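(* Let $r>0$ be an integer and let $G_{1,r}$, $G_2$, $G_3$ be the groups given by the presentations $$G_{1,r}=\langle x,y \,\|\, x^{-r}y^{-1}xyx^{r}=y^{-2}x^{r}yxy^{-1}x^{-r}y^{2}\rangle,$$ $$G_2=\langle x,y \,\|\, xy^{-1}x^{-1}yx=y^{-2}xyx^{-1}y^{-1}xy^{2}\rangle,$$ $$G_3=\langle x_1,x_2,y \,\|\, x_1=yx_2^{-1}x_1^{-1}x_2^{-1}x_1^{-1}x_2y^{-1},\ x_2=y^{-1}x_1^{2}x_2x_1x_2y\rangle .$$ 1) The group $G_{1,r}$ is a semidirect product of a normal subgroup $H$ and the infinite cyclic group $\mathbb{Z}=\langle y\rangle$, where $H$ is the amalgamated free product $$H=\cdots \underset{B_{-2}}{\ast} A_{-1}\underset{B_{-1}}{\ast} A_{0}\underset{B_{0}}{\ast} A_{1}\underset{B_{1}}{\ast}\cdots$$ with $$A_i=\langle x_{i-1},x_i,x_{i+1}\,\|\,[x_i,\,x_{i-1}^{\varepsilon}x_{i+1}^{-\varepsilon}]=1\rangle\cong(\langle x_i\rangle\times\langle x_{i-1}^{\varepsilon}x_{i+1}^{-\varepsilon}\rangle)\ast\langle x_{i+1}\rangle=(\mathbb{Z}\times\mathbb{Z})\ast\mathbb{Z}\quad\text{if } r=\varepsilon=\pm1,$$ and $$A_i=\langle x_{i-1},x_i,x_{i+1}\,\|\,x_i^{-1}(x_{i-1}^{r}x_{i+1}^{-r})x_i=x_{i-1}^{r}x_{i+1}^{-r}\rangle\quad\text{if } r\neq\pm1;$$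 all $B_i$ are isomorphic to the free group $F_2$. 2) The group $G_2$ is a semidirect product of a normal subgroup $H$ and the infinite cyclic group $\mathbb{Z}=\langle y\rangle$, where $H$ is the amalgamated free product $$H=\cdots \underset{B_{-2}}{\ast} A_{-1}\underset{B_{-1}}{\ast} A_{0}\underset{B_{0}}{\ast} A_{1}\underset{B_{1}}{\ast}\cdots$$ with $$A_i=\langle x_{i-1},x_i,x_{i+1}\,\|\,(x_{i-1}x_{i+1}^{-1})^{x_ix_{i-1}^{-1}}=(x_{i-1}x_{i+1}^{-1})^{-1}\rangle,$$ and all $B_i$ are isomorphic to $F_2$. 3) The group $G_3$ is an HNN-extension $$G_3=\langle x_1,x_2,y\,\|\,y^{-1}Ay=B,\ \varphi\rangle$$ with base group $\langle x_1,x_2\rangle=F_2$ and associated subgroups $A=\langle x_2x_1x_2,\,x_1\rangle$ and $B=\langle x_1x_2x_1,\,x_2\rangle$, which are also isomorphic to $F_2$.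
   Context: Notation: $a^b=b^{-1}ab$, $[a,b]=a^{-1}b^{-1}ab$; $\langle X\,\|\,R\rangle$ denotes the group with generators $X$ and defining relations $R$; $F_2$ is the free group of rank 2. In parts 1 and 2, $x_i=y^{-i}xy^{i}$ for $i\in\mathbb{Z}$, and $B_i=\langle x_i,x_{i+1}\rangle$ is the subgroup generated by $x_i,x_{i+1}$ in $A_i$ and in $A_{i+1}$, along which these two groups are amalgamated; so $H$ is generated by all $x_i$, $i\in\mathbb{Z}$, subject to the defining relations of all the $A_i$, and $y^{-1}x_iy=x_{i+1}$. In part 3, $y$ is the stable letter and $\varphi:A\to B$ is the isomorphism with $\varphi(x_1)=x_2^{-1}x_1^{-1}x_2^{-1}x_1^{-1}x_2$ and $\varphi(x_1^2x_2x_1x_2)=x_2$, so that $y^{-1}gy=\varphi(g)$ for $g\in A$. The groups $G_{1,r},G_2,G_3$ are groups of the virtual trefoil.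
   Formalization: In part 1 the exponent of x_{i+1} is positive throughout (x_{i-1}^ε x_{i+1}^ε and x_{i-1}^r x_{i+1}^r), since the relation of G_{1,r} says that x_1 commutes with x_0^r x_2^r, and the printed sign makes part 1 false for every r>0. *)

theory Defs
  imports "HOL-Algebra.Algebra"
begin

section \<open>Free groups and presentations\<close>

text \<open>A letter is a pair \<open>(a, e)\<close>; it stands for the generator \<open>a\<close> if \<open>e\<close> holds
  and for its inverse otherwise.  The free group is realised on reduced words.\<close>

type_synonym 'a word = "('a \<times> bool) list"

definition inv_letter :: "'a \<times> bool \<Rightarrow> 'a \<times> bool" where
  "inv_letter l = (fst l, \<not> snd l)"

definition reduced :: "'a word \<Rightarrow> bool" where
  "reduced w \<longleftrightarrow> successively (\<lambda>l m. m \<noteq> inv_letter l) w"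

fun cons_letter :: "'a \<times> bool \<Rightarrow> 'a word \<Rightarrow> 'a word" where
  "cons_letter l [] = [l]"
| "cons_letter l (m # w) = (if m = inv_letter l then w else l # m # w)"

definition free_group :: "'a set \<Rightarrow> 'a word monoid" where
  "free_group S =
     \<lparr>carrier = {w. reduced w \<and> fst ` set w \<subseteq> S},
      monoid.mult = (\<lambda>u v. foldr cons_letter u v),
      one = []\<rparr>"

definition free_gen :: "'a \<Rightarrow> 'a word" where
  "free_gen a = [(a, True)]"

definition normal_closure :: "('a, 'b) monoid_scheme \<Rightarrow> 'a set \<Rightarrow> 'a set" where
  "normal_closure G S =
     generate G {g \<otimes>\<^bsub>G\<^esub> s \<otimes>\<^bsub>G\<^esub> inv\<^bsub>G\<^esub> g | g s. g \<in> carrier G \<and> s \<in> S}"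

text \<open>A pair \<open>(u, v)\<close> in \<open>R\<close> is the defining relation \<open>u = v\<close>.\<close>

definition relators :: "'a set \<Rightarrow> ('a word \<times> 'a word) set \<Rightarrow> 'a word set" where
  "relators S R = {u \<otimes>\<^bsub>free_group S\<^esub> inv\<^bsub>free_group S\<^esub> v | u v. (u, v) \<in> R}"

definition presentation :: "'a set \<Rightarrow> ('a word \<times> 'a word) set \<Rightarrow> 'a word set monoid" where
  "presentation S R = free_group S Mod normal_closure (free_group S) (relators S R)"

definition pres_gen :: "'a set \<Rightarrow> ('a word \<times> 'a word) set \<Rightarrow> 'a \<Rightarrow> 'a word set" where
  "pres_gen S R a = normal_closure (free_group S) (relators S R) #>\<^bsub>free_group S\<^esub> free_gen a"

abbreviation F2 :: "nat word monoid" where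
  "F2 \<equiv> free_group {0, 1}"


section \<open>Constructions on groups\<close>

definition conj_by :: "('a, 'b) monoid_scheme \<Rightarrow> 'a \<Rightarrow> 'a \<Rightarrow> 'a" where
  "conj_by G a b = inv\<^bsub>G\<^esub> b \<otimes>\<^bsub>G\<^esub> a \<otimes>\<^bsub>G\<^esub> b"

definition commutator :: "('a, 'b) monoid_scheme \<Rightarrow> 'a \<Rightarrow> 'a \<Rightarrow> 'a" where
  "commutator G a b = inv\<^bsub>G\<^esub> a \<otimes>\<^bsub>G\<^esub> inv\<^bsub>G\<^esub> b \<otimes>\<^bsub>G\<^esub> a \<otimes>\<^bsub>G\<^esub> b"

definition infinite_cyclic_on :: "('a, 'b) monoid_scheme \<Rightarrow> 'a \<Rightarrow> bool" where
  "infinite_cyclic_on G a \<longleftrightarrow> G\<lparr>carrier := generate G {a}\<rparr> \<cong> integer_group"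

definition internal_semidirect :: "('a, 'b) monoid_scheme \<Rightarrow> 'a set \<Rightarrow> 'a set \<Rightarrow> bool" where
  "internal_semidirect G N K \<longleftrightarrow>
     N \<lhd> G \<and> subgroup K G \<and> N \<inter> K = {\<one>\<^bsub>G\<^esub>} \<and> N <#>\<^bsub>G\<^esub> K = carrier G"

text \<open>The multiplication table of \<open>G\<close>, on generators that are the \<open>\<iota>\<close>-images of the elements
  of \<open>G\<close>.  The free products, amalgams and HNN-extensions below are given by the multiplication
  tables of their factors together with the additional identifications.\<close>

definition table ::
  "'c set \<Rightarrow> ('a \<Rightarrow> 'c) \<Rightarrow> ('a, 'b) monoid_scheme \<Rightarrow> ('c word \<times> 'c word) set" where
  "table S \<iota> G =
     {(free_gen (\<iota> a) \<otimes>\<^bsub>free_group S\<^esub> free_gen (\<iota> b), free_gen (\<iota> (a \<otimes>\<^bsub>G\<^esub> b))) | a b.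
        a \<in> carrier G \<and> b \<in> carrier G}"

definition fp_gens ::
  "('a, 'c) monoid_scheme \<Rightarrow> ('b, 'd) monoid_scheme \<Rightarrow> ('a + 'b) set" where
  "fp_gens G K = carrier G <+> carrier K"

definition fp_rels ::
  "('a, 'c) monoid_scheme \<Rightarrow> ('b, 'd) monoid_scheme \<Rightarrow> (('a + 'b) word \<times> ('a + 'b) word) set" where
  "fp_rels G K = table (fp_gens G K) Inl G \<union> table (fp_gens G K) Inr K"

definition free_product ::
  "('a, 'c) monoid_scheme \<Rightarrow> ('b, 'd) monoid_scheme \<Rightarrow> ('a + 'b) word set monoid" where
  "free_product G K = presentation (fp_gens G K) (fp_rels G K)"

definition fp_in1 ::
  "('a, 'c) monoid_scheme \<Rightarrow> ('b, 'd) monoid_scheme \<Rightarrow> 'a \<Rightarrow> ('a + 'b) word set" where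
  "fp_in1 G K a = pres_gen (fp_gens G K) (fp_rels G K) (Inl a)"

definition fp_in2 ::
  "('a, 'c) monoid_scheme \<Rightarrow> ('b, 'd) monoid_scheme \<Rightarrow> 'b \<Rightarrow> ('a + 'b) word set" where
  "fp_in2 G K b = pres_gen (fp_gens G K) (fp_rels G K) (Inr b)"

text \<open>Amalgamated free product of a chain of groups \<open>A i\<close> indexed by the integers.  The
  subgroup \<open>B i\<close> of \<open>A i\<close> is glued to the subgroup \<open>C i\<close> of \<open>A (i + 1)\<close> along the
  isomorphism \<open>\<phi> i\<close>.\<close>

definition amalgam_data ::
  "(int \<Rightarrow> 'a monoid) \<Rightarrow> (int \<Rightarrow> 'a set) \<Rightarrow> (int \<Rightarrow> 'a set) \<Rightarrow> (int \<Rightarrow> 'a \<Rightarrow> 'a) \<Rightarrow> bool" where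
  "amalgam_data A B C \<phi> \<longleftrightarrow>
     (\<forall>i. group (A i) \<and> subgroup (B i) (A i) \<and> subgroup (C i) (A (i + 1)) \<and>
          \<phi> i \<in> iso ((A i)\<lparr>carrier := B i\<rparr>) ((A (i + 1))\<lparr>carrier := C i\<rparr>))"

definition amalgam_gens :: "(int \<Rightarrow> 'a monoid) \<Rightarrow> (int \<times> 'a) set" where
  "amalgam_gens A = (SIGMA i:UNIV. carrier (A i))"

definition amalgam_rels ::
  "(int \<Rightarrow> 'a monoid) \<Rightarrow> (int \<Rightarrow> 'a set) \<Rightarrow> (int \<Rightarrow> 'a \<Rightarrow> 'a) \<Rightarrow>
   ((int \<times> 'a) word \<times> (int \<times> 'a) word) set" where
  "amalgam_rels A B \<phi> =
     (\<Union>i. table (amalgam_gens A) (Pair i) (A i)) \<union>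
     {(free_gen (i, b), free_gen (i + 1, \<phi> i b)) | i b. b \<in> B i}"

definition amalgam ::
  "(int \<Rightarrow> 'a monoid) \<Rightarrow> (int \<Rightarrow> 'a set) \<Rightarrow> (int \<Rightarrow> 'a \<Rightarrow> 'a) \<Rightarrow> (int \<times> 'a) word set monoid" where
  "amalgam A B \<phi> = presentation (amalgam_gens A) (amalgam_rels A B \<phi>)"

definition amalgam_in ::
  "(int \<Rightarrow> 'a monoid) \<Rightarrow> (int \<Rightarrow> 'a set) \<Rightarrow> (int \<Rightarrow> 'a \<Rightarrow> 'a) \<Rightarrow> int \<Rightarrow> 'a \<Rightarrow>
   (int \<times> 'a) word set" where
  "amalgam_in A B \<phi> i a = pres_gen (amalgam_gens A) (amalgam_rels A B \<phi>) (i, a)"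

text \<open>HNN-extension with base \<open>G\<close> and associated subgroups \<open>A\<close> and \<open>B = \<phi> ` A\<close>.  The
  stable letter is \<open>None\<close>, and \<open>t\<^sup>-\<^sup>1 a t = \<phi> a\<close> for \<open>a\<close> in \<open>A\<close>.\<close>

definition hnn_data ::
  "('a, 'b) monoid_scheme \<Rightarrow> 'a set \<Rightarrow> 'a set \<Rightarrow> ('a \<Rightarrow> 'a) \<Rightarrow> bool" where
  "hnn_data G A B \<phi> \<longleftrightarrow>
     group G \<and> subgroup A G \<and> subgroup B G \<and> \<phi> \<in> iso (G\<lparr>carrier := A\<rparr>) (G\<lparr>carrier := B\<rparr>)"

definition hnn_gens :: "('a, 'b) monoid_scheme \<Rightarrow> 'a option set" where
  "hnn_gens G = insert None (Some ` carrier G)"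

definition hnn_rels ::
  "('a, 'b) monoid_scheme \<Rightarrow> 'a set \<Rightarrow> ('a \<Rightarrow> 'a) \<Rightarrow>
   ('a option word \<times> 'a option word) set" where
  "hnn_rels G A \<phi> =
     table (hnn_gens G) Some G \<union>
     {(conj_by (free_group (hnn_gens G)) (free_gen (Some a)) (free_gen None),
       free_gen (Some (\<phi> a))) | a. a \<in> A}"

definition hnn ::
  "('a, 'b) monoid_scheme \<Rightarrow> 'a set \<Rightarrow> ('a \<Rightarrow> 'a) \<Rightarrow> 'a option word set monoid" where
  "hnn G A \<phi> = presentation (hnn_gens G) (hnn_rels G A \<phi>)"

definition hnn_in ::
  "('a, 'b) monoid_scheme \<Rightarrow> 'a set \<Rightarrow> ('a \<Rightarrow> 'a) \<Rightarrow> 'a \<Rightarrow> 'a option word set" where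
  "hnn_in G A \<phi> a = pres_gen (hnn_gens G) (hnn_rels G A \<phi>) (Some a)"

definition hnn_stable ::
  "('a, 'b) monoid_scheme \<Rightarrow> 'a set \<Rightarrow> ('a \<Rightarrow> 'a) \<Rightarrow> 'a option word set" where
  "hnn_stable G A \<phi> = pres_gen (hnn_gens G) (hnn_rels G A \<phi>) None"


section \<open>The groups of the virtual trefoil\<close>

datatype gen_xy = Gx | Gy
datatype gen_xxy = Hx1 | Hx2 | Hy

context
  fixes F :: "('a, 'b) monoid_scheme" (structure)
begin

definition rel_G1 :: "int \<Rightarrow> 'a \<Rightarrow> 'a \<Rightarrow> 'a \<times> 'a" where
  "rel_G1 r x y =
     (x [^] (- r) \<otimes> inv y \<otimes> x \<otimes> y \<otimes> x [^] r,
      y [^] (- 2 :: int) \<otimes> x [^] r \<otimes> y \<otimes> x \<otimes> inv y \<otimes> x [^] (- r) \<otimes> y [^] (2 :: int))"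

definition rel_G2 :: "'a \<Rightarrow> 'a \<Rightarrow> 'a \<times> 'a" where
  "rel_G2 x y =
     (x \<otimes> inv y \<otimes> inv x \<otimes> y \<otimes> x,
      y [^] (- 2 :: int) \<otimes> x \<otimes> y \<otimes> inv x \<otimes> inv y \<otimes> x \<otimes> y [^] (2 :: int))"

definition rels_G3 :: "'a \<Rightarrow> 'a \<Rightarrow> 'a \<Rightarrow> ('a \<times> 'a) set" where
  "rels_G3 x\<^sub>1 x\<^sub>2 y =
     {(x\<^sub>1, y \<otimes> inv x\<^sub>2 \<otimes> inv x\<^sub>1 \<otimes> inv x\<^sub>2 \<otimes> inv x\<^sub>1 \<otimes> x\<^sub>2 \<otimes> inv y),
      (x\<^sub>2, inv y \<otimes> x\<^sub>1 [^] (2 :: int) \<otimes> x\<^sub>2 \<otimes> x\<^sub>1 \<otimes> x\<^sub>2 \<otimes> y)}"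

text \<open>In the next three relations \<open>a\<close>, \<open>b\<close>, \<open>c\<close> stand for \<open>x\<^sub>i\<^sub>-\<^sub>1\<close>, \<open>x\<^sub>i\<close>, \<open>x\<^sub>i\<^sub>+\<^sub>1\<close>.

  The exponent of \<open>c\<close> in the first two is positive.  With \<open>x\<^sub>i = y\<^sup>-\<^sup>i x y\<^sup>i\<close>, the relation of
  \<open>rel_G1\<close> reads \<open>x\<^sub>0\<^sup>-\<^sup>r x\<^sub>1 x\<^sub>0\<^sup>r = x\<^sub>2\<^sup>r x\<^sub>1 x\<^sub>2\<^sup>-\<^sup>r\<close>, so \<open>x\<^sub>1\<close> commutes with \<open>x\<^sub>0\<^sup>r x\<^sub>2\<^sup>r\<close>.  It
  does not commute with \<open>x\<^sub>0\<^sup>r x\<^sub>2\<^sup>-\<^sup>r\<close>, which is how the relation appears in print.\<close>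

definition rel_A1_comm :: "int \<Rightarrow> 'a \<Rightarrow> 'a \<Rightarrow> 'a \<Rightarrow> 'a \<times> 'a" where
  "rel_A1_comm \<epsilon> a b c = (commutator F b (a [^] \<epsilon> \<otimes> c [^] \<epsilon>), \<one>)"

definition rel_A1_conj :: "int \<Rightarrow> 'a \<Rightarrow> 'a \<Rightarrow> 'a \<Rightarrow> 'a \<times> 'a" where
  "rel_A1_conj r a b c = (inv b \<otimes> (a [^] r \<otimes> c [^] r) \<otimes> b, a [^] r \<otimes> c [^] r)"

definition rel_A2 :: "'a \<Rightarrow> 'a \<Rightarrow> 'a \<Rightarrow> 'a \<times> 'a" where
  "rel_A2 a b c = (conj_by F (a \<otimes> inv c) (b \<otimes> inv a), inv (a \<otimes> inv c))"

definition shift :: "'a \<Rightarrow> 'a \<Rightarrow> int \<Rightarrow> 'a" where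
  "shift x y i = y [^] (- i) \<otimes> x \<otimes> y [^] i"

end

definition rels_G1 :: "int \<Rightarrow> (gen_xy word \<times> gen_xy word) set" where
  "rels_G1 r = {rel_G1 (free_group {Gx, Gy}) r (free_gen Gx) (free_gen Gy)}"

definition G1 :: "int \<Rightarrow> gen_xy word set monoid" where
  "G1 r = presentation {Gx, Gy} (rels_G1 r)"

definition G1_gen :: "int \<Rightarrow> gen_xy \<Rightarrow> gen_xy word set" where
  "G1_gen r = pres_gen {Gx, Gy} (rels_G1 r)"

definition rels_G2 :: "(gen_xy word \<times> gen_xy word) set" where
  "rels_G2 = {rel_G2 (free_group {Gx, Gy}) (free_gen Gx) (free_gen Gy)}"

definition G2 :: "gen_xy word set monoid" where
  "G2 = presentation {Gx, Gy} rels_G2"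

definition G2_gen :: "gen_xy \<Rightarrow> gen_xy word set" where
  "G2_gen = pres_gen {Gx, Gy} rels_G2"

definition G3_rels :: "(gen_xxy word \<times> gen_xxy word) set" where
  "G3_rels = rels_G3 (free_group {Hx1, Hx2, Hy}) (free_gen Hx1) (free_gen Hx2) (free_gen Hy)"

definition G3 :: "gen_xxy word set monoid" where
  "G3 = presentation {Hx1, Hx2, Hy} G3_rels"

definition G3_gen :: "gen_xxy \<Rightarrow> gen_xxy word set" where
  "G3_gen = pres_gen {Hx1, Hx2, Hy} G3_rels"


section \<open>The factors of the amalgams\<close>

text \<open>The generator \<open>x\<^sub>j\<close> of a factor is the integer \<open>j\<close>.\<close>

definition rels_A1 :: "int \<Rightarrow> int \<Rightarrow> (int word \<times> int word) set" where
  "rels_A1 r i =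
     (let F = free_group {i - 1, i, i + 1};
          a = free_gen (i - 1); b = free_gen i; c = free_gen (i + 1)
      in if r = 1 \<or> r = - 1 then {rel_A1_comm F r a b c} else {rel_A1_conj F r a b c})"

definition rels_A2 :: "int \<Rightarrow> (int word \<times> int word) set" where
  "rels_A2 i =
     {rel_A2 (free_group {i - 1, i, i + 1}) (free_gen (i - 1)) (free_gen i) (free_gen (i + 1))}"

context
  fixes R :: "int \<Rightarrow> (int word \<times> int word) set"
begin

definition chain_factor :: "int \<Rightarrow> int word set monoid" where
  "chain_factor i = presentation {i - 1, i, i + 1} (R i)"

definition factor_gen :: "int \<Rightarrow> int \<Rightarrow> int word set" where
  "factor_gen i j = pres_gen {i - 1, i, i + 1} (R i) j"

text \<open>The subgroup generated by \<open>x\<^sub>i\<close> and \<open>x\<^sub>i\<^sub>+\<^sub>1\<close>, in the factor \<open>i\<close> and in the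
  factor \<open>i + 1\<close>.\<close>

definition edge_in :: "int \<Rightarrow> int word set set" where
  "edge_in i = generate (chain_factor i) {factor_gen i i, factor_gen i (i + 1)}"

definition edge_out :: "int \<Rightarrow> int word set set" where
  "edge_out i = generate (chain_factor (i + 1)) {factor_gen (i + 1) i, factor_gen (i + 1) (i + 1)}"

end

end

theory Submission
  imports Defs
begin

text \<open>All the isomorphisms come from universal properties, and the only points at which an element has to be
  shown nontrivial are settled by explicit homomorphisms.  The group \<open>\<langle>x\<^sub>i, x\<^sub>i\<^sub>+\<^sub>1\<rangle>\<close> is free in both
  factors because each factor retracts onto a free group when its remaining generator is
  expressed by the opposite one.  The kernel \<open>H\<close> is compared with the amalgam \<open>M\<close> by a homomorphism from the
  two-generator group to the unrestricted wreath product of \<open>M\<close> and \<open>\<int>\<close>: it sends \<open>x\<close> to the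
  sequence of the \<open>x\<^sub>k\<close> and \<open>y\<close> to the shift, so that \<open>y\<^sup>-\<^sup>j x y\<^sup>j\<close> has \<open>x\<^sub>j\<close> at place \<open>0\<close>.  The same
  wreath product, over a free group, shows that \<open>x\<^sub>1\<close> and \<open>x\<^sub>2 x\<^sub>1 x\<^sub>2\<close> generate a free group of
  rank two.\<close>

section \<open>Homomorphisms and generators\<close>

text \<open>The usual proof that \<open>H\<close> is the amalgam relies on normal forms, or on the
  semidirect product of \<open>M\<close> by the automorphism that moves each factor to the next.
  Both are avoided here. The groups are given by multiplication tables, so distinctness of elements
  is hard to read off, and the automorphism would require compatible isomorphisms between all the
  factors. In the wreath product the shift exists from the outset, and the one relation between
  \<open>x\<close> and \<open>y\<close> is checked place by place: at place \<open>k\<close> it is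
  the relation of the factor \<open>k + 1\<close>. The sequence of all \<open>x_k\<close> does not
  have finite support, which is why the product is unrestricted. The integer component doubles as
  the degree that separates the powers of \<open>y\<close> from one another and from
  \<open>H\<close>.

  For the third group the associated subgroups have explicit bases, an automorphism of the free
  group connects these bases, and the HNN relations for all elements of \<open>A\<close> follow from
  those for two generators.\<close>

lemma hom_eq_on_generate:
  assumes "group G" "group K" "U \<subseteq> carrier G"
    and h: "h \<in> hom (G\<lparr>carrier := generate G U\<rparr>) K"
    and k: "k \<in> hom (G\<lparr>carrier := generate G U\<rparr>) K"
    and eq: "\<And>x. x \<in> U \<Longrightarrow> h x = k x"
    and w: "w \<in> generate G U"
  shows "h w = k w"
proof -
  interpret G: group G by fact
  let ?H = "G\<lparr>carrier := generate G U\<rparr>"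
  have sub: "subgroup (generate G U) G"
    using assms(3) by (rule G.generate_is_subgroup)
  then have "group ?H"
    by (rule G.subgroup_imp_group)
  then interpret h: group_hom ?H K h + k: group_hom ?H K k
    using \<open>group K\<close> h k by (auto simp: group_hom_def group_hom_axioms_def)
  show ?thesis
    using w
  proof induction
    case one
    then show ?case using h.hom_one k.hom_one by simp
  next
    case (incl x)
    then show ?case by (rule eq)
  next
    case (inv x)
    then have "x \<in> carrier ?H" by (simp add: generate.incl)
    then show ?case
      using h.hom_inv[of x] k.hom_inv[of x] eq[OF inv] G.m_inv_consistent[OF sub, of x] by simp
  next
    case (eng a b)
    then show ?case
      using h.hom_mult[of a b] k.hom_mult[of a b] by simp
  qed
qed

lemma hom_eq_on_carrier:
  assumes "group G" "group K" "U \<subseteq> carrier G" "generate G U = carrier G"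
    and "h \<in> hom G K" "k \<in> hom G K" "\<And>x. x \<in> U \<Longrightarrow> h x = k x" "w \<in> carrier G"
  shows "h w = k w"
  using hom_eq_on_generate[of G K U h k w] assms by simp

lemma hom_generate_image:
  assumes "group G" "group K" "h \<in> hom G K" "U \<subseteq> carrier G"
  shows "h ` generate G U = generate K (h ` U)"
proof -
  interpret group_hom G K h
    using assms by (simp add: group_hom_def group_hom_axioms_def)
  show ?thesis using generate_img[OF assms(4)] by simp
qed

lemma hom_restrict_carrier:
  "h \<in> hom G K \<Longrightarrow> H \<subseteq> carrier G \<Longrightarrow> h \<in> hom (G\<lparr>carrier := H\<rparr>) K"
  by (auto simp: hom_def)

lemma hom_into_restrict_carrier:
  "h \<in> hom G (K\<lparr>carrier := H\<rparr>) \<Longrightarrow> H \<subseteq> carrier K \<Longrightarrow> h \<in> hom G K"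
  by (auto simp: hom_def)

text \<open>Both composites are homomorphisms that agree with the identity on generators.
  Comparisons of presented groups thereby reduce to the images of generators, and no kernel has to
  be computed.\<close>

lemma group_isomorphismsI_generators:
  assumes "group G" "group K"
    and U: "U \<subseteq> carrier G" "generate G U = carrier G"
    and V: "V \<subseteq> carrier K" "generate K V = carrier K"
    and f: "f \<in> hom G K" and g: "g \<in> hom K G"
    and gf: "\<And>x. x \<in> U \<Longrightarrow> g (f x) = x" and fg: "\<And>y. y \<in> V \<Longrightarrow> f (g y) = y"
  shows "group_isomorphisms G K f g"
proof -
  have "(g \<circ> f) x = id x" if "x \<in> carrier G" for x
    by (rule hom_eq_on_carrier[OF \<open>group G\<close> \<open>group G\<close> U hom_compose[OF f g]])
      (use gf that in \<open>auto simp: hom_def\<close>)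
  moreover have "(f \<circ> g) y = id y" if "y \<in> carrier K" for y
    by (rule hom_eq_on_carrier[OF \<open>group K\<close> \<open>group K\<close> V hom_compose[OF g f]])
      (use fg that in \<open>auto simp: hom_def\<close>)
  ultimately show ?thesis
    using f g by (simp add: group_isomorphisms_def)
qed


section \<open>Free groups\<close>

lemma inv_letter_inv_letter [simp]: "inv_letter (inv_letter l) = l"
  by (simp add: inv_letter_def)

lemma fst_inv_letter [simp]: "fst (inv_letter l) = fst l"
  by (simp add: inv_letter_def)

lemma reduced_Nil [simp]: "reduced []"
  by (simp add: reduced_def)

lemma reduced_tl: "reduced (l # w) \<Longrightarrow> reduced w"
  by (cases w) (auto simp: reduced_def)

lemma reduced_cons_letter: "reduced w \<Longrightarrow> reduced (cons_letter l w)"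
  by (cases w) (auto simp: reduced_def successively_Cons)

lemma reduced_foldr_cons_letter: "reduced w \<Longrightarrow> reduced (foldr cons_letter u w)"
  by (induction u) (auto intro: reduced_cons_letter)

lemma cons_letter_reduced: "reduced (l # w) \<Longrightarrow> cons_letter l w = l # w"
  by (cases w) (auto simp: reduced_def)

text \<open>Van der Waerden's device: every letter permutes the reduced words, and the inverse
  letter is the inverse permutation. Associativity of the reduced product is then composition of
  permutations.\<close>

lemma cons_letter_inverse:
  "reduced w \<Longrightarrow> cons_letter l (cons_letter (inv_letter l) w) = w"
  by (cases w) (auto simp: reduced_def successively_Cons cons_letter_reduced)

lemma foldr_cons_letter_Nil: "reduced w \<Longrightarrow> foldr cons_letter w [] = w"
proof (induction w)
  case (Cons l w)
  then show ?case using reduced_tl[of l w] by (simp add: cons_letter_reduced)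
qed simp

text \<open>If \<open>l\<close> cancels against the head of \<open>v\<close>, the right-hand side
  applies a letter after its inverse, which is the identity on reduced words; otherwise both sides
  unfold to the same expression.\<close>

lemma foldr_cons_letter_cons_letter:
  assumes "reduced w"
  shows "foldr cons_letter (cons_letter l v) w = cons_letter l (foldr cons_letter v w)"
  using assms
  by (cases v) (auto simp: cons_letter_inverse reduced_foldr_cons_letter)

lemma foldr_cons_letter_assoc:
  assumes "reduced w"
  shows "foldr cons_letter (foldr cons_letter u v) w = foldr cons_letter u (foldr cons_letter v w)"
  using assms by (induction u) (auto simp: foldr_cons_letter_cons_letter)

lemma set_cons_letter: "set (cons_letter l w) \<subseteq> insert l (set w)"
  by (cases w) auto

lemma set_foldr_cons_letter: "set (foldr cons_letter u w) \<subseteq> set u \<union> set w"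
proof (induction u)
  case (Cons l u)
  then show ?case using set_cons_letter[of l "foldr cons_letter u w"] by auto
qed auto

lemma foldr_cons_letter_inverse:
  "reduced w \<Longrightarrow> foldr cons_letter (rev (map inv_letter u)) (foldr cons_letter u w) = w"
proof (induction u)
  case (Cons l u)
  then show ?case
    using cons_letter_inverse[of "foldr cons_letter u w" "inv_letter l"]
    by (simp add: reduced_foldr_cons_letter)
qed auto

lemma group_free_group [simp, intro]: "group (free_group S)"
proof (rule groupI)
  fix u v
  assume u: "u \<in> carrier (free_group S)" and v: "v \<in> carrier (free_group S)"
  then show "u \<otimes>\<^bsub>free_group S\<^esub> v \<in> carrier (free_group S)"
    using set_foldr_cons_letter[of u v]
    by (fastforce simp: free_group_def reduced_foldr_cons_letter)
  fix w
  assume w: "w \<in> carrier (free_group S)"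
  then show "u \<otimes>\<^bsub>free_group S\<^esub> v \<otimes>\<^bsub>free_group S\<^esub> w = u \<otimes>\<^bsub>free_group S\<^esub> (v \<otimes>\<^bsub>free_group S\<^esub> w)"
    by (simp add: free_group_def foldr_cons_letter_assoc)
next
  fix u
  assume u: "u \<in> carrier (free_group S)"
  \<comment> \<open>Folding the reversed, inverted word onto the empty word makes the result reduced
    by construction.\<close>
  let ?v = "foldr cons_letter (rev (map inv_letter u)) []"
  have "set ?v \<subseteq> inv_letter ` set u"
    using set_foldr_cons_letter[of "rev (map inv_letter u)" "[]"] by simp
  then have "?v \<in> carrier (free_group S)"
    using u by (fastforce simp: free_group_def reduced_foldr_cons_letter)
  moreover have "?v \<otimes>\<^bsub>free_group S\<^esub> u = \<one>\<^bsub>free_group S\<^esub>"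
    using u foldr_cons_letter_inverse[of "[]" u]
    by (simp add: free_group_def foldr_cons_letter_assoc foldr_cons_letter_Nil)
  ultimately show "\<exists>v \<in> carrier (free_group S). v \<otimes>\<^bsub>free_group S\<^esub> u = \<one>\<^bsub>free_group S\<^esub>"
    by blast
qed (auto simp: free_group_def)

lemma free_gen_in_carrier [simp]: "free_gen a \<in> carrier (free_group S) \<longleftrightarrow> a \<in> S"
  by (simp add: free_gen_def free_group_def reduced_def)

lemma free_group_inv_gen:
  assumes "a \<in> S"
  shows "inv\<^bsub>free_group S\<^esub> (free_gen a) = [(a, False)]"
  by (rule group.inv_equality[OF group_free_group])
    (use assms in \<open>auto simp: free_gen_def free_group_def reduced_def inv_letter_def\<close>)

lemma free_group_generated: "generate (free_group S) (free_gen ` S) = carrier (free_group S)"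
proof
  have sub: "free_gen ` S \<subseteq> carrier (free_group S)"
    by auto
  then show "generate (free_group S) (free_gen ` S) \<subseteq> carrier (free_group S)"
    by (rule group.generate_incl[OF group_free_group])
  have "w \<in> generate (free_group S) (free_gen ` S)" if "reduced w" "fst ` set w \<subseteq> S" for w
    using that
  proof (induction w)
    case Nil
    then show ?case
      using generate.one[of "free_group S" "free_gen ` S"] by (simp add: free_group_def)
  next
    case (Cons l w)
    obtain a e where l: "l = (a, e)" by (cases l)
    have IH: "w \<in> generate (free_group S) (free_gen ` S)"
      using Cons by (auto dest: reduced_tl)
    have a: "a \<in> S" using Cons.prems l by simp
    have "l # w = [l] \<otimes>\<^bsub>free_group S\<^esub> w"
      using Cons.prems by (simp add: free_group_def cons_letter_reduced)
    moreover have "[l] \<in> generate (free_group S) (free_gen ` S)"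
    proof (cases e)
      case True
      then show ?thesis
        using a generate.incl[of "free_gen a" "free_gen ` S"] l by (simp add: free_gen_def)
    next
      case False
      then show ?thesis
        using a generate.inv[of "free_gen a" "free_gen ` S" "free_group S"] l
        by (simp add: free_group_inv_gen)
    qed
    ultimately show ?case
      using generate.eng IH by metis
  qed
  then show "carrier (free_group S) \<subseteq> generate (free_group S) (free_gen ` S)"
    by (auto simp: free_group_def)
qed

section \<open>Evaluation of words and the universal property of free groups\<close>

definition letter_value :: "('b, 'c) monoid_scheme \<Rightarrow> ('a \<Rightarrow> 'b) \<Rightarrow> 'a \<times> bool \<Rightarrow> 'b" where
  "letter_value K f l = (if snd l then f (fst l) else inv\<^bsub>K\<^esub> f (fst l))"

text \<open>The alphabet does not enter, so one and the same function is the induced homomorphism on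
  the free group over every alphabet whose letters \<open>f\<close> sends into \<open>K\<close>.
  Evaluations of a group and of a subset of its generators can thus be compared directly.\<close>

definition free_lift :: "('b, 'c) monoid_scheme \<Rightarrow> ('a \<Rightarrow> 'b) \<Rightarrow> 'a word \<Rightarrow> 'b" where
  "free_lift K f w = foldr (\<lambda>l. monoid.mult K (letter_value K f l)) w \<one>\<^bsub>K\<^esub>"

lemma free_lift_Nil [simp]: "free_lift K f [] = \<one>\<^bsub>K\<^esub>"
  and free_lift_Cons [simp]: "free_lift K f (l # w) = letter_value K f l \<otimes>\<^bsub>K\<^esub> free_lift K f w"
  by (simp_all add: free_lift_def)

context group
begin

lemma letter_value_closed: "f \<in> S \<rightarrow> carrier G \<Longrightarrow> fst l \<in> S \<Longrightarrow> letter_value G f l \<in> carrier G"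
  by (auto simp: letter_value_def)

lemma letter_value_inv_letter:
  "f \<in> S \<rightarrow> carrier G \<Longrightarrow> fst l \<in> S \<Longrightarrow> letter_value G f l \<otimes> letter_value G f (inv_letter l) = \<one>"
  by (auto simp: letter_value_def inv_letter_def Pi_iff)

lemma free_lift_closed:
  "f \<in> S \<rightarrow> carrier G \<Longrightarrow> fst ` set w \<subseteq> S \<Longrightarrow> free_lift G f w \<in> carrier G"
  by (induction w) (auto simp: letter_value_closed)

lemma free_lift_cons_letter:
  assumes f: "f \<in> S \<rightarrow> carrier G" and l: "fst l \<in> S" and w: "fst ` set w \<subseteq> S"
  shows "free_lift G f (cons_letter l w) = letter_value G f l \<otimes> free_lift G f w"
proof (cases w)
  case (Cons m v)
  have *: "letter_value G f l \<in> carrier G" "letter_value G f (inv_letter l) \<in> carrier G"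
    "free_lift G f v \<in> carrier G"
    using assms Cons by (auto intro: letter_value_closed free_lift_closed)
  then show ?thesis
    using Cons letter_value_inv_letter[OF f l] m_assoc[OF *, symmetric] by simp
qed simp

lemma free_lift_foldr_cons_letter:
  assumes f: "f \<in> S \<rightarrow> carrier G" and "fst ` set u \<subseteq> S" and w: "fst ` set w \<subseteq> S"
  shows "free_lift G f (foldr cons_letter u w) = free_lift G f u \<otimes> free_lift G f w"
  using assms(2)
proof (induction u)
  case Nil
  then show ?case using f w by (simp add: free_lift_closed)
next
  case (Cons l u)
  have "fst ` set (foldr cons_letter u w) \<subseteq> S"
    using set_foldr_cons_letter[of u w] Cons.prems w by fastforce
  then have "free_lift G f (foldr cons_letter (l # u) w)
      = letter_value G f l \<otimes> free_lift G f (foldr cons_letter u w)"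
    using f Cons.prems by (simp add: free_lift_cons_letter)
  then show ?case
    using Cons f w letter_value_closed[OF f] free_lift_closed[OF f]
    by (simp add: m_assoc)
qed

lemma free_lift_hom:
  "f \<in> S \<rightarrow> carrier G \<Longrightarrow> free_lift G f \<in> hom (free_group S) G"
  by (rule homI) (auto simp: free_group_def free_lift_closed free_lift_foldr_cons_letter)

lemma free_lift_gen: "f a \<in> carrier G \<Longrightarrow> free_lift G f (free_gen a) = f a"
  by (simp add: free_gen_def letter_value_def)

lemma free_lift_unique:
  assumes "h \<in> hom (free_group S) G" "\<And>a. a \<in> S \<Longrightarrow> h (free_gen a) = f a"
    and "w \<in> carrier (free_group S)"
  shows "free_lift G f w = h w"
proof -
  have f: "f \<in> S \<rightarrow> carrier G"
    using assms(1,2) by (force simp: hom_def Pi_iff simp flip: assms(2))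
  show ?thesis
    by (rule hom_eq_on_carrier[OF group_free_group is_group _ free_group_generated])
      (use assms f in \<open>auto intro: free_lift_hom simp: free_lift_gen Pi_iff\<close>)
qed

lemma hom_free_lift:
  assumes "group K" "h \<in> hom G K" "f \<in> S \<rightarrow> carrier G" "w \<in> carrier (free_group S)"
  shows "h (free_lift G f w) = free_lift K (\<lambda>a. h (f a)) w"
proof -
  have "free_lift K (\<lambda>a. h (f a)) w = (h \<circ> free_lift G f) w"
    by (rule group.free_lift_unique[OF \<open>group K\<close> Group.hom_compose[OF free_lift_hom[OF assms(3)] assms(2)]])
      (use assms in \<open>auto simp: free_lift_gen Pi_iff\<close>)
  then show ?thesis by simp
qed

end

lemma free_lift_cong:
  "(\<And>a. a \<in> S \<Longrightarrow> f a = g a) \<Longrightarrow> w \<in> carrier (free_group S) \<Longrightarrow> free_lift K f w = free_lift K g w"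
  unfolding free_lift_def by (rule foldr_cong) (auto simp: free_group_def letter_value_def)

lemma free_group_iso_bij:
  assumes "bij_betw f S T"
  shows "free_group S \<cong> free_group T"
proof -
  define g where "g = inv_into S f"
  have f: "f a \<in> T" "g (f a) = a" if "a \<in> S" for a
    using assms that by (auto simp: g_def bij_betw_def)
  have g: "g b \<in> S" "f (g b) = b" if "b \<in> T" for b
    using assms that by (auto simp: g_def bij_betw_def inv_into_into f_inv_into_f)
  have "group_isomorphisms (free_group S) (free_group T)
      (free_lift (free_group T) (free_gen \<circ> f)) (free_lift (free_group S) (free_gen \<circ> g))"
    by (rule group_isomorphismsI_generators[OF _ _ _ free_group_generated _ free_group_generated])
      (use f g in \<open>auto intro!: group.free_lift_hom simp: group.free_lift_gen\<close>)
  then show ?thesis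
    using group_isomorphisms_imp_iso unfolding is_iso_def by blast
qed

lemma free_group_pair_iso_F2:
  assumes "a \<noteq> b"
  shows "free_group {a, b} \<cong> F2"
proof (rule free_group_iso_bij)
  show "bij_betw (\<lambda>c. if c = a then 0 else 1) {a, b} {0, 1 :: nat}"
    using assms by (auto simp: bij_betw_def inj_on_def)
qed

text \<open>The left inverse \<open>k\<close> may be any function. This freedom is used where
  \<open>k\<close> evaluates a wreath product element at place \<open>0\<close>, an operation that
  is multiplicative only on a suitable subgroup.\<close>

lemma free_lift_iso_generate:
  assumes "group G" and f: "f \<in> S \<rightarrow> carrier G"
    and k: "\<And>w. w \<in> carrier (free_group S) \<Longrightarrow> k (free_lift G f w) = w"
  shows "free_lift G f \<in> iso (free_group S) (G\<lparr>carrier := generate G (f ` S)\<rparr>)"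
proof -
  interpret group G by fact
  have hom: "free_lift G f \<in> hom (free_group S) G"
    using f by (rule free_lift_hom)
  have "free_lift G f ` carrier (free_group S) = generate G (free_lift G f ` free_gen ` S)"
    using hom_generate_image[OF group_free_group \<open>group G\<close> hom, of "free_gen ` S"]
    by (simp add: free_group_generated image_subset_iff)
  also have "free_lift G f ` free_gen ` S = f ` S"
    using f by (auto simp: image_image free_lift_gen Pi_iff)
  finally have img: "free_lift G f ` carrier (free_group S) = generate G (f ` S)" .
  have "inj_on (free_lift G f) (carrier (free_group S))"
    using k by (rule inj_on_inverseI)
  then show ?thesis
    using hom img unfolding iso_def bij_betw_def by (auto simp: hom_def)
qed


section \<open>Presentations\<close>

lemma normal_closure_normal:
  fixes G (structure)
  assumes "group G" "U \<subseteq> carrier G"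
  shows "normal_closure G U \<lhd> G"
proof -
  interpret group G by fact
  show ?thesis
    unfolding normal_closure_def
  proof (rule normal_generateI)
    fix h g
    assume "h \<in> {g \<otimes> s \<otimes> inv g |g s. g \<in> carrier G \<and> s \<in> U}" and g: "g \<in> carrier G"
    then obtain k s where h: "h = k \<otimes> s \<otimes> inv k" "k \<in> carrier G" "s \<in> U"
      by blast
    then have "g \<otimes> h \<otimes> inv g = (g \<otimes> k) \<otimes> s \<otimes> inv (g \<otimes> k)"
      using assms g by (auto simp: m_assoc inv_mult_group)
    then show "g \<otimes> h \<otimes> inv g \<in> {g \<otimes> s \<otimes> inv g |g s. g \<in> carrier G \<and> s \<in> U}"
      using g h by blast
  qed (use assms in auto)
qed

lemma normal_closure_incl:
  fixes G (structure)
  assumes "group G" "U \<subseteq> carrier G" "s \<in> U"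
  shows "s \<in> normal_closure G U"
proof -
  interpret group G by fact
  have "s = \<one> \<otimes> s \<otimes> inv \<one>"
    using assms by auto
  then show ?thesis
    unfolding normal_closure_def using assms(3) by (blast intro: generate.incl)
qed

lemma normal_closure_minimal:
  assumes "N \<lhd> G" "U \<subseteq> N"
  shows "normal_closure G U \<subseteq> N"
proof -
  interpret normal N G by fact
  show ?thesis
    unfolding normal_closure_def
    by (rule generate_subgroup_incl) (use assms in \<open>auto intro: inv_op_closed2 subgroup_axioms\<close>)
qed

locale group_presentation =
  fixes S :: "'a set" and R :: "('a word \<times> 'a word) set"
  assumes relation_words: "R \<subseteq> carrier (free_group S) \<times> carrier (free_group S)"
begin

lemma relators_closed: "relators S R \<subseteq> carrier (free_group S)"
proof -
  interpret group "free_group S" by simp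
  have *: "u \<otimes>\<^bsub>free_group S\<^esub> inv\<^bsub>free_group S\<^esub> v \<in> carrier (free_group S)" if "(u, v) \<in> R" for u v
    using that relation_words by (intro m_closed inv_closed) auto
  show ?thesis
    by (auto simp: relators_def intro: *)
qed

lemma normal_closure_relators:
  "normal_closure (free_group S) (relators S R) \<lhd> free_group S"
  by (rule normal_closure_normal) (auto simp: relators_closed[THEN subsetD])

lemma group_presentation [simp, intro]: "group (presentation S R)"
  unfolding presentation_def by (rule normal.factorgroup_is_group[OF normal_closure_relators])

lemma pres_gen_closed: "s \<in> S \<Longrightarrow> pres_gen S R s \<in> carrier (presentation S R)"
  by (auto simp: pres_gen_def presentation_def carrier_FactGroup)

lemma free_lift_pres_gen:
  assumes "w \<in> carrier (free_group S)"
  shows "free_lift (presentation S R) (pres_gen S R) w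
    = normal_closure (free_group S) (relators S R) #>\<^bsub>free_group S\<^esub> w"
  by (rule group.free_lift_unique[where S = S])
    (use normal.r_coset_hom_Mod[OF normal_closure_relators] assms in
      \<open>auto simp: presentation_def[symmetric] pres_gen_def\<close>)

lemma presentation_generated:
  "generate (presentation S R) (pres_gen S R ` S) = carrier (presentation S R)"
proof -
  let ?N = "normal_closure (free_group S) (relators S R)"
  let ?h = "\<lambda>w. ?N #>\<^bsub>free_group S\<^esub> w"
  have "?h ` carrier (free_group S) = carrier (presentation S R)"
    by (simp add: presentation_def carrier_FactGroup)
  moreover have "?h ` generate (free_group S) (free_gen ` S) = generate (presentation S R) (?h ` free_gen ` S)"
    by (rule hom_generate_image)
      (use normal.r_coset_hom_Mod[OF normal_closure_relators] in
        \<open>auto simp: presentation_def[symmetric]\<close>)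
  ultimately show ?thesis
    by (simp add: free_group_generated image_image pres_gen_def)
qed

lemma presentation_relation:
  assumes "(u, v) \<in> R"
  shows "free_lift (presentation S R) (pres_gen S R) u = free_lift (presentation S R) (pres_gen S R) v"
proof -
  interpret F: group "free_group S" by simp
  let ?N = "normal_closure (free_group S) (relators S R)"
  interpret N: normal ?N "free_group S" by (rule normal_closure_relators)
  have uv: "u \<in> carrier (free_group S)" "v \<in> carrier (free_group S)"
    using assms relation_words by auto
  have "u \<otimes>\<^bsub>free_group S\<^esub> inv\<^bsub>free_group S\<^esub> v \<in> ?N"
    by (rule normal_closure_incl[OF F.is_group relators_closed])
      (use assms in \<open>auto simp: relators_def\<close>)
  then have "?N #>\<^bsub>free_group S\<^esub> (u \<otimes>\<^bsub>free_group S\<^esub> inv\<^bsub>free_group S\<^esub> v) = ?N"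
    using uv N.subgroup_axioms by (intro F.coset_join2) auto
  then have "?N #>\<^bsub>free_group S\<^esub> v = ?N #>\<^bsub>free_group S\<^esub> (u \<otimes>\<^bsub>free_group S\<^esub> inv\<^bsub>free_group S\<^esub> v \<otimes>\<^bsub>free_group S\<^esub> v)"
    using uv by (metis F.coset_mult_assoc F.inv_closed F.m_closed N.subset)
  then have "?N #>\<^bsub>free_group S\<^esub> u = ?N #>\<^bsub>free_group S\<^esub> v"
    using uv by (simp add: F.m_assoc)
  then show ?thesis
    using uv by (simp add: free_lift_pres_gen)
qed

text \<open>Von Dyck's theorem. The kernel of the evaluation is normal and contains the relators,
  hence contains their normal closure, and the evaluation factors through the quotient.\<close>

lemma presentation_lift:
  assumes "group K" and f: "f \<in> S \<rightarrow> carrier K"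
    and rel: "\<And>u v. (u, v) \<in> R \<Longrightarrow> free_lift K f u = free_lift K f v"
  obtains h where "h \<in> hom (presentation S R) K" "\<And>s. s \<in> S \<Longrightarrow> h (pres_gen S R s) = f s"
proof -
  interpret K: group K by fact
  interpret F: group "free_group S" by simp
  let ?N = "normal_closure (free_group S) (relators S R)"
  have hom: "free_lift K f \<in> hom (free_group S) K"
    using f by (rule K.free_lift_hom)
  then interpret h: group_hom "free_group S" K "free_lift K f"
    by (simp add: group_hom_def group_hom_axioms_def K.is_group)
  have "relators S R \<subseteq> kernel (free_group S) K (free_lift K f)"
    using relation_words by (auto simp: relators_def kernel_def rel)
  then have ker: "?N \<subseteq> kernel (free_group S) K (free_lift K f)"
    by (rule normal_closure_minimal[OF h.normal_kernel])
  obtain g where g: "g \<in> hom (free_group S Mod ?N) K"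
      "\<And>w. w \<in> carrier (free_group S) \<Longrightarrow> g (?N #>\<^bsub>free_group S\<^esub> w) = free_lift K f w"
  proof (rule FactGroup_universal[OF hom normal_closure_relators])
    fix u v
    assume uv: "u \<in> carrier (free_group S)" "v \<in> carrier (free_group S)"
      and eq: "?N #>\<^bsub>free_group S\<^esub> u = ?N #>\<^bsub>free_group S\<^esub> v"
    interpret N: normal ?N "free_group S" by (rule normal_closure_relators)
    have "u \<in> ?N #>\<^bsub>free_group S\<^esub> v"
      using eq uv F.rcos_self N.subgroup_axioms by metis
    then obtain n where n: "n \<in> ?N" "u = n \<otimes>\<^bsub>free_group S\<^esub> v"
      by (auto simp: r_coset_def)
    then show "free_lift K f u = free_lift K f v"
      using ker uv by (auto simp: kernel_def)
  qed blast
  show thesis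
    by (rule that[of g]) (use g f in \<open>auto simp: presentation_def pres_gen_def K.free_lift_gen Pi_iff\<close>)
qed

end

section \<open>Relations given by multiplication tables\<close>

lemma table_words:
  assumes "group G" "\<iota> \<in> carrier G \<rightarrow> S"
  shows "table S \<iota> G \<subseteq> carrier (free_group S) \<times> carrier (free_group S)"
proof -
  interpret G: group G by fact
  interpret F: group "free_group S" by simp
  show ?thesis
    using assms(2) by (auto simp: table_def intro!: F.m_closed)
qed

text \<open>Only the values at \<open>a\<close> and \<open>b\<close> are known to lie in
  \<open>K\<close>. The product is therefore moved to the free group on these two letters, where
  multiplication is given by the same formula.\<close>

lemma free_lift_mult_gens:
  assumes "group K" "f a \<in> carrier K" "f b \<in> carrier K" "a \<in> S" "b \<in> S"
  shows "free_lift K f (free_gen a \<otimes>\<^bsub>free_group S\<^esub> free_gen b) = f a \<otimes>\<^bsub>K\<^esub> f b"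
proof -
  interpret K: group K by fact
  have hom: "free_lift K f \<in> hom (free_group {a, b}) K"
    using assms by (intro K.free_lift_hom) auto
  have "free_gen a \<otimes>\<^bsub>free_group S\<^esub> free_gen b = free_gen a \<otimes>\<^bsub>free_group {a, b}\<^esub> free_gen b"
    by (simp add: free_group_def)
  then show ?thesis
    using hom_mult[OF hom, of "free_gen a" "free_gen b"] assms
    by (simp add: K.free_lift_gen)
qed

lemma free_lift_table:
  assumes "group K" "f \<in> S \<rightarrow> carrier K" "group G" "\<iota> \<in> carrier G \<rightarrow> S"
    and hom: "(\<lambda>a. f (\<iota> a)) \<in> hom G K" and uv: "(u, v) \<in> table S \<iota> G"
  shows "free_lift K f u = free_lift K f v"
proof -
  interpret K: group K by fact
  interpret G: group G by fact
  obtain a b where ab: "a \<in> carrier G" "b \<in> carrier G"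
      "u = free_gen (\<iota> a) \<otimes>\<^bsub>free_group S\<^esub> free_gen (\<iota> b)" "v = free_gen (\<iota> (a \<otimes>\<^bsub>G\<^esub> b))"
    using uv by (auto simp: table_def)
  have "\<iota> a \<in> S" "\<iota> b \<in> S" "\<iota> (a \<otimes>\<^bsub>G\<^esub> b) \<in> S"
    using ab assms(4) by auto
  then have "f (\<iota> a) \<in> carrier K" "f (\<iota> b) \<in> carrier K" "f (\<iota> (a \<otimes>\<^bsub>G\<^esub> b)) \<in> carrier K"
    using assms(2) by auto
  then show ?thesis
    using ab \<open>\<iota> a \<in> S\<close> \<open>\<iota> b \<in> S\<close> hom_mult[OF hom, of a b]
    by (simp add: free_lift_mult_gens[OF \<open>group K\<close>] K.free_lift_gen)
qed

text \<open>The source of the canonical homomorphisms from the factors of a free product or an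
  amalgam and from the base of an HNN-extension.\<close>

lemma (in group_presentation) table_hom:
  assumes "group K" and \<iota>: "\<iota> \<in> carrier K \<rightarrow> S" and "table S \<iota> K \<subseteq> R"
  shows "(\<lambda>a. pres_gen S R (\<iota> a)) \<in> hom K (presentation S R)"
proof (rule homI)
  interpret K: group K by fact
  interpret P: group "presentation S R" by simp
  fix a b
  assume ab: "a \<in> carrier K" "b \<in> carrier K"
  then have S: "\<iota> a \<in> S" "\<iota> b \<in> S" "\<iota> (a \<otimes>\<^bsub>K\<^esub> b) \<in> S"
    using \<iota> by auto
  show "pres_gen S R (\<iota> a) \<in> carrier (presentation S R)"
    using S by (simp add: pres_gen_closed)
  have "(free_gen (\<iota> a) \<otimes>\<^bsub>free_group S\<^esub> free_gen (\<iota> b), free_gen (\<iota> (a \<otimes>\<^bsub>K\<^esub> b))) \<in> R"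
    using ab assms(3) by (auto simp: table_def)
  from presentation_relation[OF this] S
  show "pres_gen S R (\<iota> (a \<otimes>\<^bsub>K\<^esub> b)) = pres_gen S R (\<iota> a) \<otimes>\<^bsub>presentation S R\<^esub> pres_gen S R (\<iota> b)"
    by (simp add: free_lift_mult_gens P.free_lift_gen pres_gen_closed)
qed


section \<open>Infinite cyclic subgroups\<close>

text \<open>Since \<open>d\<close> sends the \<open>k\<close>-th power of \<open>a\<close> to
  \<open>k\<close>, it inverts the map that takes \<open>k\<close> to this power. Infinite order is
  always witnessed below by such a degree map.\<close>

lemma group_isomorphisms_infinite_cyclic:
  assumes "group G" and a: "a \<in> carrier G" and d: "d \<in> hom G integer_group" "d a = 1"
  shows "group_isomorphisms (G\<lparr>carrier := generate G {a}\<rparr>) integer_group d (\<lambda>k. a [^]\<^bsub>G\<^esub> k)"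
proof -
  interpret G: group G by fact
  have gen: "generate G {a} = {a [^]\<^bsub>G\<^esub> (k :: int) | k. k \<in> UNIV}"
    using a by (rule G.generate_pow)
  have pow: "d (a [^]\<^bsub>G\<^esub> (k :: int)) = k" for k
    using hom_int_pow[OF d(1) a _ group_integer_group, of k] d(2) \<open>group G\<close> by simp
  show ?thesis
    using a d(1) G.hom_integer_group_pow[OF a]
    by (auto simp: group_isomorphisms_def gen pow intro: hom_restrict_carrier)
      (auto simp: hom_def)
qed

lemma infinite_cyclic_onI:
  assumes "group G" "a \<in> carrier G" "d \<in> hom G integer_group" "d a = 1"
  shows "infinite_cyclic_on G a"
  using group_isomorphisms_imp_iso[OF group_isomorphisms_infinite_cyclic[OF assms]]
  unfolding infinite_cyclic_on_def is_iso_def by blast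


section \<open>The unrestricted wreath product with the integers\<close>

text \<open>The pair \<open>(f, n)\<close> is the permutation \<open>(a, k) \<mapsto> (f k a, k + n)\<close> of \<open>M \<times> \<int>\<close>.\<close>

definition wreath :: "('a, 'b) monoid_scheme \<Rightarrow> ((int \<Rightarrow> 'a) \<times> int) monoid" where
  "wreath M =
     \<lparr>carrier = (UNIV \<rightarrow> carrier M) \<times> UNIV,
      monoid.mult = (\<lambda>(f, m) (g, n). (\<lambda>k. f (k + n) \<otimes>\<^bsub>M\<^esub> g k, m + n)),
      one = (\<lambda>k. \<one>\<^bsub>M\<^esub>, 0)\<rparr>"

lemma wreath_carrier [simp]: "(f, n) \<in> carrier (wreath M) \<longleftrightarrow> (\<forall>k. f k \<in> carrier M)"
  by (auto simp: wreath_def)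

lemma wreath_mult [simp]:
  "(f, m) \<otimes>\<^bsub>wreath M\<^esub> (g, n) = (\<lambda>k. f (k + n) \<otimes>\<^bsub>M\<^esub> g k, m + n)"
  by (simp add: wreath_def)

lemma wreath_one: "\<one>\<^bsub>wreath M\<^esub> = (\<lambda>k. \<one>\<^bsub>M\<^esub>, 0)"
  by (simp add: wreath_def)

context group
begin

lemma group_wreath: "group (wreath G)"
proof (rule groupI)
  fix p q r
  assume p: "p \<in> carrier (wreath G)" and q: "q \<in> carrier (wreath G)"
  obtain f m where [simp]: "p = (f, m)" by (cases p)
  obtain g n where [simp]: "q = (g, n)" by (cases q)
  show "p \<otimes>\<^bsub>wreath G\<^esub> q \<in> carrier (wreath G)"
    using p q by simp
  assume r: "r \<in> carrier (wreath G)"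
  obtain h l where [simp]: "r = (h, l)" by (cases r)
  show "p \<otimes>\<^bsub>wreath G\<^esub> q \<otimes>\<^bsub>wreath G\<^esub> r = p \<otimes>\<^bsub>wreath G\<^esub> (q \<otimes>\<^bsub>wreath G\<^esub> r)"
    using p q r by (simp add: m_assoc ac_simps)
next
  fix p
  assume p: "p \<in> carrier (wreath G)"
  obtain f m where [simp]: "p = (f, m)" by (cases p)
  show "\<one>\<^bsub>wreath G\<^esub> \<otimes>\<^bsub>wreath G\<^esub> p = p"
    using p by (simp add: wreath_one)
  \<comment> \<open>In a product the left sequence is read at a place moved by the integer of the
    right factor, here \<open>m\<close>; the inverse therefore stores the inverse of entry
    \<open>k\<close> at place \<open>k + m\<close>.\<close>
  have "(\<lambda>k. inv (f (k - m)), - m) \<in> carrier (wreath G)"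
    "(\<lambda>k. inv (f (k - m)), - m) \<otimes>\<^bsub>wreath G\<^esub> p = \<one>\<^bsub>wreath G\<^esub>"
    using p by (auto simp: wreath_one)
  then show "\<exists>q \<in> carrier (wreath G). q \<otimes>\<^bsub>wreath G\<^esub> p = \<one>\<^bsub>wreath G\<^esub>"
    by blast
qed (auto simp: wreath_one)

lemma wreath_inv:
  "\<forall>k. f k \<in> carrier G \<Longrightarrow> inv\<^bsub>wreath G\<^esub> (f, n) = (\<lambda>k. inv (f (k - n)), - n)"
  by (rule group.inv_equality[OF group_wreath]) (auto simp: wreath_one)

lemma wreath_base_int_pow:
  assumes f: "\<forall>k. f k \<in> carrier G"
  shows "(f, 0) [^]\<^bsub>wreath G\<^esub> (r :: int) = (\<lambda>k. f k [^] r, 0)"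
proof -
  have nat: "(f, 0) [^]\<^bsub>wreath G\<^esub> (n :: nat) = (\<lambda>k. f k [^] n, 0)" for n
    using f by (induction n) (simp_all add: wreath_one nat_pow_def)
  show ?thesis
    unfolding int_pow_def2 using f by (simp add: nat wreath_inv)
qed

lemma wreath_shift_int_pow: "((\<lambda>k. \<one>, 1) [^]\<^bsub>wreath G\<^esub> (j :: int)) = (\<lambda>k. \<one>, j)"
proof -
  have nat: "(\<lambda>k. \<one>, 1) [^]\<^bsub>wreath G\<^esub> (n :: nat) = (\<lambda>k. \<one>, int n)" for n
    by (induction n) (simp_all add: wreath_one nat_pow_def)
  show ?thesis
    unfolding int_pow_def2 by (simp add: nat wreath_inv)
qed

text \<open>Conjugation by the shift only translates a sequence. A relation between the shifts
  \<open>0\<close>, \<open>1\<close>, \<open>2\<close> of one sequence in the wreath product thus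
  amounts to the same relation between every three consecutive entries.\<close>

lemma shift_wreath:
  assumes "\<forall>k. f k \<in> carrier G"
  shows "shift (wreath G) (f, 0) (\<lambda>k. \<one>, 1) j = (\<lambda>k. f (k + j), 0)"
  using assms by (simp add: shift_def wreath_shift_int_pow)

lemma snd_wreath_hom: "snd \<in> hom (wreath G) integer_group"
  by (rule homI) auto

end


section \<open>Groups generated by \<open>x\<close> and \<open>y\<close>\<close>

locale two_generated = group G for G (structure) +
  fixes x y
  assumes x_closed [simp, intro]: "x \<in> carrier G" and y_closed [simp, intro]: "y \<in> carrier G"
    and generated: "generate G {x, y} = carrier G"
begin

abbreviation H where "H \<equiv> generate G (range (shift G x y))"

lemma shift_closed [simp, intro]: "shift G x y i \<in> carrier G"
  by (simp add: shift_def)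

lemma shift_add:
  "shift G x y (i + k) = inv (y [^] k) \<otimes> shift G x y i \<otimes> y [^] k"
proof -
  have "y [^] (- (i + k)) = inv (y [^] k) \<otimes> y [^] (- i)"
    using int_pow_mult[of y "- k" "- i"] by (simp add: int_pow_neg add.commute)
  then show ?thesis
    by (simp add: shift_def int_pow_mult m_assoc)
qed

lemma conj_y_shift: "y \<otimes> shift G x y i \<otimes> inv y = shift G x y (i - 1)"
  using shift_add[of i "- 1"] by (simp add: int_pow_neg)

lemma conj_inv_y_shift: "inv y \<otimes> shift G x y i \<otimes> y = shift G x y (i + 1)"
  using shift_add[of i 1] by simp

lemma H_subset: "H \<subseteq> carrier G"
  by (rule generate_incl) auto

lemma H_subgroup: "subgroup H G"
  by (rule generate_is_subgroup) auto

lemma x_in_H: "x \<in> H"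
proof -
  have "shift G x y 0 = x" by (simp add: shift_def)
  then show ?thesis
    by (metis generate.incl rangeI)
qed

lemma conj_hom: "g \<in> carrier G \<Longrightarrow> (\<lambda>h. g \<otimes> h \<otimes> inv g) \<in> hom G G"
  by (rule homI) (simp_all add: m_assoc inv_solve_left)

lemma conj_generate_subset:
  assumes "g \<in> carrier G" "\<And>i. g \<otimes> shift G x y i \<otimes> inv g \<in> range (shift G x y)" "h \<in> H"
  shows "g \<otimes> h \<otimes> inv g \<in> H"
proof -
  have "(\<lambda>h. g \<otimes> h \<otimes> inv g) ` H = generate G ((\<lambda>h. g \<otimes> h \<otimes> inv g) ` range (shift G x y))"
    by (rule hom_generate_image[OF is_group is_group conj_hom]) (use assms in auto)
  also have "\<dots> \<subseteq> H"
    by (rule mono_generate) (use assms(2) in auto)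
  finally show ?thesis using assms(3) by blast
qed

text \<open>It is enough to conjugate by \<open>x\<close>, \<open>y\<close> and their inverses:
  \<open>x\<close> lies in \<open>H\<close>, and \<open>y\<close> moves every index by one. The
  inverse of \<open>y\<close> is a separate case, because being mapped into itself in one direction
  does not imply it in the other.\<close>

lemma H_normal: "H \<lhd> G"
proof -
  have conj: "g \<otimes> h \<otimes> inv g \<in> H" if "g \<in> generate G {x, y}" "h \<in> H" for g h
    using that
  proof (induction arbitrary: h)
    case one
    then show ?case using H_subset by auto
  next
    case (incl g)
    then show ?case
      using conj_generate_subset[of y h] conj_y_shift x_in_H
        subgroup.m_closed[OF H_subgroup] subgroup.m_inv_closed[OF H_subgroup]
      by auto
  next
    case (inv g)
    then show ?case
      using conj_generate_subset[of "inv y" h] conj_inv_y_shift x_in_H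
        subgroup.m_closed[OF H_subgroup] subgroup.m_inv_closed[OF H_subgroup]
      by auto
  next
    case (eng g k)
    then have "g \<otimes> (k \<otimes> h \<otimes> inv k) \<otimes> inv g \<in> H" by blast
    moreover have "g \<in> carrier G" "k \<in> carrier G" "h \<in> carrier G"
      using eng H_subset generated by auto
    ultimately show ?case by (simp add: m_assoc inv_mult_group)
  qed
  show ?thesis
    by (rule normal_invI[OF H_subgroup]) (use conj generated in auto)
qed

text \<open>The product of a normal subgroup and a subgroup is a subgroup, and this one contains
  both generators \<open>x\<close> and \<open>y\<close>.\<close>

lemma H_generate_y: "H <#> generate G {y} = carrier G"
proof -
  have y: "subgroup (generate G {y}) G"
    by (rule generate_is_subgroup) auto
  have sub: "subgroup (H <#> generate G {y}) G"
    by (rule mult_norm_subgroup[OF H_normal y])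
  have mult: "h \<otimes> k \<in> H <#> generate G {y}" if "h \<in> H" "k \<in> generate G {y}" for h k
    using that by (auto simp: set_mult_def)
  have "x \<otimes> \<one> \<in> H <#> generate G {y}" "\<one> \<otimes> y \<in> H <#> generate G {y}"
    by (rule mult; simp add: x_in_H generate.one generate.incl)+
  then have "generate G {x, y} \<subseteq> H <#> generate G {y}"
    by (intro generate_subgroup_incl[OF _ sub]) simp
  then show ?thesis
    using generated subgroup.subset[OF sub] by auto
qed

lemma degree_H:
  assumes d: "d \<in> hom G integer_group" "d x = 0" and h: "h \<in> H"
  shows "d h = 0"
proof -
  interpret d: group_hom G integer_group d
    using d by (simp add: group_hom_def group_hom_axioms_def)
  have zero: "(\<lambda>_. 0 :: int) \<in> hom (G\<lparr>carrier := H\<rparr>) integer_group"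
    by (rule homI) auto
  show ?thesis
    by (rule hom_eq_on_generate[where k = "\<lambda>_. 0", OF is_group group_integer_group _ hom_restrict_carrier[OF d(1) H_subset] zero _ h])
      (use d in \<open>auto simp: shift_def d.hom_int_pow\<close>)
qed

text \<open>The degree \<open>d\<close> vanishes on \<open>H\<close>, which is generated by
  conjugates of \<open>x\<close>, and takes the value \<open>k\<close> at the \<open>k\<close>-th
  power of \<open>y\<close>; so the two subgroups meet trivially.\<close>

lemma semidirect_H:
  assumes d: "d \<in> hom G integer_group" "d x = 0" "d y = 1"
  shows "internal_semidirect G H (generate G {y})"
proof -
  interpret d: group_hom G integer_group d
    using d by (simp add: group_hom_def group_hom_axioms_def)
  have "g = \<one>" if "g \<in> H" and "g \<in> generate G {y}" for g
  proof -
    obtain k :: int where k: "g = y [^] k"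
      using \<open>g \<in> generate G {y}\<close> generate_pow[of y] by auto
    then have "k = 0"
      using degree_H[OF d(1,2) \<open>g \<in> H\<close>] d(3) by (simp add: d.hom_int_pow)
    then show ?thesis using k by simp
  qed
  then have "H \<inter> generate G {y} = {\<one>}"
    by (auto intro: generate.one)
  moreover have "subgroup (generate G {y}) G"
    by (rule generate_is_subgroup) auto
  ultimately show ?thesis
    using H_normal H_generate_y by (simp add: internal_semidirect_def)
qed

text \<open>On \<open>H\<close> the integer component vanishes, so that evaluation at \<open>0\<close> is multiplicative.\<close>

lemma wreath_eval_hom:
  assumes "group M" and \<rho>: "\<rho> \<in> hom G (wreath M)" and z: "\<forall>k. z k \<in> carrier M"
    and "\<rho> x = (z, 0)" "\<rho> y = (\<lambda>k. \<one>\<^bsub>M\<^esub>, 1)"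
  shows "(\<lambda>h. fst (\<rho> h) 0) \<in> hom (G\<lparr>carrier := H\<rparr>) M"
    and "fst (\<rho> (shift G x y j)) 0 = z j"
proof -
  interpret M: group M by fact
  interpret W: group "wreath M" by (rule M.group_wreath)
  interpret \<rho>: group_hom G "wreath M" \<rho>
    using \<rho> by (simp add: group_hom_def group_hom_axioms_def W.is_group)
  have "snd \<circ> \<rho> \<in> hom G integer_group"
    by (rule Group.hom_compose[OF \<rho> M.snd_wreath_hom])
  then have snd: "snd (\<rho> h) = 0" if "h \<in> H" for h
    using degree_H[of "snd \<circ> \<rho>" h] that assms(4) by simp
  show "(\<lambda>h. fst (\<rho> h) 0) \<in> hom (G\<lparr>carrier := H\<rparr>) M"
  proof (rule homI)
    fix g h
    assume "g \<in> carrier (G\<lparr>carrier := H\<rparr>)" "h \<in> carrier (G\<lparr>carrier := H\<rparr>)"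
    then have gh: "g \<in> H" "h \<in> H" by auto
    obtain f m where f: "\<rho> g = (f, m)" by (cases "\<rho> g")
    obtain k n where k: "\<rho> h = (k, n)" by (cases "\<rho> h")
    have g: "g \<in> carrier G" "h \<in> carrier G"
      using gh H_subset by auto
    show "fst (\<rho> g) 0 \<in> carrier M"
      using \<rho>.hom_closed[OF g(1)] f by simp
    show "fst (\<rho> (g \<otimes>\<^bsub>G\<lparr>carrier := H\<rparr>\<^esub> h)) 0 = fst (\<rho> g) 0 \<otimes>\<^bsub>M\<^esub> fst (\<rho> h) 0"
      using snd[OF gh(2)] f k g by simp
  qed
  have "\<rho> (shift G x y j) = shift (wreath M) (z, 0) (\<lambda>k. \<one>\<^bsub>M\<^esub>, 1) j"
    using assms(4,5) by (simp add: shift_def \<rho>.hom_int_pow)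
  then show "fst (\<rho> (shift G x y j)) 0 = z j"
    using z by (simp add: M.shift_wreath)
qed

end

text \<open>A homomorphism that undoes \<open>f\<close> on the letters undoes the evaluation on all
  words, so the elements \<open>f s\<close> satisfy no relation.\<close>

lemma free_lift_iso_retract:
  assumes "group G" and f: "f \<in> S \<rightarrow> carrier G"
    and h: "h \<in> hom G (free_group S)" "\<And>s. s \<in> S \<Longrightarrow> h (f s) = free_gen s"
  shows "free_lift G f \<in> iso (free_group S) (G\<lparr>carrier := generate G (f ` S)\<rparr>)"
proof (rule free_lift_iso_generate[OF \<open>group G\<close> f])
  interpret group G by fact
  fix w
  assume w: "w \<in> carrier (free_group S)"
  have "h (free_lift G f w) = free_lift (free_group S) (\<lambda>s. h (f s)) w"
    by (rule hom_free_lift[OF group_free_group h(1) f w])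
  also have "\<dots> = id w"
    by (rule group.free_lift_unique[OF group_free_group _ _ w]) (use h(2) in \<open>auto simp: hom_def\<close>)
  finally show "h (free_lift G f w) = w" by simp
qed

section \<open>Chains of factors and their amalgams\<close>

text \<open>What the first two groups have in common. The retractions concern the two edges of the
  factor \<open>i\<close>: the upper edge keeps \<open>x_i\<close> and \<open>x_(i+1)\<close>, the
  lower one keeps \<open>x_(i-1)\<close> and \<open>x_i\<close>, and in each case the third
  generator can be expressed by the kept ones so that the relations hold in a free group.\<close>

locale factor_chain =
  fixes R :: "int \<Rightarrow> (int word \<times> int word) set"
  assumes factor_words:
      "R i \<subseteq> carrier (free_group {i - 1, i, i + 1}) \<times> carrier (free_group {i - 1, i, i + 1})"
    and retract_in: "\<exists>f. f i = free_gen i \<and> f (i + 1) = free_gen (i + 1) \<and>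
        f (i - 1) \<in> carrier (free_group {i, i + 1}) \<and>
        (\<forall>(u, v) \<in> R i. free_lift (free_group {i, i + 1}) f u = free_lift (free_group {i, i + 1}) f v)"
    and retract_out: "\<exists>f. f (i - 1) = free_gen (i - 1) \<and> f i = free_gen i \<and>
        f (i + 1) \<in> carrier (free_group {i - 1, i}) \<and>
        (\<forall>(u, v) \<in> R i. free_lift (free_group {i - 1, i}) f u = free_lift (free_group {i - 1, i}) f v)"
begin

abbreviation "A \<equiv> chain_factor R"
abbreviation "a \<equiv> factor_gen R"
abbreviation "B \<equiv> edge_in R"
abbreviation "C \<equiv> edge_out R"

sublocale factor: group_presentation "{i - 1, i, i + 1}" "R i" for i
  by unfold_locales (rule factor_words)

lemma group_factor [simp, intro]: "group (A i)"
  by (simp add: chain_factor_def factor.group_presentation)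

lemma factor_gen_closed: "j \<in> {i - 1, i, i + 1} \<Longrightarrow> a i j \<in> carrier (A i)"
  unfolding chain_factor_def factor_gen_def by (rule factor.pres_gen_closed)

lemma factor_generated: "generate (A i) (a i ` {i - 1, i, i + 1}) = carrier (A i)"
  unfolding chain_factor_def factor_gen_def by (rule factor.presentation_generated)

lemma factor_relation: "(u, v) \<in> R i \<Longrightarrow> free_lift (A i) (a i) u = free_lift (A i) (a i) v"
  using factor.presentation_relation[of u v i] by (simp add: chain_factor_def factor_gen_def[abs_def])

lemma factor_lift:
  assumes "group K" "f \<in> {i - 1, i, i + 1} \<rightarrow> carrier K"
    and "\<And>u v. (u, v) \<in> R i \<Longrightarrow> free_lift K f u = free_lift K f v"
  obtains h where "h \<in> hom (A i) K" "\<And>j. j \<in> {i - 1, i, i + 1} \<Longrightarrow> h (a i j) = f j"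
  using factor.presentation_lift[OF assms] unfolding chain_factor_def factor_gen_def by blast

section \<open>The edge subgroups and their identification\<close>

lemma edge_in_iso: "free_lift (A i) (a i) \<in> iso (free_group {i, i + 1}) ((A i)\<lparr>carrier := B i\<rparr>)"
proof -
  obtain f where f: "f i = free_gen i" "f (i + 1) = free_gen (i + 1)"
      "f (i - 1) \<in> carrier (free_group {i, i + 1})"
      "\<forall>(u, v) \<in> R i. free_lift (free_group {i, i + 1}) f u = free_lift (free_group {i, i + 1}) f v"
    using retract_in by blast
  obtain h where h: "h \<in> hom (A i) (free_group {i, i + 1})"
      "\<And>j. j \<in> {i - 1, i, i + 1} \<Longrightarrow> h (a i j) = f j"
    by (rule factor_lift[of "free_group {i, i + 1}" f i]) (use f in auto)
  have "free_lift (A i) (a i) \<in> iso (free_group {i, i + 1}) ((A i)\<lparr>carrier := generate (A i) (a i ` {i, i + 1})\<rparr>)"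
    by (rule free_lift_iso_retract[OF _ _ h(1)]) (use h(2) f in \<open>auto intro: factor_gen_closed\<close>)
  then show ?thesis by (simp add: edge_in_def)
qed

lemma edge_out_iso:
  "free_lift (A (i + 1)) (a (i + 1)) \<in> iso (free_group {i, i + 1}) ((A (i + 1))\<lparr>carrier := C i\<rparr>)"
proof -
  \<comment> \<open>\<open>C i\<close> lies in the factor \<open>i + 1\<close>, where
    \<open>x_i\<close> and \<open>x_(i+1)\<close> are the lower two generators; hence the retraction
    of that factor.\<close>
  obtain f where f: "f i = free_gen i" "f (i + 1) = free_gen (i + 1)"
      "f (i + 1 + 1) \<in> carrier (free_group {i, i + 1})"
      "\<forall>(u, v) \<in> R (i + 1). free_lift (free_group {i, i + 1}) f u = free_lift (free_group {i, i + 1}) f v"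
    using retract_out[of "i + 1"] by auto
  obtain h where h: "h \<in> hom (A (i + 1)) (free_group {i, i + 1})"
      "\<And>j. j \<in> {i + 1 - 1, i + 1, i + 1 + 1} \<Longrightarrow> h (a (i + 1) j) = f j"
    by (rule factor_lift[of "free_group {i, i + 1}" f "i + 1"]) (use f in auto)
  have "free_lift (A (i + 1)) (a (i + 1))
      \<in> iso (free_group {i, i + 1}) ((A (i + 1))\<lparr>carrier := generate (A (i + 1)) (a (i + 1) ` {i, i + 1})\<rparr>)"
    by (rule free_lift_iso_retract[OF _ _ h(1)]) (use h(2) f in \<open>auto intro: factor_gen_closed\<close>)
  then show ?thesis by (simp add: edge_out_def)
qed

lemma edge_in_free: "(A i)\<lparr>carrier := B i\<rparr> \<cong> F2"
proof -
  have "free_group {i, i + 1} \<cong> (A i)\<lparr>carrier := B i\<rparr>"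
    using edge_in_iso unfolding is_iso_def by blast
  then show ?thesis
    by (rule iso_trans[OF group.iso_sym[OF group_free_group] free_group_pair_iso_F2]) simp
qed

lemma edge_out_free: "(A (i + 1))\<lparr>carrier := C i\<rparr> \<cong> F2"
proof -
  have "free_group {i, i + 1} \<cong> (A (i + 1))\<lparr>carrier := C i\<rparr>"
    using edge_out_iso unfolding is_iso_def by blast
  then show ?thesis
    by (rule iso_trans[OF group.iso_sym[OF group_free_group] free_group_pair_iso_F2]) simp
qed

text \<open>The two copies of an edge are identified through the free group on \<open>x_i\<close>
  and \<open>x_(i+1)\<close>, so that \<open>glue\<close> is an isomorphism by composition and
  respects the generators. It is meaningful on \<open>B i\<close> only.\<close>

definition glue :: "int \<Rightarrow> int word set \<Rightarrow> int word set" where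
  "glue i = free_lift (A (i + 1)) (a (i + 1)) \<circ>
     inv_into (carrier (free_group {i, i + 1})) (free_lift (A i) (a i))"

lemma glue_iso: "glue i \<in> iso ((A i)\<lparr>carrier := B i\<rparr>) ((A (i + 1))\<lparr>carrier := C i\<rparr>)"
  unfolding glue_def
  by (rule iso_set_trans[OF group.iso_set_sym[OF group_free_group edge_in_iso] edge_out_iso])

lemma glue_gen:
  assumes "j \<in> {i, i + 1}"
  shows "glue i (a i j) = a (i + 1) j"
proof -
  have lift: "free_lift (A i) (a i) (free_gen j) = a i j"
    "free_lift (A (i + 1)) (a (i + 1)) (free_gen j) = a (i + 1) j"
    using assms by (auto intro!: group.free_lift_gen factor_gen_closed)
  have "inj_on (free_lift (A i) (a i)) (carrier (free_group {i, i + 1}))"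
    using edge_in_iso by (simp add: iso_def bij_betw_def)
  then have "inv_into (carrier (free_group {i, i + 1})) (free_lift (A i) (a i)) (a i j) = free_gen j"
    by (rule inv_into_f_eq) (use assms lift in auto)
  then show ?thesis using lift by (simp add: glue_def)
qed

lemma edge_in_subgroup: "subgroup (B i) (A i)"
  unfolding edge_in_def
  by (rule group.generate_is_subgroup) (auto intro: factor_gen_closed)

lemma edge_out_subgroup: "subgroup (C i) (A (i + 1))"
  unfolding edge_out_def
  by (rule group.generate_is_subgroup) (auto intro: factor_gen_closed)

lemma amalgam_data_glue: "amalgam_data A B C glue"
  by (auto simp: amalgam_data_def glue_iso edge_in_subgroup edge_out_subgroup)

lemma edge_in_closed: "b \<in> B i \<Longrightarrow> b \<in> carrier (A i)"
  using subgroup.subset[OF edge_in_subgroup] by blast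

lemma glue_closed: "b \<in> B i \<Longrightarrow> glue i b \<in> carrier (A (i + 1))"
proof -
  assume "b \<in> B i"
  then have "glue i b \<in> C i"
    using glue_iso[of i] by (auto simp: iso_def hom_def)
  then show ?thesis
    using subgroup.subset[OF edge_out_subgroup] by blast
qed

section \<open>The amalgam of a chain and its comparison with \<open>H\<close>\<close>

lemma amalgam_words:
  "amalgam_rels A B glue \<subseteq> carrier (free_group (amalgam_gens A)) \<times> carrier (free_group (amalgam_gens A))"
proof -
  have "table (amalgam_gens A) (Pair i) (A i)
      \<subseteq> carrier (free_group (amalgam_gens A)) \<times> carrier (free_group (amalgam_gens A))" for i
    by (rule table_words) (auto simp: amalgam_gens_def)
  then show ?thesis
    using edge_in_closed glue_closed unfolding amalgam_rels_def by (auto simp: amalgam_gens_def)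
qed

sublocale amalgam: group_presentation "amalgam_gens A" "amalgam_rels A B glue"
  by unfold_locales (rule amalgam_words)

abbreviation "M \<equiv> amalgam A B glue"

lemma group_amalgam [simp, intro]: "group M"
  by (simp add: amalgam_def amalgam.group_presentation)

lemma amalgam_in_hom: "amalgam_in A B glue i \<in> hom (A i) M"
  using amalgam.table_hom[of "A i" "Pair i"]
  by (auto simp: amalgam_def amalgam_in_def[abs_def] amalgam_gens_def amalgam_rels_def)

lemma amalgam_in_closed: "c \<in> carrier (A i) \<Longrightarrow> amalgam_in A B glue i c \<in> carrier M"
  using amalgam_in_hom by (auto simp: hom_def)

lemma amalgam_in_glue:
  assumes "b \<in> B i"
  shows "amalgam_in A B glue i b = amalgam_in A B glue (i + 1) (glue i b)"
proof -
  have "(free_gen (i, b), free_gen (i + 1, glue i b)) \<in> amalgam_rels A B glue"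
    using assms by (auto simp: amalgam_rels_def)
  from amalgam.presentation_relation[OF this] show ?thesis
    using amalgam_in_closed[OF edge_in_closed[OF assms]] amalgam_in_closed[OF glue_closed[OF assms]]
    by (simp add: amalgam_def amalgam_in_def group.free_lift_gen amalgam.group_presentation)
qed

text \<open>The generator \<open>x_j\<close> occurs in the three factors \<open>j - 1\<close>,
  \<open>j\<close> and \<open>j + 1\<close>; its copy in the middle one serves as the
  representative.\<close>

definition chain_gen :: "int \<Rightarrow> (int \<times> int word set) word set" where
  "chain_gen j = amalgam_in A B glue j (a j j)"

lemma amalgam_in_gen:
  assumes "j \<in> {i - 1, i, i + 1}"
  shows "amalgam_in A B glue i (a i j) = chain_gen j"
proof -
  have "a k k \<in> B k" "a k (k + 1) \<in> B k" for k
    by (auto simp: edge_in_def intro: generate.incl)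
  \<comment> \<open>Gluing along the edge \<open>i - 1\<close> settles \<open>j = i - 1\<close>, and
    gluing along the edge \<open>i\<close> settles \<open>j = i + 1\<close>; for
    \<open>j = i\<close> the claim is the definition.\<close>
  then have "amalgam_in A B glue (i - 1) (a (i - 1) (i - 1)) = amalgam_in A B glue i (a i (i - 1))"
    "amalgam_in A B glue i (a i (i + 1)) = amalgam_in A B glue (i + 1) (a (i + 1) (i + 1))"
    using amalgam_in_glue[of "a (i - 1) (i - 1)" "i - 1"] amalgam_in_glue[of "a i (i + 1)" i]
      glue_gen[of "i - 1" "i - 1"] glue_gen[of "i + 1" i]
    by simp_all
  then show ?thesis
    using assms by (auto simp: chain_gen_def)
qed

lemma chain_gen_closed [simp, intro]: "chain_gen j \<in> carrier M"
  unfolding chain_gen_def by (auto intro: amalgam_in_closed factor_gen_closed)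

lemma chain_gen_relation:
  assumes "(u, v) \<in> R i"
  shows "free_lift M chain_gen u = free_lift M chain_gen v"
proof -
  have uv: "u \<in> carrier (free_group {i - 1, i, i + 1})" "v \<in> carrier (free_group {i - 1, i, i + 1})"
    using assms factor_words by auto
  have "free_lift M chain_gen w = amalgam_in A B glue i (free_lift (A i) (a i) w)"
    if w: "w \<in> carrier (free_group {i - 1, i, i + 1})" for w
  proof -
    have "amalgam_in A B glue i (free_lift (A i) (a i) w) = free_lift M (\<lambda>j. amalgam_in A B glue i (a i j)) w"
      by (rule group.hom_free_lift[OF group_factor group_amalgam amalgam_in_hom _ w])
        (auto intro: factor_gen_closed)
    also have "\<dots> = free_lift M chain_gen w"
      using w by (intro free_lift_cong[OF _ w] amalgam_in_gen) 
    finally show ?thesis by simp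
  qed
  then show ?thesis
    using uv factor_relation[OF assms] by simp
qed

lemma amalgam_generated: "generate M (range chain_gen) = carrier M"
proof -
  interpret M: group M by (rule group_amalgam)
  have chain_gen: "range chain_gen \<subseteq> carrier M" by auto
  have "amalgam_in A B glue i c \<in> generate M (range chain_gen)" if "c \<in> carrier (A i)" for i c
  proof -
    have "amalgam_in A B glue i ` carrier (A i)
        = generate M (amalgam_in A B glue i ` a i ` {i - 1, i, i + 1})"
      unfolding factor_generated[symmetric]
      by (rule hom_generate_image[OF group_factor group_amalgam amalgam_in_hom])
        (auto intro: factor_gen_closed)
    also have "\<dots> \<subseteq> generate M (range chain_gen)"
      by (rule M.mono_generate) (use amalgam_in_gen[of _ i] in auto)
    finally show ?thesis using that by blast
  qed
  then have "pres_gen (amalgam_gens A) (amalgam_rels A B glue) ` amalgam_gens A \<subseteq> generate M (range chain_gen)"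
    by (auto simp: amalgam_in_def amalgam_gens_def)
  then have "carrier M \<subseteq> generate M (range chain_gen)"
    unfolding amalgam.presentation_generated[folded amalgam_def, symmetric]
    by (rule M.generate_subgroup_incl[OF _ M.generate_is_subgroup[OF chain_gen]])
  then show ?thesis
    using M.generate_incl[OF chain_gen] by blast
qed

text \<open>The relations of the factors hold among the shifts of \<open>x\<close>, which gives
  \<open>\<Phi>\<close>, and on generators its image is seen to be \<open>H\<close>. Injectivity,
  the point where normal forms would usually enter, comes from the left inverse: follow
  \<open>\<rho>\<close> and read the entry at place \<open>0\<close>, which is multiplicative on
  \<open>H\<close> and returns \<open>chain_gen j\<close> for the \<open>j\<close>-th shift.\<close>

lemma amalgam_iso:
  assumes "two_generated G x y"
    and rel: "\<And>i u v. (u, v) \<in> R i \<Longrightarrow> free_lift G (shift G x y) u = free_lift G (shift G x y) v"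
    and \<rho>: "\<rho> \<in> hom G (wreath M)" "\<rho> x = (chain_gen, 0)" "\<rho> y = (\<lambda>k. \<one>\<^bsub>M\<^esub>, 1)"
  shows "\<exists>\<Phi> \<in> iso M (G\<lparr>carrier := generate G (range (shift G x y))\<rparr>).
    \<forall>i. \<forall>j \<in> {i - 1, i, i + 1}. \<Phi> (amalgam_in A B glue i (a i j)) = shift G x y j"
proof -
  interpret two_generated G x y by fact
  interpret M: group M by (rule group_amalgam)
  have "\<exists>h. h \<in> hom (A i) G \<and> (\<forall>j \<in> {i - 1, i, i + 1}. h (a i j) = shift G x y j)" for i
    by (rule factor_lift[OF is_group, of "shift G x y" i]) (auto intro: rel)
  then obtain f where f: "\<And>i. f i \<in> hom (A i) G"
      "\<And>i j. j \<in> {i - 1, i, i + 1} \<Longrightarrow> f i (a i j) = shift G x y j"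
    by metis
  have closed: "f i c \<in> carrier G" if "c \<in> carrier (A i)" for i c
    using f(1)[of i] that by (auto simp: hom_def)
  \<comment> \<open>The maps of neighbouring factors must agree along their edge. Both sides are
    homomorphisms on \<open>B i\<close>, so the two generators of the edge decide, and
    \<open>glue\<close> preserves these.\<close>
  have glued: "f (i + 1) (glue i b) = f i b" if "b \<in> B i" for i b
  proof -
    have "(f (i + 1) \<circ> glue i) b = f i b"
      unfolding edge_in_def
    proof (rule hom_eq_on_generate[OF group_factor is_group])
      have "f (i + 1) \<in> hom ((A (i + 1))\<lparr>carrier := C i\<rparr>) G"
        using f(1) by (rule hom_restrict_carrier) (rule subgroup.subset[OF edge_out_subgroup])
      then show "f (i + 1) \<circ> glue i \<in> hom ((A i)\<lparr>carrier := generate (A i) {a i i, a i (i + 1)}\<rparr>) G"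
        using glue_iso[of i] Group.hom_compose by (auto simp: iso_def edge_in_def)
      show "f i \<in> hom ((A i)\<lparr>carrier := generate (A i) {a i i, a i (i + 1)}\<rparr>) G"
        using f(1) subgroup.subset[OF edge_in_subgroup]
        by (auto simp: edge_in_def intro: hom_restrict_carrier)
      show "b \<in> generate (A i) {a i i, a i (i + 1)}"
        using that by (simp add: edge_in_def)
    qed (use f(2)[of _ i] f(2)[of _ "i + 1"] glue_gen[of _ i] in \<open>auto intro: factor_gen_closed\<close>)
    then show ?thesis by simp
  qed
  let ?F = "\<lambda>(i, c). f i c"
  obtain \<Phi> where \<Phi>: "\<Phi> \<in> hom M G"
      "\<And>i c. c \<in> carrier (A i) \<Longrightarrow> \<Phi> (amalgam_in A B glue i c) = f i c"
  proof (rule amalgam.presentation_lift[OF is_group, of ?F])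
    show F: "?F \<in> amalgam_gens A \<rightarrow> carrier G"
      using closed by (auto simp: amalgam_gens_def)
    fix u v
    assume "(u, v) \<in> amalgam_rels A B glue"
    then consider i where "(u, v) \<in> table (amalgam_gens A) (Pair i) (A i)"
      | i b where "b \<in> B i" "u = free_gen (i, b)" "v = free_gen (i + 1, glue i b)"
      unfolding amalgam_rels_def by blast
    then show "free_lift G ?F u = free_lift G ?F v"
    proof cases
      case 1
      then show ?thesis
        by (rule free_lift_table[OF is_group F group_factor, rotated 2])
          (use f(1) in \<open>auto simp: amalgam_gens_def\<close>)
    next
      case 2
      then show ?thesis
        using glued closed edge_in_closed glue_closed by (simp add: free_lift_gen)
    qed
  next
    fix h
    assume "h \<in> hom (presentation (amalgam_gens A) (amalgam_rels A B glue)) G"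
      and "\<And>s. s \<in> amalgam_gens A \<Longrightarrow> h (pres_gen (amalgam_gens A) (amalgam_rels A B glue) s) = ?F s"
    then show thesis
      using that[of h] by (auto simp: amalgam_def amalgam_in_def amalgam_gens_def)
  qed
  have gens: "\<Phi> (amalgam_in A B glue i (a i j)) = shift G x y j" if "j \<in> {i - 1, i, i + 1}" for i j
    using that f(2) by (simp add: \<Phi>(2)[OF factor_gen_closed])
  have \<Phi>chain_gen: "\<Phi> (chain_gen j) = shift G x y j" for j
    using gens[of j j] by (simp add: chain_gen_def)
  have "\<Phi> ` carrier M = generate G (\<Phi> ` range chain_gen)"
    using hom_generate_image[OF group_amalgam is_group \<Phi>(1), of "range chain_gen"]
    by (auto simp: amalgam_generated)
  then have img: "\<Phi> ` carrier M = H"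
    by (simp add: image_image \<Phi>chain_gen)
  let ?GH = "G\<lparr>carrier := H\<rparr>"
  have \<Phi>H: "\<Phi> \<in> hom M ?GH"
    using \<Phi>(1) img by (auto simp: hom_def)
  define \<Psi> where "\<Psi> h = fst (\<rho> h) 0" for h
  have \<Psi>: "\<Psi> \<in> hom ?GH M" "\<Psi> (shift G x y j) = chain_gen j" for j
    using wreath_eval_hom[OF group_amalgam \<rho>(1) _ \<rho>(2,3)] by (auto simp: \<Psi>_def[abs_def])
  have "(\<Psi> \<circ> \<Phi>) w = id w" if "w \<in> carrier M" for w
    by (rule hom_eq_on_carrier[OF group_amalgam group_amalgam _ amalgam_generated Group.hom_compose[OF \<Phi>H \<Psi>(1)]])
      (use that in \<open>auto simp: \<Phi>chain_gen \<Psi>(2) hom_def\<close>)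
  then have "inj_on \<Phi> (carrier M)"
    by (intro inj_on_inverseI[of _ \<Psi>]) simp
  then have "\<Phi> \<in> iso M ?GH"
    using \<Phi>H img by (simp add: iso_def bij_betw_def)
  then show ?thesis using gens by blast
qed

text \<open>The assumption \<open>wreath\<close> yields one homomorphism \<open>\<rho>\<close> that
  serves twice: its sequence component inverts the map from the amalgam to \<open>H\<close>, and its
  integer component is the degree behind the semidirect decomposition and the infinite order of
  \<open>y\<close>.\<close>

lemma semidirect_amalgam:
  assumes words: "RG \<subseteq> carrier (free_group {Gx, Gy}) \<times> carrier (free_group {Gx, Gy})"
    and G: "G = presentation {Gx, Gy} RG"
    and x: "x = pres_gen {Gx, Gy} RG Gx" and y: "y = pres_gen {Gx, Gy} RG Gy"
    and H: "H = generate G (range (shift G x y))"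
    and rel: "\<And>i u v. (u, v) \<in> R i \<Longrightarrow> free_lift G (shift G x y) u = free_lift G (shift G x y) v"
    and wreath: "\<And>u v. (u, v) \<in> RG \<Longrightarrow>
      free_lift (wreath M) (case_gen_xy (chain_gen, 0) (\<lambda>k. \<one>\<^bsub>M\<^esub>, 1)) u =
      free_lift (wreath M) (case_gen_xy (chain_gen, 0) (\<lambda>k. \<one>\<^bsub>M\<^esub>, 1)) v"
  shows "internal_semidirect G H (generate G {y}) \<and> infinite_cyclic_on G y \<and>
    (\<exists>\<phi>. amalgam_data A B C \<phi> \<and>
       (\<forall>i. \<phi> i (a i i) = a (i + 1) i \<and> \<phi> i (a i (i + 1)) = a (i + 1) (i + 1)) \<and>
       (\<exists>\<Phi> \<in> iso (amalgam A B \<phi>) (G\<lparr>carrier := H\<rparr>).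
          \<forall>i. \<forall>j \<in> {i - 1, i, i + 1}. \<Phi> (amalgam_in A B \<phi> i (a i j)) = shift G x y j)) \<and>
    (\<forall>i. (A i)\<lparr>carrier := B i\<rparr> \<cong> F2 \<and> (A (i + 1))\<lparr>carrier := C i\<rparr> \<cong> F2)"
proof -
  interpret P: group_presentation "{Gx, Gy}" RG
    by unfold_locales (rule words)
  interpret G: group G by (simp add: G P.group_presentation)
  interpret xy: two_generated G x y
    using P.pres_gen_closed P.presentation_generated by unfold_locales (auto simp: G x y)
  interpret M: group M by (rule group_amalgam)
  interpret W: group "wreath M" by (rule M.group_wreath)
  obtain \<rho> where "\<rho> \<in> hom (presentation {Gx, Gy} RG) (wreath M)"
      "\<And>s. s \<in> {Gx, Gy} \<Longrightarrow> \<rho> (pres_gen {Gx, Gy} RG s) = case_gen_xy (chain_gen, 0) (\<lambda>k. \<one>\<^bsub>M\<^esub>, 1) s"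
    by (rule P.presentation_lift[OF W.is_group, of "case_gen_xy (chain_gen, 0) (\<lambda>k. \<one>\<^bsub>M\<^esub>, 1)"])
      (auto intro: wreath)
  then have \<rho>: "\<rho> \<in> hom G (wreath M)" "\<rho> x = (chain_gen, 0)" "\<rho> y = (\<lambda>k. \<one>\<^bsub>M\<^esub>, 1)"
    by (simp_all add: G x y)
  have d: "snd \<circ> \<rho> \<in> hom G integer_group" "(snd \<circ> \<rho>) x = 0" "(snd \<circ> \<rho>) y = 1"
    using Group.hom_compose[OF \<rho>(1) M.snd_wreath_hom] \<rho> by simp_all
  have "internal_semidirect G H (generate G {y})"
    unfolding H by (rule xy.semidirect_H[OF d])
  moreover have "infinite_cyclic_on G y"
    by (rule infinite_cyclic_onI[OF G.is_group xy.y_closed d(1,3)])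
  moreover have "\<exists>\<Phi> \<in> iso M (G\<lparr>carrier := H\<rparr>).
      \<forall>i. \<forall>j \<in> {i - 1, i, i + 1}. \<Phi> (amalgam_in A B glue i (a i j)) = shift G x y j"
    unfolding H by (rule amalgam_iso[OF xy.two_generated_axioms rel \<rho>])
  ultimately show ?thesis
    using amalgam_data_glue edge_in_free edge_out_free by (auto intro!: exI[of _ glue] glue_gen)
qed

end

section \<open>The defining relations\<close>

context group
begin

lemma inv_mult_cancel: "p \<in> carrier G \<Longrightarrow> q \<in> carrier G \<Longrightarrow> inv p \<otimes> (p \<otimes> q) = q"
  by (simp add: m_assoc[symmetric])

lemma mult_inv_cancel: "p \<in> carrier G \<Longrightarrow> q \<in> carrier G \<Longrightarrow> p \<otimes> (inv p \<otimes> q) = q"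
  by (simp add: m_assoc[symmetric])

text \<open>Products become right-nested, inverses move to the letters and neighbours cancel. With
  these rules \<open>simp\<close> compares reduced words, which settles identities valid in every
  group.\<close>

lemmas group_normal_form = m_assoc inv_mult_group inv_mult_cancel mult_inv_cancel

lemma int_pow_2: "p \<in> carrier G \<Longrightarrow> p [^] (2 :: int) = p \<otimes> p"
  using int_pow_mult[of p 1 1] by simp

lemma int_pow_minus_2: "p \<in> carrier G \<Longrightarrow> p [^] (- 2 :: int) = inv p \<otimes> inv p"
  by (simp add: int_pow_neg int_pow_2 inv_mult_group)

text \<open>Multiply by \<open>p\<close> on the left and by \<open>q\<close> on the right. With
  \<open>s = x_1\<close>, \<open>p = x_0^r\<close> and \<open>q = x_2^r\<close> this turns the
  relation of the first group into a commutation relation; the product \<open>p q\<close> is the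
  reason why both exponents have the same sign.\<close>

lemma conj_eq_iff_commute:
  assumes "p \<in> carrier G" "q \<in> carrier G" "s \<in> carrier G"
  shows "inv p \<otimes> s \<otimes> p = q \<otimes> s \<otimes> inv q \<longleftrightarrow> s \<otimes> (p \<otimes> q) = p \<otimes> q \<otimes> s"
proof -
  have "inv p \<otimes> s \<otimes> p = q \<otimes> s \<otimes> inv q
      \<longleftrightarrow> p \<otimes> (inv p \<otimes> s \<otimes> p) \<otimes> q = p \<otimes> (q \<otimes> s \<otimes> inv q) \<otimes> q"
    using assms by simp
  then show ?thesis
    using assms by (simp add: group_normal_form)
qed

lemma int_pow_conj:
  assumes "p \<in> carrier G" "q \<in> carrier G"
  shows "(inv q \<otimes> p \<otimes> q) [^] (r :: int) = inv q \<otimes> p [^] r \<otimes> q"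
proof -
  have "(\<lambda>p. inv q \<otimes> p \<otimes> q) \<in> hom G G"
    by (rule homI) (use assms in \<open>simp_all add: group_normal_form\<close>)
  from hom_int_pow[OF this assms(1) is_group is_group, of r] show ?thesis by simp
qed

end

text \<open>The relations between three consecutive \<open>x\<^sub>i\<close>, cleared of conjugations.\<close>

definition commuting_relation :: "int \<Rightarrow> ('a, 'b) monoid_scheme \<Rightarrow> 'a \<Rightarrow> 'a \<Rightarrow> 'a \<Rightarrow> bool" where
  "commuting_relation r K a b c \<longleftrightarrow>
     b \<otimes>\<^bsub>K\<^esub> (a [^]\<^bsub>K\<^esub> r \<otimes>\<^bsub>K\<^esub> c [^]\<^bsub>K\<^esub> r) = a [^]\<^bsub>K\<^esub> r \<otimes>\<^bsub>K\<^esub> c [^]\<^bsub>K\<^esub> r \<otimes>\<^bsub>K\<^esub> b"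

definition balanced_relation :: "('a, 'b) monoid_scheme \<Rightarrow> 'a \<Rightarrow> 'a \<Rightarrow> 'a \<Rightarrow> bool" where
  "balanced_relation K a b c \<longleftrightarrow>
     a \<otimes>\<^bsub>K\<^esub> inv\<^bsub>K\<^esub> b \<otimes>\<^bsub>K\<^esub> a = c \<otimes>\<^bsub>K\<^esub> inv\<^bsub>K\<^esub> b \<otimes>\<^bsub>K\<^esub> c"

context group
begin

lemma commuting_relation_hom:
  assumes "group K" "h \<in> hom G K" "a \<in> carrier G" "b \<in> carrier G" "c \<in> carrier G"
    and "commuting_relation r G a b c"
  shows "commuting_relation r K (h a) (h b) (h c)"
proof -
  interpret h: group_hom G K h
    using assms by (simp add: group_hom_def group_hom_axioms_def)
  have "h (b \<otimes> (a [^] r \<otimes> c [^] r)) = h (a [^] r \<otimes> c [^] r \<otimes> b)"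
    using assms(6) by (simp add: commuting_relation_def)
  then show ?thesis
    using assms(3-5) by (simp add: commuting_relation_def h.hom_int_pow)
qed

lemma balanced_relation_hom:
  assumes "group K" "h \<in> hom G K" "a \<in> carrier G" "b \<in> carrier G" "c \<in> carrier G"
    and "balanced_relation G a b c"
  shows "balanced_relation K (h a) (h b) (h c)"
proof -
  interpret h: group_hom G K h
    using assms by (simp add: group_hom_def group_hom_axioms_def)
  have "h (a \<otimes> inv b \<otimes> a) = h (c \<otimes> inv b \<otimes> c)"
    using assms(6) by (simp add: balanced_relation_def)
  then show ?thesis
    using assms(3-5) by (simp add: balanced_relation_def)
qed

lemma rel_G1_iff:
  assumes "x \<in> carrier G" "y \<in> carrier G"
  shows "fst (rel_G1 G r x y) = snd (rel_G1 G r x y) \<longleftrightarrow>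
    commuting_relation r G (shift G x y 0) (shift G x y 1) (shift G x y 2)"
proof -
  have s: "shift G x y 0 = x" "shift G x y 1 = inv y \<otimes> x \<otimes> y"
    "shift G x y 2 = inv (y \<otimes> y) \<otimes> x \<otimes> (y \<otimes> y)"
    using assms by (simp_all add: shift_def int_pow_neg int_pow_2)
  have q: "(inv (y \<otimes> y) \<otimes> x \<otimes> (y \<otimes> y)) [^] r = inv (y \<otimes> y) \<otimes> x [^] r \<otimes> (y \<otimes> y)"
    using assms by (intro int_pow_conj) auto
  have "fst (rel_G1 G r x y) = snd (rel_G1 G r x y) \<longleftrightarrow>
      inv (x [^] r) \<otimes> (inv y \<otimes> x \<otimes> y) \<otimes> x [^] r =
      inv (y \<otimes> y) \<otimes> x [^] r \<otimes> (y \<otimes> y) \<otimes> (inv y \<otimes> x \<otimes> y) \<otimes> inv (inv (y \<otimes> y) \<otimes> x [^] r \<otimes> (y \<otimes> y))"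
    using assms by (simp add: rel_G1_def int_pow_neg int_pow_2 group_normal_form)
  also have "\<dots> \<longleftrightarrow> commuting_relation r G (shift G x y 0) (shift G x y 1) (shift G x y 2)"
    unfolding s commuting_relation_def q by (rule conj_eq_iff_commute) (use assms in auto)
  finally show ?thesis .
qed

text \<open>Inserting powers of \<open>y\<close> that cancel, the left-hand side of the relation is
  \<open>x_0 x_1^-1 x_0\<close> and the right-hand side is \<open>x_2 x_1^-1 x_2\<close>.\<close>

lemma rel_G2_iff:
  assumes "x \<in> carrier G" "y \<in> carrier G"
  shows "fst (rel_G2 G x y) = snd (rel_G2 G x y) \<longleftrightarrow>
    balanced_relation G (shift G x y 0) (shift G x y 1) (shift G x y 2)"
  using assms
  by (simp add: rel_G2_def balanced_relation_def shift_def int_pow_minus_2 int_pow_2 int_pow_neg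
      group_normal_form)

lemma rel_A1_comm_iff:
  assumes "a \<in> carrier G" "b \<in> carrier G" "c \<in> carrier G"
  shows "fst (rel_A1_comm G r a b c) = snd (rel_A1_comm G r a b c) \<longleftrightarrow> commuting_relation r G a b c"
proof -
  define v where "v = a [^] r \<otimes> c [^] r"
  have v: "v \<in> carrier G" using assms by (simp add: v_def)
  have "inv b \<otimes> inv v \<otimes> b \<otimes> v = \<one> \<longleftrightarrow> v \<otimes> b \<otimes> (inv b \<otimes> inv v \<otimes> b \<otimes> v) = v \<otimes> b \<otimes> \<one>"
    using assms v by simp
  also have "\<dots> \<longleftrightarrow> b \<otimes> v = v \<otimes> b"
    using assms v by (simp add: group_normal_form)
  finally show ?thesis
    by (simp add: rel_A1_comm_def commutator_def commuting_relation_def v_def)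
qed

lemma rel_A1_conj_iff:
  assumes "a \<in> carrier G" "b \<in> carrier G" "c \<in> carrier G"
  shows "fst (rel_A1_conj G r a b c) = snd (rel_A1_conj G r a b c) \<longleftrightarrow> commuting_relation r G a b c"
proof -
  define v where "v = a [^] r \<otimes> c [^] r"
  have v: "v \<in> carrier G" using assms by (simp add: v_def)
  have "inv b \<otimes> v \<otimes> b = v \<longleftrightarrow> b \<otimes> (inv b \<otimes> v \<otimes> b) = b \<otimes> v"
    using assms v by simp
  also have "\<dots> \<longleftrightarrow> b \<otimes> v = v \<otimes> b"
    using assms v by (auto simp: group_normal_form)
  finally show ?thesis
    by (simp add: rel_A1_conj_def commuting_relation_def v_def)
qed

lemma rel_A2_iff:
  assumes "a \<in> carrier G" "b \<in> carrier G" "c \<in> carrier G"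
  shows "fst (rel_A2 G a b c) = snd (rel_A2 G a b c) \<longleftrightarrow> balanced_relation G a b c"
proof -
  \<comment> \<open>The conjugate is \<open>a b^-1 a c^-1 b a^-1\<close> and the inverse is
    \<open>c a^-1\<close>. The factor \<open>a b^-1 c\<close> cancels the tails and leaves
    \<open>a b^-1 a\<close> and \<open>c b^-1 c\<close>.\<close>
  have "fst (rel_A2 G a b c) = snd (rel_A2 G a b c) \<longleftrightarrow>
      fst (rel_A2 G a b c) \<otimes> (a \<otimes> inv b \<otimes> c) = snd (rel_A2 G a b c) \<otimes> (a \<otimes> inv b \<otimes> c)"
    using assms by (simp add: rel_A2_def conj_by_def)
  then show ?thesis
    using assms by (simp add: rel_A2_def conj_by_def balanced_relation_def group_normal_form)
qed

lemma free_lift_rel_G1: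
  assumes "f Gx \<in> carrier G" "f Gy \<in> carrier G" "(u, v) \<in> rels_G1 r"
  shows "free_lift G f u = fst (rel_G1 G r (f Gx) (f Gy))" "free_lift G f v = snd (rel_G1 G r (f Gx) (f Gy))"
proof -
  have "free_lift G f \<in> hom (free_group {Gx, Gy}) G"
    using assms by (intro free_lift_hom) auto
  then interpret h: group_hom "free_group {Gx, Gy}" G "free_lift G f"
    by (simp add: group_hom_def group_hom_axioms_def is_group)
  show "free_lift G f u = fst (rel_G1 G r (f Gx) (f Gy))" "free_lift G f v = snd (rel_G1 G r (f Gx) (f Gy))"
    using assms by (simp_all add: rels_G1_def rel_G1_def h.hom_int_pow free_lift_gen)
qed

lemma free_lift_rel_G2:
  assumes "f Gx \<in> carrier G" "f Gy \<in> carrier G" "(u, v) \<in> rels_G2"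
  shows "free_lift G f u = fst (rel_G2 G (f Gx) (f Gy))" "free_lift G f v = snd (rel_G2 G (f Gx) (f Gy))"
proof -
  have "free_lift G f \<in> hom (free_group {Gx, Gy}) G"
    using assms by (intro free_lift_hom) auto
  then interpret h: group_hom "free_group {Gx, Gy}" G "free_lift G f"
    by (simp add: group_hom_def group_hom_axioms_def is_group)
  show "free_lift G f u = fst (rel_G2 G (f Gx) (f Gy))" "free_lift G f v = snd (rel_G2 G (f Gx) (f Gy))"
    using assms by (simp_all add: rels_G2_def rel_G2_def h.hom_int_pow free_lift_gen)
qed

text \<open>In every target group the commutator form and the conjugation form of the relation say
  the same, so from here on no distinction by the value of \<open>r\<close> is made until the free
  product decomposition.\<close>

lemma free_lift_rels_A1:
  assumes f: "f \<in> {i - 1, i, i + 1} \<rightarrow> carrier G" and uv: "(u, v) \<in> rels_A1 r i"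
  shows "free_lift G f u = free_lift G f v \<longleftrightarrow> commuting_relation r G (f (i - 1)) (f i) (f (i + 1))"
proof -
  have "free_lift G f \<in> hom (free_group {i - 1, i, i + 1}) G"
    using f by (rule free_lift_hom)
  then interpret h: group_hom "free_group {i - 1, i, i + 1}" G "free_lift G f"
    by (simp add: group_hom_def group_hom_axioms_def is_group)
  have closed: "f (i - 1) \<in> carrier G" "f i \<in> carrier G" "f (i + 1) \<in> carrier G"
    using f by auto
  show ?thesis
  proof (cases "r = 1 \<or> r = - 1")
    case True
    then have "free_lift G f u = fst (rel_A1_comm G r (f (i - 1)) (f i) (f (i + 1)))"
      "free_lift G f v = snd (rel_A1_comm G r (f (i - 1)) (f i) (f (i + 1)))"
      using uv closed
      by (auto simp: rels_A1_def Let_def rel_A1_comm_def commutator_def h.hom_int_pow free_lift_gen)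
    then show ?thesis
      using rel_A1_comm_iff[OF closed] by simp
  next
    case False
    then have "free_lift G f u = fst (rel_A1_conj G r (f (i - 1)) (f i) (f (i + 1)))"
      "free_lift G f v = snd (rel_A1_conj G r (f (i - 1)) (f i) (f (i + 1)))"
      using uv closed
      by (auto simp: rels_A1_def Let_def rel_A1_conj_def h.hom_int_pow free_lift_gen)
    then show ?thesis
      using rel_A1_conj_iff[OF closed] by simp
  qed
qed

lemma free_lift_rels_A2:
  assumes f: "f \<in> {i - 1, i, i + 1} \<rightarrow> carrier G" and uv: "(u, v) \<in> rels_A2 i"
  shows "free_lift G f u = free_lift G f v \<longleftrightarrow> balanced_relation G (f (i - 1)) (f i) (f (i + 1))"
proof -
  have "free_lift G f \<in> hom (free_group {i - 1, i, i + 1}) G"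
    using f by (rule free_lift_hom)
  then interpret h: group_hom "free_group {i - 1, i, i + 1}" G "free_lift G f"
    by (simp add: group_hom_def group_hom_axioms_def is_group)
  have closed: "f (i - 1) \<in> carrier G" "f i \<in> carrier G" "f (i + 1) \<in> carrier G"
    using f by auto
  have "free_lift G f u = fst (rel_A2 G (f (i - 1)) (f i) (f (i + 1)))"
    "free_lift G f v = snd (rel_A2 G (f (i - 1)) (f i) (f (i + 1)))"
    using uv closed by (auto simp: rels_A2_def rel_A2_def conj_by_def free_lift_gen)
  then show ?thesis
    using rel_A2_iff[OF closed] by simp
qed

end

lemma rels_G1_words: "rels_G1 r \<subseteq> carrier (free_group {Gx, Gy}) \<times> carrier (free_group {Gx, Gy})"
proof -
  interpret F: group "free_group {Gx, Gy}" by simp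
  show ?thesis by (simp add: rels_G1_def rel_G1_def)
qed

lemma rels_G2_words: "rels_G2 \<subseteq> carrier (free_group {Gx, Gy}) \<times> carrier (free_group {Gx, Gy})"
proof -
  interpret F: group "free_group {Gx, Gy}" by simp
  show ?thesis by (simp add: rels_G2_def rel_G2_def)
qed

lemma rels_A1_words:
  "rels_A1 r i \<subseteq> carrier (free_group {i - 1, i, i + 1}) \<times> carrier (free_group {i - 1, i, i + 1})"
proof -
  interpret F: group "free_group {i - 1, i, i + 1}" by simp
  show ?thesis by (simp add: rels_A1_def Let_def rel_A1_comm_def commutator_def rel_A1_conj_def)
qed

lemma rels_A1_nonempty: "rels_A1 r i \<noteq> {}"
  by (simp add: rels_A1_def Let_def)

lemma rels_A2_words:
  "rels_A2 i \<subseteq> carrier (free_group {i - 1, i, i + 1}) \<times> carrier (free_group {i - 1, i, i + 1})"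
proof -
  interpret F: group "free_group {i - 1, i, i + 1}" by simp
  show ?thesis by (simp add: rels_A2_def rel_A2_def conj_by_def)
qed

text \<open>The outer generator is sent to the inverse of the opposite one, so that
  \<open>x\<^sub>i\<^sub>-\<^sub>1\<^sup>r x\<^sub>i\<^sub>+\<^sub>1\<^sup>r\<close> becomes trivial.\<close>

lemma factor_chain_A1: "factor_chain (rels_A1 r)"
proof
  fix i :: int
  show "rels_A1 r i \<subseteq> carrier (free_group {i - 1, i, i + 1}) \<times> carrier (free_group {i - 1, i, i + 1})"
    by (rule rels_A1_words)
  interpret F: group "free_group {i, i + 1}" by simp
  let ?f = "free_gen(i - 1 := inv\<^bsub>free_group {i, i + 1}\<^esub> free_gen (i + 1))"
  have "free_lift (free_group {i, i + 1}) ?f u = free_lift (free_group {i, i + 1}) ?f v"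
    if "(u, v) \<in> rels_A1 r i" for u v
    by (subst F.free_lift_rels_A1[OF _ that])
      (auto simp: commuting_relation_def F.int_pow_inv)
  then show "\<exists>f. f i = free_gen i \<and> f (i + 1) = free_gen (i + 1) \<and>
        f (i - 1) \<in> carrier (free_group {i, i + 1}) \<and>
        (\<forall>(u, v) \<in> rels_A1 r i. free_lift (free_group {i, i + 1}) f u = free_lift (free_group {i, i + 1}) f v)"
    by (intro exI[of _ ?f]) auto
  interpret E: group "free_group {i - 1, i}" by simp
  let ?g = "free_gen(i + 1 := inv\<^bsub>free_group {i - 1, i}\<^esub> free_gen (i - 1))"
  have "free_lift (free_group {i - 1, i}) ?g u = free_lift (free_group {i - 1, i}) ?g v"
    if "(u, v) \<in> rels_A1 r i" for u v
    by (subst E.free_lift_rels_A1[OF _ that])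
      (auto simp: commuting_relation_def E.int_pow_inv)
  then show "\<exists>f. f (i - 1) = free_gen (i - 1) \<and> f i = free_gen i \<and>
        f (i + 1) \<in> carrier (free_group {i - 1, i}) \<and>
        (\<forall>(u, v) \<in> rels_A1 r i. free_lift (free_group {i - 1, i}) f u = free_lift (free_group {i - 1, i}) f v)"
    by (intro exI[of _ ?g]) auto
qed

text \<open>The relation \<open>a b^-1 a = c b^-1 c\<close> becomes trivial as soon as
  \<open>a = c\<close>, so each outer generator can be sent to the opposite one.\<close>

lemma factor_chain_A2: "factor_chain rels_A2"
proof
  fix i :: int
  show "rels_A2 i \<subseteq> carrier (free_group {i - 1, i, i + 1}) \<times> carrier (free_group {i - 1, i, i + 1})"
    by (rule rels_A2_words)
  interpret F: group "free_group {i, i + 1}" by simp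
  let ?f = "free_gen(i - 1 := free_gen (i + 1))"
  have "free_lift (free_group {i, i + 1}) ?f u = free_lift (free_group {i, i + 1}) ?f v"
    if "(u, v) \<in> rels_A2 i" for u v
    by (subst F.free_lift_rels_A2[OF _ that]) (auto simp: balanced_relation_def)
  then show "\<exists>f. f i = free_gen i \<and> f (i + 1) = free_gen (i + 1) \<and>
        f (i - 1) \<in> carrier (free_group {i, i + 1}) \<and>
        (\<forall>(u, v) \<in> rels_A2 i. free_lift (free_group {i, i + 1}) f u = free_lift (free_group {i, i + 1}) f v)"
    by (intro exI[of _ ?f]) auto
  interpret E: group "free_group {i - 1, i}" by simp
  let ?g = "free_gen(i + 1 := free_gen (i - 1))"
  have "free_lift (free_group {i - 1, i}) ?g u = free_lift (free_group {i - 1, i}) ?g v"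
    if "(u, v) \<in> rels_A2 i" for u v
    by (subst E.free_lift_rels_A2[OF _ that]) (auto simp: balanced_relation_def)
  then show "\<exists>f. f (i - 1) = free_gen (i - 1) \<and> f i = free_gen i \<and>
        f (i + 1) \<in> carrier (free_group {i - 1, i}) \<and>
        (\<forall>(u, v) \<in> rels_A2 i. free_lift (free_group {i - 1, i}) f u = free_lift (free_group {i - 1, i}) f v)"
    by (intro exI[of _ ?g]) auto
qed

section \<open>The first two groups as semidirect products with an amalgam\<close>

lemma (in two_generated) shift_conj_pow:
  "inv (y [^] k) \<otimes> shift G x y i \<otimes> y [^] k = shift G x y (i + k)"
  by (simp add: shift_add)

lemma (in two_generated) conj_y_pow_hom: "(\<lambda>g. inv (y [^] k) \<otimes> g \<otimes> y [^] (k :: int)) \<in> hom G G"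
  using conj_hom[of "inv (y [^] k)"] by simp

lemma G1_semidirect_amalgam:
  assumes G: "G = G1 r" and x: "x = G1_gen r Gx" and y: "y = G1_gen r Gy"
    and H: "H = generate G (range (shift G x y))"
    and A: "A = chain_factor (rels_A1 r)" and a: "a = factor_gen (rels_A1 r)"
    and B: "B = edge_in (rels_A1 r)" and C: "C = edge_out (rels_A1 r)"
  shows "internal_semidirect G H (generate G {y}) \<and> infinite_cyclic_on G y \<and>
    (\<exists>\<phi>. amalgam_data A B C \<phi> \<and>
       (\<forall>i. \<phi> i (a i i) = a (i + 1) i \<and> \<phi> i (a i (i + 1)) = a (i + 1) (i + 1)) \<and>
       (\<exists>\<Phi> \<in> iso (amalgam A B \<phi>) (G\<lparr>carrier := H\<rparr>).
          \<forall>i. \<forall>j \<in> {i - 1, i, i + 1}. \<Phi> (amalgam_in A B \<phi> i (a i j)) = shift G x y j)) \<and>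
    (\<forall>i. (A i)\<lparr>carrier := B i\<rparr> \<cong> F2 \<and> (A (i + 1))\<lparr>carrier := C i\<rparr> \<cong> F2)"
proof -
  interpret chain: factor_chain "rels_A1 r" by (rule factor_chain_A1)
  interpret P: group_presentation "{Gx, Gy}" "rels_G1 r"
    by unfold_locales (rule rels_G1_words)
  have GP: "G = presentation {Gx, Gy} (rels_G1 r)" by (simp add: G G1_def)
  have xP: "x = pres_gen {Gx, Gy} (rels_G1 r) Gx" and yP: "y = pres_gen {Gx, Gy} (rels_G1 r) Gy"
    by (simp_all add: x y G1_gen_def)
  interpret G: group G by (simp add: GP P.group_presentation)
  interpret xy: two_generated G x y
    using P.pres_gen_closed P.presentation_generated by unfold_locales (auto simp: GP xP yP)
  have base: "commuting_relation r G (shift G x y 0) (shift G x y 1) (shift G x y 2)"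
  proof -
    obtain u v where uv: "(u, v) \<in> rels_G1 r" unfolding rels_G1_def by (metis singletonI surj_pair)
    from P.presentation_relation[OF uv] show ?thesis
      using G.free_lift_rel_G1[of "pres_gen {Gx, Gy} (rels_G1 r)", OF _ _ uv]
        G.rel_G1_iff[OF xy.x_closed xy.y_closed] xy.x_closed xy.y_closed
      by (simp add: GP[symmetric] xP[symmetric] yP[symmetric])
  qed
  \<comment> \<open>Conjugation by the power \<open>i - 1\<close> of \<open>y\<close> carries the
    indices \<open>0\<close>, \<open>1\<close>, \<open>2\<close> to \<open>i - 1\<close>,
    \<open>i\<close>, \<open>i + 1\<close>; the single defining relation thus supplies those of all
    factors.\<close>
  have "commuting_relation r G (shift G x y (i - 1)) (shift G x y i) (shift G x y (i + 1))" for i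
    using G.commuting_relation_hom[OF G.is_group xy.conj_y_pow_hom[of "i - 1"] _ _ _ base]
    by (simp add: xy.shift_conj_pow add.commute)
  then have rel: "free_lift G (shift G x y) u = free_lift G (shift G x y) v" if "(u, v) \<in> rels_A1 r i" for i u v
    using G.free_lift_rels_A1[OF _ that] by auto
  interpret M: group chain.M by (rule chain.group_amalgam)
  interpret W: group "wreath chain.M" by (rule M.group_wreath)
  have "commuting_relation r chain.M (chain.chain_gen k) (chain.chain_gen (k + 1)) (chain.chain_gen (k + 2))" for k
  proof -
    \<comment> \<open>The triple that starts at \<open>k\<close> is centred at \<open>k + 1\<close>,
      so its relation comes from that factor.\<close>
    obtain u v where uv: "(u, v) \<in> rels_A1 r (k + 1)"
      using rels_A1_nonempty by (metis ex_in_conv surj_pair)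
    show ?thesis
      using chain.chain_gen_relation[OF uv] M.free_lift_rels_A1[OF _ uv, of chain.chain_gen] by (simp add: add.assoc)
  qed
  \<comment> \<open>The three shifted sequences have integer component zero, so powers and products
    are formed place by place; place \<open>k\<close> asserts the relation for the indices
    \<open>k\<close>, \<open>k + 1\<close>, \<open>k + 2\<close>.\<close>
  then have "commuting_relation r (wreath chain.M) (shift (wreath chain.M) (chain.chain_gen, 0) (\<lambda>k. \<one>\<^bsub>chain.M\<^esub>, 1) 0)
      (shift (wreath chain.M) (chain.chain_gen, 0) (\<lambda>k. \<one>\<^bsub>chain.M\<^esub>, 1) 1)
      (shift (wreath chain.M) (chain.chain_gen, 0) (\<lambda>k. \<one>\<^bsub>chain.M\<^esub>, 1) 2)"
    by (simp add: M.shift_wreath M.wreath_base_int_pow commuting_relation_def)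
  then have "free_lift (wreath chain.M) (case_gen_xy (chain.chain_gen, 0) (\<lambda>k. \<one>\<^bsub>chain.M\<^esub>, 1)) u =
      free_lift (wreath chain.M) (case_gen_xy (chain.chain_gen, 0) (\<lambda>k. \<one>\<^bsub>chain.M\<^esub>, 1)) v"
    if "(u, v) \<in> rels_G1 r" for u v
    using W.free_lift_rel_G1[OF _ _ that, of "case_gen_xy (chain.chain_gen, 0) (\<lambda>k. \<one>\<^bsub>chain.M\<^esub>, 1)"]
      W.rel_G1_iff[of "(chain.chain_gen, 0)" "(\<lambda>k. \<one>\<^bsub>chain.M\<^esub>, 1)" r]
    by simp
  from chain.semidirect_amalgam[OF rels_G1_words GP xP yP H rel this] show ?thesis
    unfolding A a B C .
qed

text \<open>The argument for the first group carries over with \<open>balanced_relation\<close> in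
  place of \<open>commuting_relation\<close>: it too is preserved by homomorphisms and can be
  checked place by place.\<close>

lemma G2_semidirect_amalgam:
  assumes G: "G = G2" and x: "x = G2_gen Gx" and y: "y = G2_gen Gy"
    and H: "H = generate G (range (shift G x y))"
    and A: "A = chain_factor rels_A2" and a: "a = factor_gen rels_A2"
    and B: "B = edge_in rels_A2" and C: "C = edge_out rels_A2"
  shows "internal_semidirect G H (generate G {y}) \<and> infinite_cyclic_on G y \<and>
    (\<exists>\<phi>. amalgam_data A B C \<phi> \<and>
       (\<forall>i. \<phi> i (a i i) = a (i + 1) i \<and> \<phi> i (a i (i + 1)) = a (i + 1) (i + 1)) \<and>
       (\<exists>\<Phi> \<in> iso (amalgam A B \<phi>) (G\<lparr>carrier := H\<rparr>).
          \<forall>i. \<forall>j \<in> {i - 1, i, i + 1}. \<Phi> (amalgam_in A B \<phi> i (a i j)) = shift G x y j)) \<and>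
    (\<forall>i. (A i)\<lparr>carrier := B i\<rparr> \<cong> F2 \<and> (A (i + 1))\<lparr>carrier := C i\<rparr> \<cong> F2)"
proof -
  interpret chain: factor_chain rels_A2 by (rule factor_chain_A2)
  interpret P: group_presentation "{Gx, Gy}" rels_G2
    by unfold_locales (rule rels_G2_words)
  have GP: "G = presentation {Gx, Gy} rels_G2" by (simp add: G G2_def)
  have xP: "x = pres_gen {Gx, Gy} rels_G2 Gx" and yP: "y = pres_gen {Gx, Gy} rels_G2 Gy"
    by (simp_all add: x y G2_gen_def)
  interpret G: group G by (simp add: GP P.group_presentation)
  interpret xy: two_generated G x y
    using P.pres_gen_closed P.presentation_generated by unfold_locales (auto simp: GP xP yP)
  have base: "balanced_relation G (shift G x y 0) (shift G x y 1) (shift G x y 2)"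
  proof -
    obtain u v where uv: "(u, v) \<in> rels_G2" unfolding rels_G2_def by (metis singletonI surj_pair)
    from P.presentation_relation[OF uv] show ?thesis
      using G.free_lift_rel_G2[of "pres_gen {Gx, Gy} rels_G2", OF _ _ uv]
        G.rel_G2_iff[OF xy.x_closed xy.y_closed] xy.x_closed xy.y_closed
      by (simp add: GP[symmetric] xP[symmetric] yP[symmetric])
  qed
  have "balanced_relation G (shift G x y (i - 1)) (shift G x y i) (shift G x y (i + 1))" for i
    using G.balanced_relation_hom[OF G.is_group xy.conj_y_pow_hom[of "i - 1"] _ _ _ base]
    by (simp add: xy.shift_conj_pow add.commute)
  then have rel: "free_lift G (shift G x y) u = free_lift G (shift G x y) v" if "(u, v) \<in> rels_A2 i" for i u v
    using G.free_lift_rels_A2[OF _ that] by auto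
  interpret M: group chain.M by (rule chain.group_amalgam)
  interpret W: group "wreath chain.M" by (rule M.group_wreath)
  have "balanced_relation chain.M (chain.chain_gen k) (chain.chain_gen (k + 1)) (chain.chain_gen (k + 2))" for k
  proof -
    obtain u v where uv: "(u, v) \<in> rels_A2 (k + 1)"
      unfolding rels_A2_def by (metis singletonI surj_pair)
    show ?thesis
      using chain.chain_gen_relation[OF uv] M.free_lift_rels_A2[OF _ uv, of chain.chain_gen] by (simp add: add.assoc)
  qed
  then have "balanced_relation (wreath chain.M) (shift (wreath chain.M) (chain.chain_gen, 0) (\<lambda>k. \<one>\<^bsub>chain.M\<^esub>, 1) 0)
      (shift (wreath chain.M) (chain.chain_gen, 0) (\<lambda>k. \<one>\<^bsub>chain.M\<^esub>, 1) 1)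
      (shift (wreath chain.M) (chain.chain_gen, 0) (\<lambda>k. \<one>\<^bsub>chain.M\<^esub>, 1) 2)"
    by (simp add: M.shift_wreath M.wreath_inv balanced_relation_def)
  then have "free_lift (wreath chain.M) (case_gen_xy (chain.chain_gen, 0) (\<lambda>k. \<one>\<^bsub>chain.M\<^esub>, 1)) u =
      free_lift (wreath chain.M) (case_gen_xy (chain.chain_gen, 0) (\<lambda>k. \<one>\<^bsub>chain.M\<^esub>, 1)) v"
    if "(u, v) \<in> rels_G2" for u v
    using W.free_lift_rel_G2[OF _ _ that, of "case_gen_xy (chain.chain_gen, 0) (\<lambda>k. \<one>\<^bsub>chain.M\<^esub>, 1)"]
      W.rel_G2_iff[of "(chain.chain_gen, 0)" "(\<lambda>k. \<one>\<^bsub>chain.M\<^esub>, 1)"]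
    by simp
  from chain.semidirect_amalgam[OF rels_G2_words GP xP yP H rel this] show ?thesis
    unfolding A a B C .
qed

section \<open>Free products\<close>

locale two_groups = G: group G + K: group K
  for G :: "('a, 'c) monoid_scheme" and K :: "('b, 'd) monoid_scheme"
begin

sublocale fp: group_presentation "fp_gens G K" "fp_rels G K"
proof
  have "table (fp_gens G K) Inl G \<subseteq> carrier (free_group (fp_gens G K)) \<times> carrier (free_group (fp_gens G K))"
    by (rule table_words[OF G.is_group]) (auto simp: fp_gens_def)
  moreover
  have "table (fp_gens G K) Inr K \<subseteq> carrier (free_group (fp_gens G K)) \<times> carrier (free_group (fp_gens G K))"
    by (rule table_words[OF K.is_group]) (auto simp: fp_gens_def)
  ultimately show "fp_rels G K \<subseteq> carrier (free_group (fp_gens G K)) \<times> carrier (free_group (fp_gens G K))"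
    by (simp add: fp_rels_def)
qed

lemma group_free_product [simp, intro]: "group (free_product G K)"
  unfolding free_product_def by (rule fp.group_presentation)

lemma fp_in1_hom: "fp_in1 G K \<in> hom G (free_product G K)"
  unfolding free_product_def fp_in1_def[abs_def]
  by (rule fp.table_hom[OF G.is_group]) (auto simp: fp_gens_def fp_rels_def)

lemma fp_in2_hom: "fp_in2 G K \<in> hom K (free_product G K)"
  unfolding free_product_def fp_in2_def[abs_def]
  by (rule fp.table_hom[OF K.is_group]) (auto simp: fp_gens_def fp_rels_def)

lemma fp_in1_closed: "p \<in> carrier G \<Longrightarrow> fp_in1 G K p \<in> carrier (free_product G K)"
  using fp_in1_hom by (auto simp: hom_def)

lemma fp_in2_closed: "q \<in> carrier K \<Longrightarrow> fp_in2 G K q \<in> carrier (free_product G K)"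
  using fp_in2_hom by (auto simp: hom_def)

lemma free_product_generated:
  "generate (free_product G K) (fp_in1 G K ` carrier G \<union> fp_in2 G K ` carrier K) = carrier (free_product G K)"
proof -
  have "pres_gen (fp_gens G K) (fp_rels G K) ` fp_gens G K = fp_in1 G K ` carrier G \<union> fp_in2 G K ` carrier K"
    by (auto simp: fp_gens_def fp_in1_def fp_in2_def image_iff)
  then show ?thesis
    using fp.presentation_generated by (simp add: free_product_def)
qed

lemma free_product_lift:
  assumes "group L" and f: "f \<in> hom G L" and g: "g \<in> hom K L"
  obtains h where "h \<in> hom (free_product G K) L"
    "\<And>p. p \<in> carrier G \<Longrightarrow> h (fp_in1 G K p) = f p" "\<And>q. q \<in> carrier K \<Longrightarrow> h (fp_in2 G K q) = g q"
proof (rule fp.presentation_lift[OF \<open>group L\<close>, of "case_sum f g"])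
  show F: "case_sum f g \<in> fp_gens G K \<rightarrow> carrier L"
    using f g by (auto simp: fp_gens_def hom_def)
  fix u v
  assume "(u, v) \<in> fp_rels G K"
  then consider "(u, v) \<in> table (fp_gens G K) Inl G" | "(u, v) \<in> table (fp_gens G K) Inr K"
    unfolding fp_rels_def by blast
  then show "free_lift L (case_sum f g) u = free_lift L (case_sum f g) v"
  proof cases
    case 1
    then show ?thesis
      by (rule free_lift_table[OF \<open>group L\<close> F G.is_group, rotated 2])
        (use f in \<open>auto simp: fp_gens_def\<close>)
  next
    case 2
    then show ?thesis
      by (rule free_lift_table[OF \<open>group L\<close> F K.is_group, rotated 2])
        (use g in \<open>auto simp: fp_gens_def\<close>)
  qed
next
  fix h
  assume h: "h \<in> hom (presentation (fp_gens G K) (fp_rels G K)) L"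
    and eq: "\<And>s. s \<in> fp_gens G K \<Longrightarrow> h (pres_gen (fp_gens G K) (fp_rels G K) s) = case_sum f g s"
  have "Inl p \<in> fp_gens G K \<longleftrightarrow> p \<in> carrier G" "Inr q \<in> fp_gens G K \<longleftrightarrow> q \<in> carrier K" for p q
    by (auto simp: fp_gens_def)
  then show thesis
    using h by (intro that[of h]) (simp_all add: free_product_def fp_in1_def fp_in2_def eq)
qed

end

text \<open>Mutually inverse maps of the factors induce mutually inverse maps of the free products.
  This replaces the cyclic subgroups of \<open>A_i\<close> by copies of the integers.\<close>

lemma free_product_cong:
  assumes "group G" "group G'" "group K" "group K'" "G \<cong> G'" "K \<cong> K'"
  shows "free_product G K \<cong> free_product G' K'"
proof -
  interpret A: two_groups G K using assms by (simp add: two_groups_def)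
  interpret A': two_groups G' K' using assms by (simp add: two_groups_def)
  obtain f f' where f: "group_isomorphisms G G' f f'"
    using \<open>G \<cong> G'\<close> A.G.iso_iff_group_isomorphisms unfolding is_iso_def by blast
  obtain g g' where g: "group_isomorphisms K K' g g'"
    using \<open>K \<cong> K'\<close> A.K.iso_iff_group_isomorphisms unfolding is_iso_def by blast
  have homs: "f \<in> hom G G'" "f' \<in> hom G' G" "g \<in> hom K K'" "g' \<in> hom K' K"
    using f g by (auto simp: group_isomorphisms_def)
  obtain h where h: "h \<in> hom (free_product G K) (free_product G' K')"
      "\<And>p. p \<in> carrier G \<Longrightarrow> h (fp_in1 G K p) = (fp_in1 G' K' \<circ> f) p"
      "\<And>q. q \<in> carrier K \<Longrightarrow> h (fp_in2 G K q) = (fp_in2 G' K' \<circ> g) q"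
    using A.free_product_lift[OF A'.group_free_product Group.hom_compose[OF homs(1) A'.fp_in1_hom]
        Group.hom_compose[OF homs(3) A'.fp_in2_hom]] by blast
  obtain h' where h': "h' \<in> hom (free_product G' K') (free_product G K)"
      "\<And>p. p \<in> carrier G' \<Longrightarrow> h' (fp_in1 G' K' p) = (fp_in1 G K \<circ> f') p"
      "\<And>q. q \<in> carrier K' \<Longrightarrow> h' (fp_in2 G' K' q) = (fp_in2 G K \<circ> g') q"
    using A'.free_product_lift[OF A.group_free_product Group.hom_compose[OF homs(2) A.fp_in1_hom]
        Group.hom_compose[OF homs(4) A.fp_in2_hom]] by blast
  have "group_isomorphisms (free_product G K) (free_product G' K') h h'"
    by (rule group_isomorphismsI_generators[OF _ _ _ A.free_product_generated _ A'.free_product_generated h(1) h'(1)])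
      (use f g homs h(2,3) h'(2,3) in
        \<open>auto simp: group_isomorphisms_def hom_in_carrier A.fp_in1_closed A.fp_in2_closed A'.fp_in1_closed A'.fp_in2_closed\<close>)
  then show ?thesis
    using group_isomorphisms_imp_iso unfolding is_iso_def by blast
qed


section \<open>The factors for \<open>r = 1\<close>\<close>

context group
begin

lemma int_pow_commute:
  assumes "p \<in> carrier G" "q \<in> carrier G" "p \<otimes> q = q \<otimes> p"
  shows "p [^] (r :: int) \<otimes> q = q \<otimes> p [^] r"
proof -
  have "inv q \<otimes> p \<otimes> q = p"
    using assms by (simp add: m_assoc inv_mult_cancel)
  then have "p [^] r = inv q \<otimes> p [^] r \<otimes> q"
    using int_pow_conj[OF assms(1,2), of r] by simp
  then have "q \<otimes> p [^] r = q \<otimes> (inv q \<otimes> p [^] r \<otimes> q)" by simp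
  then show ?thesis
    using assms by (simp add: group_normal_form)
qed

lemma generate_commute:
  assumes uv: "u \<in> carrier G" "v \<in> carrier G" "u \<otimes> v = v \<otimes> u"
    and "p \<in> generate G {u}" "q \<in> generate G {v}"
  shows "p \<otimes> q = q \<otimes> p"
proof -
  obtain m n :: int where "p = u [^] m" "q = v [^] n"
    using assms(4,5) uv(1,2) by (auto simp: generate_pow)
  moreover have "u [^] m \<otimes> v = v \<otimes> u [^] m"
    using uv by (rule int_pow_commute)
  then have "v [^] n \<otimes> u [^] m = u [^] m \<otimes> v [^] n"
    using uv by (intro int_pow_commute) auto
  ultimately show ?thesis by simp
qed

end

lemma A1_relation:
  fixes r i
  defines "G \<equiv> chain_factor (rels_A1 r) i" and "a \<equiv> factor_gen (rels_A1 r) i"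
  shows "commuting_relation r G (a (i - 1)) (a i) (a (i + 1))"
proof -
  interpret chain: factor_chain "rels_A1 r" by (rule factor_chain_A1)
  interpret G: group G by (simp add: G_def)
  obtain u v where uv: "(u, v) \<in> rels_A1 r i"
    using rels_A1_nonempty by (metis ex_in_conv surj_pair)
  show ?thesis
    using chain.factor_relation[OF uv] G.free_lift_rels_A1[OF _ uv, of a] chain.factor_gen_closed[of _ i]
    by (auto simp: G_def a_def)
qed

lemma A1_lift:
  assumes "group K" "p \<in> carrier K" "q \<in> carrier K" "s \<in> carrier K" "commuting_relation r K p q s"
  obtains h where "h \<in> hom (chain_factor (rels_A1 r) i) K" "h (factor_gen (rels_A1 r) i (i - 1)) = p"
    "h (factor_gen (rels_A1 r) i i) = q" "h (factor_gen (rels_A1 r) i (i + 1)) = s"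
proof -
  interpret chain: factor_chain "rels_A1 r" by (rule factor_chain_A1)
  interpret K: group K by fact
  let ?f = "\<lambda>j. if j = i - 1 then p else if j = i then q else s"
  obtain h where "h \<in> hom (chain_factor (rels_A1 r) i) K"
      "\<And>j. j \<in> {i - 1, i, i + 1} \<Longrightarrow> h (factor_gen (rels_A1 r) i j) = ?f j"
  proof (rule chain.factor_lift[OF \<open>group K\<close>, of ?f i])
    fix u v
    assume "(u, v) \<in> rels_A1 r i"
    then show "free_lift K ?f u = free_lift K ?f v"
      using assms by (subst K.free_lift_rels_A1) auto
  qed (use assms in auto)
  then show thesis
    by (intro that[of h]) auto
qed

text \<open>Eliminating \<open>x\<^sub>i\<^sub>-\<^sub>1\<close> in favour of \<open>v = x\<^sub>i\<^sub>-\<^sub>1 x\<^sub>i\<^sub>+\<^sub>1\<close> leaves the single relation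
  \<open>[x\<^sub>i, v] = 1\<close>.\<close>

lemma A1_free_product:
  assumes G: "G = chain_factor (rels_A1 1) i"
    and u: "u = factor_gen (rels_A1 1) i i"
    and v: "v = factor_gen (rels_A1 1) i (i - 1) \<otimes>\<^bsub>G\<^esub> factor_gen (rels_A1 1) i (i + 1)"
    and w: "w = factor_gen (rels_A1 1) i (i + 1)"
    and P: "P = G\<lparr>carrier := generate G {u}\<rparr> \<times>\<times> G\<lparr>carrier := generate G {v}\<rparr>"
    and Q: "Q = G\<lparr>carrier := generate G {w}\<rparr>"
  shows "infinite_cyclic_on G u \<and> infinite_cyclic_on G v \<and> infinite_cyclic_on G w \<and>
    (\<exists>\<psi> \<in> iso (free_product P Q) G.
       (\<forall>p \<in> carrier P. \<psi> (fp_in1 P Q p) = fst p \<otimes>\<^bsub>G\<^esub> snd p) \<and>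
       (\<forall>q \<in> carrier Q. \<psi> (fp_in2 P Q q) = q)) \<and>
    G \<cong> free_product (integer_group \<times>\<times> integer_group) integer_group"
proof -
  interpret chain: factor_chain "rels_A1 1" by (rule factor_chain_A1)
  interpret G: group G by (simp add: G)
  define c where "c = factor_gen (rels_A1 1) i (i - 1)"
  have closed: "c \<in> carrier G" "u \<in> carrier G" "w \<in> carrier G"
    unfolding c_def u w G by (auto intro: chain.factor_gen_closed)
  have v: "v = c \<otimes>\<^bsub>G\<^esub> w" by (simp add: v c_def w)
  have v_closed: "v \<in> carrier G" using closed by (simp add: v)
  have gens: "generate G {c, u, w} = carrier G"
    using chain.factor_generated[of i] by (simp add: G c_def u w)
  have uv: "u \<otimes>\<^bsub>G\<^esub> v = v \<otimes>\<^bsub>G\<^esub> u"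
    using A1_relation[of 1 i] closed by (simp add: commuting_relation_def v flip: c_def u w G)

  let ?U = "G\<lparr>carrier := generate G {u}\<rparr>" and ?V = "G\<lparr>carrier := generate G {v}\<rparr>"
  have sub: "subgroup (generate G {u}) G" "subgroup (generate G {v}) G" "subgroup (generate G {w}) G"
    using closed v_closed by (auto intro!: G.generate_is_subgroup)
  have groups: "group ?U" "group ?V" "group Q"
    using sub by (auto simp: Q intro: G.subgroup_imp_group)
  have in_gen: "u \<in> generate G {u}" "v \<in> generate G {v}" "w \<in> generate G {w}"
    by (auto intro: generate.incl)
  have in_carrier: "g \<in> carrier G" if "g \<in> generate G {u} \<or> g \<in> generate G {v} \<or> g \<in> generate G {w}" for g
    using that sub subgroup.mem_carrier by metis
  have "group P" unfolding P using groups by (intro DirProd_group)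
  with groups interpret PQ: two_groups P Q
    by (simp add: two_groups_def)
  let ?FP = "free_product P Q"
  interpret FP: group ?FP by (rule PQ.group_free_product)

  \<comment> \<open>The relation holds in every abelian group, so the images of the three generators
    may be prescribed freely. They are chosen to give \<open>u\<close>, \<open>v\<close> and
    \<open>w\<close> degree \<open>1\<close> in turn; under \<open>dv\<close> the element
    \<open>v = c w\<close> has degree \<open>1 + 0\<close>.\<close>
  obtain du where du: "du \<in> hom G integer_group" "du c = 0" "du u = 1" "du w = 0"
    unfolding G c_def u w
    by (rule A1_lift[of integer_group 0 1 0 1 i]) (auto simp: commuting_relation_def)
  obtain dv where dv: "dv \<in> hom G integer_group" "dv c = 1" "dv u = 0" "dv w = 0"
    unfolding G c_def u w
    by (rule A1_lift[of integer_group 1 0 0 1 i]) (auto simp: commuting_relation_def)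
  obtain dw where dw: "dw \<in> hom G integer_group" "dw c = 0" "dw u = 0" "dw w = 1"
    unfolding G c_def u w
    by (rule A1_lift[of integer_group 0 0 1 1 i]) (auto simp: commuting_relation_def)
  have cyclic: "infinite_cyclic_on G u" "infinite_cyclic_on G v" "infinite_cyclic_on G w"
    using infinite_cyclic_onI[OF G.is_group _ du(1)] infinite_cyclic_onI[OF G.is_group _ dv(1)]
      infinite_cyclic_onI[OF G.is_group _ dw(1)] closed v_closed du dv dw hom_mult[OF dv(1), of c w]
    by (auto simp: v)

  have "(\<lambda>p. fst p \<otimes>\<^bsub>G\<^esub> snd p) \<in> hom P G"
  proof (rule homI)
    fix p p'
    assume p: "p \<in> carrier P" "p' \<in> carrier P"
    then have mem: "fst p \<in> generate G {u}" "snd p \<in> generate G {v}"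
      "fst p' \<in> generate G {u}" "snd p' \<in> generate G {v}"
      by (auto simp: P)
    then show "fst p \<otimes>\<^bsub>G\<^esub> snd p \<in> carrier G"
      using in_carrier by blast
    have carr: "fst p \<in> carrier G" "snd p \<in> carrier G" "fst p' \<in> carrier G" "snd p' \<in> carrier G"
      using mem in_carrier by blast+
    have "fst p' \<otimes>\<^bsub>G\<^esub> snd p = snd p \<otimes>\<^bsub>G\<^esub> fst p'"
      by (rule G.generate_commute[OF closed(2) v_closed uv mem(3) mem(2)])
    then have "fst p' \<otimes>\<^bsub>G\<^esub> (snd p \<otimes>\<^bsub>G\<^esub> snd p') = snd p \<otimes>\<^bsub>G\<^esub> (fst p' \<otimes>\<^bsub>G\<^esub> snd p')"
      using carr by (simp add: G.m_assoc[symmetric])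
    then show "fst (p \<otimes>\<^bsub>P\<^esub> p') \<otimes>\<^bsub>G\<^esub> snd (p \<otimes>\<^bsub>P\<^esub> p') = fst p \<otimes>\<^bsub>G\<^esub> snd p \<otimes>\<^bsub>G\<^esub> (fst p' \<otimes>\<^bsub>G\<^esub> snd p')"
      using carr by (cases p; cases p') (simp add: P G.m_assoc)
  qed
  moreover have "(\<lambda>q. q) \<in> hom Q G"
    using in_carrier by (auto simp: Q hom_def)
  ultimately obtain \<psi> where \<psi>: "\<psi> \<in> hom ?FP G"
      "\<And>p. p \<in> carrier P \<Longrightarrow> \<psi> (fp_in1 P Q p) = fst p \<otimes>\<^bsub>G\<^esub> snd p"
      "\<And>q. q \<in> carrier Q \<Longrightarrow> \<psi> (fp_in2 P Q q) = q"
    using PQ.free_product_lift[OF G.is_group] by blast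

  have one: "\<one>\<^bsub>G\<^esub> \<in> generate G {u}" "\<one>\<^bsub>G\<^esub> \<in> generate G {v}"
    by (auto intro: generate.one)
  let ?u = "fp_in1 P Q (u, \<one>\<^bsub>G\<^esub>)" and ?v = "fp_in1 P Q (\<one>\<^bsub>G\<^esub>, v)" and ?w = "fp_in2 P Q w"
  have mem: "(u, \<one>\<^bsub>G\<^esub>) \<in> carrier P" "(\<one>\<^bsub>G\<^esub>, v) \<in> carrier P" "w \<in> carrier Q"
    using one in_gen by (auto simp: P Q)
  then have FPc: "?u \<in> carrier ?FP" "?v \<in> carrier ?FP" "?w \<in> carrier ?FP"
    by (auto intro: PQ.fp_in1_closed PQ.fp_in2_closed)
  have "?u \<otimes>\<^bsub>?FP\<^esub> ?v = ?v \<otimes>\<^bsub>?FP\<^esub> ?u"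
    using mem closed v_closed by (simp add: hom_mult[OF PQ.fp_in1_hom, symmetric]) (simp add: P)
  \<comment> \<open>Since \<open>c = v w^-1\<close> in \<open>G\<close>, the inverse map has to send
    \<open>c\<close> to the corresponding product. The combination \<open>c w\<close> then becomes
    \<open>?v\<close>, and the relation of the factor is the commutation of \<open>?u\<close> and
    \<open>?v\<close>.\<close>
  then have "commuting_relation 1 ?FP (?v \<otimes>\<^bsub>?FP\<^esub> inv\<^bsub>?FP\<^esub> ?w) ?u ?w"
    using FPc by (simp add: commuting_relation_def FP.m_assoc)
  then obtain \<theta> where \<theta>: "\<theta> \<in> hom G ?FP" "\<theta> c = ?v \<otimes>\<^bsub>?FP\<^esub> inv\<^bsub>?FP\<^esub> ?w" "\<theta> u = ?u" "\<theta> w = ?w"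
    unfolding G c_def u w
    by (rule A1_lift[OF FP.is_group, rotated 3]) (use FPc in \<open>auto simp: G c_def u w\<close>)
  interpret \<psi>: group_hom ?FP G \<psi>
    using \<psi>(1) by (simp add: group_hom_def group_hom_axioms_def FP.is_group G.is_group)
  have \<theta>v: "\<theta> v = ?v"
    using hom_mult[OF \<theta>(1) closed(1,3)] FPc by (simp add: v \<theta> FP.m_assoc)

  have \<theta>_restrict: "\<theta> \<in> hom ?U ?FP" "\<theta> \<in> hom ?V ?FP" "\<theta> \<in> hom (G\<lparr>carrier := generate G {w}\<rparr>) ?FP"
    by (rule hom_restrict_carrier[OF \<theta>(1)]; use sub in \<open>blast dest: subgroup.subset\<close>)+
  \<comment> \<open>The free product is generated by all elements of \<open>P\<close> and
    \<open>Q\<close>, so \<open>\<theta>\<close> must be known on the whole of each cyclic subgroup.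
    There it is compared with the canonical map, the two agreeing on the generator.\<close>
  have \<theta>U: "\<theta> p = fp_in1 P Q (p, \<one>\<^bsub>G\<^esub>)" if "p \<in> generate G {u}" for p
  proof (rule hom_eq_on_generate[OF G.is_group FP.is_group _ _ _ _ that])
    have "(\<lambda>p. (p, \<one>\<^bsub>G\<^esub>)) \<in> hom ?U P"
      using one by (auto simp: hom_def P)
    from Group.hom_compose[OF this PQ.fp_in1_hom]
    show "(\<lambda>p. fp_in1 P Q (p, \<one>\<^bsub>G\<^esub>)) \<in> hom ?U ?FP" by (simp add: comp_def)
  qed (use \<theta> closed \<theta>_restrict in auto)
  have \<theta>V: "\<theta> p = fp_in1 P Q (\<one>\<^bsub>G\<^esub>, p)" if "p \<in> generate G {v}" for p
  proof (rule hom_eq_on_generate[OF G.is_group FP.is_group _ _ _ _ that])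
    have "(\<lambda>p. (\<one>\<^bsub>G\<^esub>, p)) \<in> hom ?V P"
      using one by (auto simp: hom_def P)
    from Group.hom_compose[OF this PQ.fp_in1_hom]
    show "(\<lambda>p. fp_in1 P Q (\<one>\<^bsub>G\<^esub>, p)) \<in> hom ?V ?FP" by (simp add: comp_def)
  qed (use \<theta>v v_closed \<theta>_restrict in auto)
  have \<theta>W: "\<theta> q = fp_in2 P Q q" if "q \<in> generate G {w}" for q
  proof (rule hom_eq_on_generate[OF G.is_group FP.is_group _ _ _ _ that])
    show "fp_in2 P Q \<in> hom (G\<lparr>carrier := generate G {w}\<rparr>) ?FP"
      using PQ.fp_in2_hom by (simp add: Q)
  qed (use \<theta> closed \<theta>_restrict in auto)
  have \<theta>P: "\<theta> (\<psi> (fp_in1 P Q p)) = fp_in1 P Q p" if p: "p \<in> carrier P" for p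
  proof -
    have mem: "fst p \<in> generate G {u}" "snd p \<in> generate G {v}"
      using p by (auto simp: P)
    have "\<theta> (\<psi> (fp_in1 P Q p)) = fp_in1 P Q (fst p, \<one>\<^bsub>G\<^esub>) \<otimes>\<^bsub>?FP\<^esub> fp_in1 P Q (\<one>\<^bsub>G\<^esub>, snd p)"
      using hom_mult[OF \<theta>(1), of "fst p" "snd p"] mem in_carrier p by (simp add: \<psi>(2) \<theta>U \<theta>V)
    also have "\<dots> = fp_in1 P Q ((fst p, \<one>\<^bsub>G\<^esub>) \<otimes>\<^bsub>P\<^esub> (\<one>\<^bsub>G\<^esub>, snd p))"
      using mem one by (intro hom_mult[OF PQ.fp_in1_hom, symmetric]) (auto simp: P)
    also have "(fst p, \<one>\<^bsub>G\<^esub>) \<otimes>\<^bsub>P\<^esub> (\<one>\<^bsub>G\<^esub>, snd p) = p"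
      using mem in_carrier by (cases p) (simp add: P)
    finally show ?thesis .
  qed
  have \<psi>\<theta>: "\<psi> (\<theta> g) = g" if "g \<in> {c, u, w}" for g
    using that mem closed v_closed FPc
    by (auto simp: \<theta> \<psi>(2,3) v G.m_assoc)
  have "group_isomorphisms ?FP G \<psi> \<theta>"
    by (rule group_isomorphismsI_generators[OF FP.is_group G.is_group _ PQ.free_product_generated _ gens \<psi>(1) \<theta>(1)])
      (use closed \<theta>P \<theta>W \<psi>(3) \<psi>\<theta> PQ.fp_in1_closed PQ.fp_in2_closed in \<open>auto simp: Q\<close>)
  then have isos: "\<psi> \<in> iso ?FP G" "?FP \<cong> G"
    using group_isomorphisms_imp_iso unfolding is_iso_def by blast+

  have Z: "?U \<cong> integer_group" "?V \<cong> integer_group" "Q \<cong> integer_group"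
    using cyclic by (auto simp: infinite_cyclic_on_def Q)
  have "P \<cong> integer_group \<times>\<times> integer_group"
    unfolding P by (rule group.DirProd_iso_trans[OF groups(1) Z(1,2)])
  then have "?FP \<cong> free_product (integer_group \<times>\<times> integer_group) integer_group"
    using Z(3) groups by (intro free_product_cong \<open>group P\<close> DirProd_group) auto
  then have "G \<cong> free_product (integer_group \<times>\<times> integer_group) integer_group"
    using iso_trans[OF FP.iso_sym[OF isos(2)]] by blast
  then show ?thesis
    using cyclic isos(1) \<psi>(2,3) by blast
qed

section \<open>HNN-extensions\<close>

locale hnn_setting =
  fixes G :: "('a, 'b) monoid_scheme" and A B \<phi>
  assumes data: "hnn_data G A B \<phi>"
begin

sublocale G: group G
  using data by (simp add: hnn_data_def)

lemma A_subgroup: "subgroup A G" and B_subgroup: "subgroup B G"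
  and \<phi>_iso: "\<phi> \<in> iso (G\<lparr>carrier := A\<rparr>) (G\<lparr>carrier := B\<rparr>)"
  using data by (simp_all add: hnn_data_def)

lemma A_closed: "c \<in> A \<Longrightarrow> c \<in> carrier G"
  using subgroup.subset[OF A_subgroup] by blast

lemma \<phi>_closed: "c \<in> A \<Longrightarrow> \<phi> c \<in> carrier G"
  using \<phi>_iso subgroup.subset[OF B_subgroup] by (auto simp: iso_def hom_def)

lemma \<phi>_hom: "\<phi> \<in> hom (G\<lparr>carrier := A\<rparr>) G"
  using \<phi>_iso subgroup.subset[OF B_subgroup] by (auto simp: iso_def hom_def)

sublocale hnn: group_presentation "hnn_gens G" "hnn_rels G A \<phi>"
proof
  interpret F: group "free_group (hnn_gens G)" by simp
  have "table (hnn_gens G) Some G \<subseteq> carrier (free_group (hnn_gens G)) \<times> carrier (free_group (hnn_gens G))"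
    by (rule table_words[OF G.is_group]) (auto simp: hnn_gens_def)
  moreover have "Some c \<in> hnn_gens G" "Some (\<phi> c) \<in> hnn_gens G" if "c \<in> A" for c
    using that A_closed \<phi>_closed by (auto simp: hnn_gens_def)
  moreover have "None \<in> hnn_gens G" by (simp add: hnn_gens_def)
  ultimately show "hnn_rels G A \<phi> \<subseteq> carrier (free_group (hnn_gens G)) \<times> carrier (free_group (hnn_gens G))"
    unfolding hnn_rels_def conj_by_def by auto
qed

lemma group_hnn [simp, intro]: "group (hnn G A \<phi>)"
  unfolding hnn_def by (rule hnn.group_presentation)

lemma hnn_in_hom: "hnn_in G A \<phi> \<in> hom G (hnn G A \<phi>)"
  unfolding hnn_def hnn_in_def[abs_def]
  by (rule hnn.table_hom[OF G.is_group]) (auto simp: hnn_gens_def hnn_rels_def)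

lemma hnn_in_closed: "c \<in> carrier G \<Longrightarrow> hnn_in G A \<phi> c \<in> carrier (hnn G A \<phi>)"
  using hnn_in_hom by (auto simp: hom_def)

lemma hnn_stable_closed: "hnn_stable G A \<phi> \<in> carrier (hnn G A \<phi>)"
  unfolding hnn_def hnn_stable_def by (rule hnn.pres_gen_closed) (simp add: hnn_gens_def)

lemma free_lift_conj_relation:
  assumes "group K" "f \<in> hnn_gens G \<rightarrow> carrier K" "c \<in> A"
  shows "free_lift K f (conj_by (free_group (hnn_gens G)) (free_gen (Some c)) (free_gen None))
    = inv\<^bsub>K\<^esub> f None \<otimes>\<^bsub>K\<^esub> f (Some c) \<otimes>\<^bsub>K\<^esub> f None"
    "free_lift K f (free_gen (Some (\<phi> c))) = f (Some (\<phi> c))"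
proof -
  interpret K: group K by fact
  interpret h: group_hom "free_group (hnn_gens G)" K "free_lift K f"
    using K.free_lift_hom[OF assms(2)] by (simp add: group_hom_def group_hom_axioms_def K.is_group)
  have gens: "Some c \<in> hnn_gens G" "Some (\<phi> c) \<in> hnn_gens G" "None \<in> hnn_gens G"
    using assms(3) A_closed \<phi>_closed by (auto simp: hnn_gens_def)
  moreover from this have "f (Some c) \<in> carrier K" "f (Some (\<phi> c)) \<in> carrier K" "f None \<in> carrier K"
    using assms(2) by auto
  ultimately show "free_lift K f (conj_by (free_group (hnn_gens G)) (free_gen (Some c)) (free_gen None))
    = inv\<^bsub>K\<^esub> f None \<otimes>\<^bsub>K\<^esub> f (Some c) \<otimes>\<^bsub>K\<^esub> f None"
    "free_lift K f (free_gen (Some (\<phi> c))) = f (Some (\<phi> c))"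
    by (simp_all add: conj_by_def K.free_lift_gen)
qed

lemma hnn_relation:
  assumes "c \<in> A"
  shows "inv\<^bsub>hnn G A \<phi>\<^esub> hnn_stable G A \<phi> \<otimes>\<^bsub>hnn G A \<phi>\<^esub> hnn_in G A \<phi> c \<otimes>\<^bsub>hnn G A \<phi>\<^esub> hnn_stable G A \<phi>
    = hnn_in G A \<phi> (\<phi> c)"
proof -
  have "(conj_by (free_group (hnn_gens G)) (free_gen (Some c)) (free_gen None), free_gen (Some (\<phi> c)))
      \<in> hnn_rels G A \<phi>"
    using assms by (auto simp: hnn_rels_def)
  from hnn.presentation_relation[OF this] show ?thesis
    using free_lift_conj_relation[OF hnn.group_presentation _ assms, of "pres_gen (hnn_gens G) (hnn_rels G A \<phi>)"]
    by (simp add: hnn.pres_gen_closed hnn_def hnn_in_def hnn_stable_def)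
qed

lemma hnn_generated:
  "generate (hnn G A \<phi>) (insert (hnn_stable G A \<phi>) (hnn_in G A \<phi> ` carrier G)) = carrier (hnn G A \<phi>)"
proof -
  have "pres_gen (hnn_gens G) (hnn_rels G A \<phi>) ` hnn_gens G
      = insert (hnn_stable G A \<phi>) (hnn_in G A \<phi> ` carrier G)"
    by (auto simp: hnn_gens_def hnn_in_def hnn_stable_def image_iff)
  then show ?thesis
    using hnn.presentation_generated by (simp add: hnn_def)
qed

lemma hnn_lift:
  assumes "group K" and f: "f \<in> hom G K" and t: "t \<in> carrier K"
    and conj: "\<And>c. c \<in> A \<Longrightarrow> inv\<^bsub>K\<^esub> t \<otimes>\<^bsub>K\<^esub> f c \<otimes>\<^bsub>K\<^esub> t = f (\<phi> c)"
  obtains h where "h \<in> hom (hnn G A \<phi>) K" "h (hnn_stable G A \<phi>) = t"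
    "\<And>c. c \<in> carrier G \<Longrightarrow> h (hnn_in G A \<phi> c) = f c"
proof (rule hnn.presentation_lift[OF \<open>group K\<close>, of "case_option t f"])
  show F: "case_option t f \<in> hnn_gens G \<rightarrow> carrier K"
    using f t by (auto simp: hnn_gens_def hom_def)
  fix u v
  assume "(u, v) \<in> hnn_rels G A \<phi>"
  then consider "(u, v) \<in> table (hnn_gens G) Some G"
    | c where "c \<in> A" "u = conj_by (free_group (hnn_gens G)) (free_gen (Some c)) (free_gen None)"
      "v = free_gen (Some (\<phi> c))"
    unfolding hnn_rels_def by blast
  then show "free_lift K (case_option t f) u = free_lift K (case_option t f) v"
  proof cases
    case 1
    then show ?thesis
      by (rule free_lift_table[OF \<open>group K\<close> F G.is_group, rotated 2])
        (use f in \<open>auto simp: hnn_gens_def\<close>)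
  next
    case 2
    then show ?thesis
      using free_lift_conj_relation[OF \<open>group K\<close> F] conj by simp
  qed
next
  fix h
  assume h: "h \<in> hom (presentation (hnn_gens G) (hnn_rels G A \<phi>)) K"
    and eq: "\<And>s. s \<in> hnn_gens G \<Longrightarrow> h (pres_gen (hnn_gens G) (hnn_rels G A \<phi>) s) = case_option t f s"
  have "None \<in> hnn_gens G" "Some c \<in> hnn_gens G \<longleftrightarrow> c \<in> carrier G" for c
    by (auto simp: hnn_gens_def)
  then show thesis
    using h by (intro that[of h]) (simp_all add: hnn_def hnn_in_def hnn_stable_def eq)
qed

end


section \<open>Two-generator subgroups of the free group of rank two\<close>

text \<open>\<open>A\<close> and \<open>B\<close> are both of this form, with the letters exchanged.
  Under \<open>\<rho>\<close> the letters depend on the parity of the place: \<open>a\<close> counts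
  at even places, \<open>b\<close> counts at odd ones and also moves one place up. Read from an even
  place, \<open>b a b\<close> meets its \<open>a\<close> at an odd place, where it is trivial, and
  only one of its two \<open>b\<close> counts; so it contributes a single \<open>b\<close> and
  restores the parity. Evaluation at \<open>0\<close> therefore recovers a word from its
  image.\<close>

lemma sandwich_lift_iso:
  fixes a b :: 'a
  assumes "a \<noteq> b"
  defines "F \<equiv> free_group {a, b}"
  defines "s \<equiv> free_gen b \<otimes>\<^bsub>F\<^esub> free_gen a \<otimes>\<^bsub>F\<^esub> free_gen b"
  shows "free_lift F (\<lambda>c. if c = a then free_gen a else s)
    \<in> iso F (F\<lparr>carrier := generate F {s, free_gen a}\<rparr>)"
proof -
  interpret F: group F by (simp add: F_def)
  interpret W: group "wreath F" by (rule F.group_wreath)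
  let ?f = "\<lambda>c. if c = a then free_gen a else s"
  have gens: "free_gen a \<in> carrier F" "free_gen b \<in> carrier F"
    by (simp_all add: F_def)
  then have s: "s \<in> carrier F" by (simp add: s_def)
  have f: "?f \<in> {a, b} \<rightarrow> carrier F" using gens s by auto

  txt \<open>The letters act on \<open>F \<times> \<int>\<close> so that, between even levels, \<open>b a b\<close> acts as
    left multiplication by \<open>b\<close> and \<open>a\<close> as left multiplication by \<open>a\<close>.\<close>
  define g :: "'a \<Rightarrow> (int \<Rightarrow> 'a word) \<times> int" where
    "g c = (if c = a then (\<lambda>k. if even k then free_gen a else \<one>\<^bsub>F\<^esub>, 0)
      else (\<lambda>k. if even k then \<one>\<^bsub>F\<^esub> else free_gen b, 1))" for c
  have g: "g \<in> {a, b} \<rightarrow> carrier (wreath F)"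
    using gens by (auto simp: g_def)
  define \<rho> where "\<rho> = free_lift (wreath F) g"
  have \<rho>: "\<rho> \<in> hom F (wreath F)"
    unfolding \<rho>_def F_def using g[unfolded F_def] W.free_lift_hom[unfolded F_def] by blast
  have \<rho>_gens: "\<rho> (free_gen a) = g a" "\<rho> (free_gen b) = g b"
    using g by (auto simp: \<rho>_def W.free_lift_gen)
  \<comment> \<open>The image of \<open>s\<close> moves by two places, so a vanishing integer
    component cannot be used. On \<open>T\<close> evaluation at \<open>0\<close> is still
    multiplicative, because the left factor is read at an even place, where its entry equals the one
    at \<open>0\<close>. Entries at odd places stay free: for \<open>s\<close> they are
    \<open>a b\<close>.\<close>
  define T where "T = {(f, n). (f, n) \<in> carrier (wreath F) \<and> even n \<and> (\<forall>j k. even j \<longrightarrow> even k \<longrightarrow> f j = f k)}"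
  have T_I: "(h, n) \<in> T" if "\<forall>k. h k \<in> carrier F" "even n" "\<And>k. even k \<Longrightarrow> h k = h 0" for h n
    using that unfolding T_def mem_Collect_eq split_conv wreath_carrier by metis
  have T_carrier: "\<forall>k. h k \<in> carrier F" and T_even: "even n" if "(h, n) \<in> T" for h n
    using that by (simp_all add: T_def)
  have T_value: "h k = h 0" if "(h, n) \<in> T" "even k" for h n k
    using that even_zero unfolding T_def mem_Collect_eq split_conv by blast
  have T: "subgroup T (wreath F)"
  proof (rule W.subgroupI)
    show "T \<subseteq> carrier (wreath F)"
      using T_carrier by auto
    have "(\<lambda>_. \<one>\<^bsub>F\<^esub>, 0) \<in> T" by (rule T_I) auto
    then show "T \<noteq> {}" by blast
    fix p q
    assume pq: "p \<in> T" "q \<in> T"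
    obtain h n where p: "p = (h, n)" by (cases p)
    obtain k m where q: "q = (k, m)" by (cases q)
    note h = T_carrier[OF pq(1)[unfolded p]] T_even[OF pq(1)[unfolded p]] T_value[OF pq(1)[unfolded p]]
    note k = T_carrier[OF pq(2)[unfolded q]] T_even[OF pq(2)[unfolded q]] T_value[OF pq(2)[unfolded q]]
    have "(\<lambda>j. inv\<^bsub>F\<^esub> h (j - n), - n) \<in> T"
    proof (rule T_I)
      fix j :: int assume "even j"
      then show "inv\<^bsub>F\<^esub> h (j - n) = inv\<^bsub>F\<^esub> h (0 - n)"
        using h(2) h(3)[of "j - n"] h(3)[of "0 - n"] by simp
    qed (use h in auto)
    then show "inv\<^bsub>wreath F\<^esub> p \<in> T"
      using h(1) by (simp add: p F.wreath_inv)
    have "(\<lambda>j. h (j + m) \<otimes>\<^bsub>F\<^esub> k j, n + m) \<in> T"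
    proof (rule T_I)
      fix j :: int assume "even j"
      then show "h (j + m) \<otimes>\<^bsub>F\<^esub> k j = h (0 + m) \<otimes>\<^bsub>F\<^esub> k 0"
        using k(2) h(3)[of "j + m"] h(3)[of "0 + m"] k(3)[of j] by simp
    qed (use h(1,2) k(1,2) in auto)
    then show "p \<otimes>\<^bsub>wreath F\<^esub> q \<in> T"
      by (simp add: p q)
  qed
  have eval: "(\<lambda>p. fst p 0) \<in> hom (wreath F\<lparr>carrier := T\<rparr>) F"
  proof (rule homI)
    fix p q
    assume "p \<in> carrier (wreath F\<lparr>carrier := T\<rparr>)" "q \<in> carrier (wreath F\<lparr>carrier := T\<rparr>)"
    then have pq: "p \<in> T" "q \<in> T" by simp_all
    obtain h n where p: "p = (h, n)" by (cases p)
    obtain k m where q: "q = (k, m)" by (cases q)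
    show "fst p 0 \<in> carrier F"
      using T_carrier[of h n] pq by (simp add: p)
    have "h m = h 0"
      using T_value[of h n m] T_even[of k m] pq by (simp add: p q)
    then show "fst (p \<otimes>\<^bsub>wreath F\<lparr>carrier := T\<rparr>\<^esub> q) 0 = fst p 0 \<otimes>\<^bsub>F\<^esub> fst q 0"
      by (simp add: p q)
  qed
  have lift: "free_lift F ?f \<in> hom F F"
    using F.free_lift_hom[OF f] by (simp add: F_def)
  have lift_gens: "free_lift F ?f (free_gen a) = free_gen a" "free_lift F ?f (free_gen b) = s"
    using assms(1) gens s by (auto simp: F.free_lift_gen)
  have comp: "\<rho> \<circ> free_lift F ?f \<in> hom F (wreath F)"
    by (rule Group.hom_compose[OF lift \<rho>])
  have \<rho>s: "\<rho> s = g b \<otimes>\<^bsub>wreath F\<^esub> g a \<otimes>\<^bsub>wreath F\<^esub> g b"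
    using gens hom_mult[OF \<rho>] by (simp add: s_def \<rho>_gens)
  have images: "\<rho> (free_gen a) \<in> T" "\<rho> s \<in> T"
    unfolding \<rho>s \<rho>_gens using gens assms(1) by (auto simp: g_def T_def)
  have F_gen: "generate F (free_gen ` {a, b}) = carrier F"
    by (simp only: F_def free_group_generated)
  have "(\<rho> \<circ> free_lift F ?f) ` carrier F = generate (wreath F) ((\<rho> \<circ> free_lift F ?f) ` free_gen ` {a, b})"
    unfolding F_gen[symmetric]
    by (rule hom_generate_image[OF F.is_group W.is_group comp]) (use gens in auto)
  also have "\<dots> \<subseteq> T"
    by (rule W.generate_subgroup_incl[OF _ T]) (use images lift_gens in auto)
  finally have "\<rho> \<circ> free_lift F ?f \<in> hom F (wreath F\<lparr>carrier := T\<rparr>)"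
    using comp by (auto simp: hom_def)
  from Group.hom_compose[OF this eval]
  have id: "(\<lambda>w. fst (\<rho> (free_lift F ?f w)) 0) \<in> hom F F"
    by (simp add: comp_def)
  have inverse: "fst (\<rho> (free_lift F ?f w)) 0 = w" if "w \<in> carrier F" for w
  proof -
    have "(\<lambda>w. fst (\<rho> (free_lift F ?f w)) 0) w = id w"
      by (rule hom_eq_on_carrier[OF F.is_group F.is_group _ F_gen id _ _ that])
        (use gens assms(1) in \<open>auto simp: lift_gens \<rho>s \<rho>_gens g_def hom_def\<close>)
    then show ?thesis by simp
  qed
  have "free_lift F ?f \<in> iso (free_group {a, b}) (F\<lparr>carrier := generate F (?f ` {a, b})\<rparr>)"
    by (rule free_lift_iso_generate[OF F.is_group f, of "\<lambda>v. fst (\<rho> v) 0"])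
      (use inverse in \<open>simp add: F_def\<close>)
  moreover have "?f ` {a, b} = {s, free_gen a}"
    using assms(1) by auto
  ultimately show ?thesis by (simp add: F_def)
qed

section \<open>The third group as an HNN-extension\<close>

lemma G3_rels_words:
  "G3_rels \<subseteq> carrier (free_group {Hx1, Hx2, Hy}) \<times> carrier (free_group {Hx1, Hx2, Hy})"
proof -
  interpret L: group "free_group {Hx1, Hx2, Hy}" by simp
  show ?thesis by (simp add: G3_rels_def rels_G3_def)
qed

lemma (in group) free_lift_G3_rels:
  assumes "f Hx1 \<in> carrier G" "f Hx2 \<in> carrier G" "f Hy \<in> carrier G"
  shows "(\<forall>(u, v) \<in> G3_rels. free_lift G f u = free_lift G f v) \<longleftrightarrow>
    (\<forall>(u, v) \<in> rels_G3 G (f Hx1) (f Hx2) (f Hy). u = v)"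
proof -
  have "free_lift G f \<in> hom (free_group {Hx1, Hx2, Hy}) G"
    using assms by (intro free_lift_hom) auto
  then interpret h: group_hom "free_group {Hx1, Hx2, Hy}" G "free_lift G f"
    by (simp add: group_hom_def group_hom_axioms_def is_group)
  show ?thesis
    using assms by (simp add: G3_rels_def rels_G3_def h.hom_int_pow free_lift_gen)
qed

text \<open>Solving the first relation for the conjugate of \<open>p\<close> puts both into the
  shape \<open>t^-1 c t = \<phi> c\<close>, with \<open>c\<close> running through a pair of
  generators of \<open>A\<close>.\<close>

lemma (in group) rels_G3_iff:
  assumes "p \<in> carrier G" "q \<in> carrier G" "t \<in> carrier G"
  shows "(\<forall>(u, v) \<in> rels_G3 G p q t. u = v) \<longleftrightarrow>
    inv t \<otimes> p \<otimes> t = inv q \<otimes> inv p \<otimes> inv q \<otimes> inv p \<otimes> q \<and>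
    inv t \<otimes> (p [^] (2 :: int) \<otimes> q \<otimes> p \<otimes> q) \<otimes> t = q"
proof -
  define e where "e = inv q \<otimes> inv p \<otimes> inv q \<otimes> inv p \<otimes> q"
  have e: "e \<in> carrier G" using assms by (simp add: e_def)
  have "p = t \<otimes> e \<otimes> inv t \<longleftrightarrow> inv t \<otimes> p \<otimes> t = e"
  proof
    assume p: "p = t \<otimes> e \<otimes> inv t"
    show "inv t \<otimes> p \<otimes> t = e"
      by (subst p) (use assms e in \<open>simp add: group_normal_form\<close>)
  next
    assume "inv t \<otimes> p \<otimes> t = e"
    then have "t \<otimes> (inv t \<otimes> p \<otimes> t) \<otimes> inv t = t \<otimes> e \<otimes> inv t" by simp
    then show "p = t \<otimes> e \<otimes> inv t"
      using assms by (simp add: group_normal_form)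
  qed
  moreover have "(\<forall>(u, v) \<in> rels_G3 G p q t. u = v) \<longleftrightarrow>
      p = t \<otimes> e \<otimes> inv t \<and> inv t \<otimes> (p [^] (2 :: int) \<otimes> q \<otimes> p \<otimes> q) \<otimes> t = q"
    using assms by (auto simp: rels_G3_def e_def m_assoc)
  ultimately show ?thesis by (simp add: e_def)
qed

text \<open>With \<open>s = x_2 x_1 x_2\<close> and \<open>t = x_1 x_2 x_1\<close> the prescribed
  values read \<open>\<phi> x_1 = x_2^-1 t^-1 x_2\<close> and
  \<open>\<phi> (x_1 x_1 s) = x_2\<close>, which forces
  \<open>\<phi> s = x_2^-1 t t x_2 x_2\<close>. Writing \<open>x_2\<close> for \<open>s\<close> in
  the source and \<open>x_1\<close> for \<open>t\<close> in the target turns this into the map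
  \<open>\<tau>\<close>, and \<open>\<phi>\<close> is assembled from \<open>\<tau>\<close> and the
  parametrisations \<open>\<alpha>\<close>, \<open>\<beta>\<close> of \<open>A\<close> and
  \<open>B\<close>.\<close>

lemma G3_hnn:
  assumes F: "F = free_group {Hx1, Hx2}" and x1: "x\<^sub>1 = free_gen Hx1" and x2: "x\<^sub>2 = free_gen Hx2"
    and A: "A = generate F {x\<^sub>2 \<otimes>\<^bsub>F\<^esub> x\<^sub>1 \<otimes>\<^bsub>F\<^esub> x\<^sub>2, x\<^sub>1}"
    and B: "B = generate F {x\<^sub>1 \<otimes>\<^bsub>F\<^esub> x\<^sub>2 \<otimes>\<^bsub>F\<^esub> x\<^sub>1, x\<^sub>2}"
  shows "F \<cong> F2 \<and> F\<lparr>carrier := A\<rparr> \<cong> F2 \<and> F\<lparr>carrier := B\<rparr> \<cong> F2 \<and>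
    (\<exists>\<phi>. hnn_data F A B \<phi> \<and>
       \<phi> x\<^sub>1 = inv\<^bsub>F\<^esub> x\<^sub>2 \<otimes>\<^bsub>F\<^esub> inv\<^bsub>F\<^esub> x\<^sub>1 \<otimes>\<^bsub>F\<^esub> inv\<^bsub>F\<^esub> x\<^sub>2 \<otimes>\<^bsub>F\<^esub> inv\<^bsub>F\<^esub> x\<^sub>1 \<otimes>\<^bsub>F\<^esub> x\<^sub>2 \<and>
       \<phi> (x\<^sub>1 [^]\<^bsub>F\<^esub> (2 :: int) \<otimes>\<^bsub>F\<^esub> x\<^sub>2 \<otimes>\<^bsub>F\<^esub> x\<^sub>1 \<otimes>\<^bsub>F\<^esub> x\<^sub>2) = x\<^sub>2 \<and>
       (\<exists>\<Phi> \<in> iso (hnn F A \<phi>) G3.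
          \<Phi> (hnn_in F A \<phi> x\<^sub>1) = G3_gen Hx1 \<and> \<Phi> (hnn_in F A \<phi> x\<^sub>2) = G3_gen Hx2 \<and>
          \<Phi> (hnn_stable F A \<phi>) = G3_gen Hy))"
proof -
  interpret F: group F by (simp add: F)
  have closed: "x\<^sub>1 \<in> carrier F" "x\<^sub>2 \<in> carrier F"
    by (simp_all add: F x1 x2)
  have F_gen: "generate F {x\<^sub>1, x\<^sub>2} = carrier F"
    using free_group_generated[of "{Hx1, Hx2}"] by (simp add: F x1 x2)
  let ?s = "x\<^sub>2 \<otimes>\<^bsub>F\<^esub> x\<^sub>1 \<otimes>\<^bsub>F\<^esub> x\<^sub>2" and ?t = "x\<^sub>1 \<otimes>\<^bsub>F\<^esub> x\<^sub>2 \<otimes>\<^bsub>F\<^esub> x\<^sub>1"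
  have lift: "\<exists>h \<in> hom F F. h x\<^sub>1 = p \<and> h x\<^sub>2 = q" if "p \<in> carrier F" "q \<in> carrier F" for p q
  proof
    let ?f = "\<lambda>c. if c = Hx1 then p else q"
    show "free_lift F ?f \<in> hom F F"
      using F.free_lift_hom[of ?f "{Hx1, Hx2}"] that by (simp add: F)
    show "free_lift F ?f x\<^sub>1 = p \<and> free_lift F ?f x\<^sub>2 = q"
      using that by (simp add: x1 x2 F.free_lift_gen)
  qed

  obtain \<alpha> where \<alpha>: "\<alpha> \<in> iso F (F\<lparr>carrier := A\<rparr>)" "\<alpha> x\<^sub>1 = x\<^sub>1" "\<alpha> x\<^sub>2 = ?s"
  proof -
    let ?f = "\<lambda>c. if c = Hx1 then x\<^sub>1 else ?s"
    have "free_lift F ?f \<in> iso F (F\<lparr>carrier := A\<rparr>)"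
      using sandwich_lift_iso[of Hx1 Hx2] unfolding F A x1 x2 by simp
    moreover have "free_lift F ?f x\<^sub>1 = x\<^sub>1" "free_lift F ?f x\<^sub>2 = ?s"
      using closed F.free_lift_gen[of ?f] by (simp_all add: x1 x2)
    ultimately show ?thesis by (rule that)
  qed
  obtain \<beta> where \<beta>: "\<beta> \<in> iso F (F\<lparr>carrier := B\<rparr>)" "\<beta> x\<^sub>1 = ?t" "\<beta> x\<^sub>2 = x\<^sub>2"
  proof -
    let ?f = "\<lambda>c. if c = Hx2 then x\<^sub>2 else ?t"
    have "free_lift F ?f \<in> iso F (F\<lparr>carrier := B\<rparr>)"
      using sandwich_lift_iso[of Hx2 Hx1] unfolding F B x1 x2 insert_commute[of Hx2 Hx1] by simp
    moreover have "free_lift F ?f x\<^sub>1 = ?t" "free_lift F ?f x\<^sub>2 = x\<^sub>2"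
      using closed F.free_lift_gen[of ?f] by (simp_all add: x1 x2)
    ultimately show ?thesis by (rule that)
  qed

  txt \<open>In terms of the bases \<open>(x\<^sub>1, x\<^sub>2 x\<^sub>1 x\<^sub>2)\<close> of \<open>A\<close> and \<open>(x\<^sub>1 x\<^sub>2 x\<^sub>1, x\<^sub>2)\<close> of \<open>B\<close>, the
    isomorphism is the following automorphism of the free group.\<close>
  have "\<exists>\<tau> \<in> hom F F. \<tau> x\<^sub>1 = inv\<^bsub>F\<^esub> x\<^sub>2 \<otimes>\<^bsub>F\<^esub> inv\<^bsub>F\<^esub> x\<^sub>1 \<otimes>\<^bsub>F\<^esub> x\<^sub>2 \<and> \<tau> x\<^sub>2 = inv\<^bsub>F\<^esub> x\<^sub>2 \<otimes>\<^bsub>F\<^esub> x\<^sub>1 \<otimes>\<^bsub>F\<^esub> x\<^sub>1 \<otimes>\<^bsub>F\<^esub> x\<^sub>2 \<otimes>\<^bsub>F\<^esub> x\<^sub>2"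
    using closed by (intro lift) auto
  then obtain \<tau> where \<tau>: "\<tau> \<in> hom F F" "\<tau> x\<^sub>1 = inv\<^bsub>F\<^esub> x\<^sub>2 \<otimes>\<^bsub>F\<^esub> inv\<^bsub>F\<^esub> x\<^sub>1 \<otimes>\<^bsub>F\<^esub> x\<^sub>2"
      "\<tau> x\<^sub>2 = inv\<^bsub>F\<^esub> x\<^sub>2 \<otimes>\<^bsub>F\<^esub> x\<^sub>1 \<otimes>\<^bsub>F\<^esub> x\<^sub>1 \<otimes>\<^bsub>F\<^esub> x\<^sub>2 \<otimes>\<^bsub>F\<^esub> x\<^sub>2"
    by blast
  \<comment> \<open>\<open>\<tau>\<close> sends \<open>?q\<close> to \<open>x_2\<close>, so the
    inverse sends \<open>x_2\<close> to \<open>?q\<close>; the equation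
    \<open>x_1 = x_2 (\<tau> x_1)^-1 x_2^-1\<close> then dictates its value at
    \<open>x_1\<close>.\<close>
  let ?q = "x\<^sub>1 \<otimes>\<^bsub>F\<^esub> x\<^sub>1 \<otimes>\<^bsub>F\<^esub> x\<^sub>2"
  have "\<exists>\<tau>' \<in> hom F F. \<tau>' x\<^sub>1 = ?q \<otimes>\<^bsub>F\<^esub> inv\<^bsub>F\<^esub> x\<^sub>1 \<otimes>\<^bsub>F\<^esub> inv\<^bsub>F\<^esub> ?q \<and> \<tau>' x\<^sub>2 = ?q"
    using closed by (intro lift) auto
  then obtain \<tau>' where \<tau>': "\<tau>' \<in> hom F F" "\<tau>' x\<^sub>1 = ?q \<otimes>\<^bsub>F\<^esub> inv\<^bsub>F\<^esub> x\<^sub>1 \<otimes>\<^bsub>F\<^esub> inv\<^bsub>F\<^esub> ?q" "\<tau>' x\<^sub>2 = ?q"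
    by blast
  interpret \<tau>: group_hom F F \<tau>
    using \<tau>(1) by (simp add: group_hom_def group_hom_axioms_def F.is_group)
  interpret \<tau>': group_hom F F \<tau>'
    using \<tau>'(1) by (simp add: group_hom_def group_hom_axioms_def F.is_group)
  have "group_isomorphisms F F \<tau> \<tau>'"
    by (rule group_isomorphismsI_generators[OF F.is_group F.is_group _ F_gen _ F_gen \<tau>(1) \<tau>'(1)])
      (use closed in \<open>auto simp: \<tau>(2,3) \<tau>'(2,3) F.group_normal_form\<close>)
  then have \<tau>_iso: "\<tau> \<in> iso F F"
    by (rule group_isomorphisms_imp_iso)

  define \<phi> where "\<phi> = \<beta> \<circ> (\<tau> \<circ> inv_into (carrier F) \<alpha>)"
  have \<phi>_iso: "\<phi> \<in> iso (F\<lparr>carrier := A\<rparr>) (F\<lparr>carrier := B\<rparr>)"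
    unfolding \<phi>_def
    by (rule iso_set_trans[OF iso_set_trans[OF F.iso_set_sym[OF \<alpha>(1)] \<tau>_iso] \<beta>(1)])
  have subs: "subgroup A F" "subgroup B F"
    unfolding A B by (rule F.generate_is_subgroup; use closed in simp)+
  have data: "hnn_data F A B \<phi>"
    using subs \<phi>_iso by (simp add: hnn_data_def F.is_group)
  have "inj_on \<alpha> (carrier F)"
    using \<alpha>(1) by (simp add: iso_def bij_betw_def)
  then have \<phi>\<alpha>: "\<phi> (\<alpha> g) = \<beta> (\<tau> g)" if "g \<in> carrier F" for g
    using that by (simp add: \<phi>_def)
  have homs: "\<alpha> \<in> hom F F" "\<beta> \<in> hom F F"
    using \<alpha>(1) \<beta>(1) subs[THEN subgroup.subset] by (auto simp: iso_def intro: hom_into_restrict_carrier)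
  interpret \<alpha>: group_hom F F \<alpha>
    using homs by (simp add: group_hom_def group_hom_axioms_def F.is_group)
  interpret \<beta>: group_hom F F \<beta>
    using homs by (simp add: group_hom_def group_hom_axioms_def F.is_group)
  have \<phi>x1: "\<phi> x\<^sub>1 = inv\<^bsub>F\<^esub> x\<^sub>2 \<otimes>\<^bsub>F\<^esub> inv\<^bsub>F\<^esub> x\<^sub>1 \<otimes>\<^bsub>F\<^esub> inv\<^bsub>F\<^esub> x\<^sub>2 \<otimes>\<^bsub>F\<^esub> inv\<^bsub>F\<^esub> x\<^sub>1 \<otimes>\<^bsub>F\<^esub> x\<^sub>2"
    using \<phi>\<alpha>[of x\<^sub>1] closed by (simp add: \<alpha> \<beta> \<tau> F.group_normal_form)
  define w where "w = x\<^sub>1 [^]\<^bsub>F\<^esub> (2 :: int) \<otimes>\<^bsub>F\<^esub> x\<^sub>2 \<otimes>\<^bsub>F\<^esub> x\<^sub>1 \<otimes>\<^bsub>F\<^esub> x\<^sub>2"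
  have w: "w \<in> carrier F" "w = x\<^sub>1 \<otimes>\<^bsub>F\<^esub> x\<^sub>1 \<otimes>\<^bsub>F\<^esub> ?s"
    using closed by (simp_all add: w_def F.int_pow_2 F.m_assoc)
  have \<phi>w: "\<phi> w = x\<^sub>2"
    using \<phi>\<alpha>[of "x\<^sub>1 \<otimes>\<^bsub>F\<^esub> x\<^sub>1 \<otimes>\<^bsub>F\<^esub> x\<^sub>2"] closed
    by (simp add: w(2) \<alpha>(2,3) \<beta>(2,3) \<tau>(2,3) F.group_normal_form)

  have sw: "?s = inv\<^bsub>F\<^esub> x\<^sub>1 \<otimes>\<^bsub>F\<^esub> inv\<^bsub>F\<^esub> x\<^sub>1 \<otimes>\<^bsub>F\<^esub> w"
    using closed by (simp add: w(2) F.group_normal_form)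
  \<comment> \<open>The relations of \<open>G3\<close> speak about \<open>x_1\<close> and
    \<open>w\<close>, so \<open>A\<close> is described by these instead of its basis;
    \<open>w = x_1 x_1 s\<close> makes the exchange possible.\<close>
  have A_gen: "A = generate F {w, x\<^sub>1}"
  proof
    have "subgroup (generate F {w, x\<^sub>1}) F"
      using closed w(1) by (intro F.generate_is_subgroup) simp
    moreover have "?s \<in> generate F {w, x\<^sub>1}"
      unfolding sw by (intro generate.eng generate.inv generate.incl) auto
    ultimately show "A \<subseteq> generate F {w, x\<^sub>1}"
      unfolding A by (intro F.generate_subgroup_incl) (auto intro: generate.incl)
    have "w \<in> A"
      unfolding w(2) A by (intro generate.eng generate.incl) auto
    then show "generate F {w, x\<^sub>1} \<subseteq> A"
      by (intro F.generate_subgroup_incl subs) (auto simp: A intro: generate.incl)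
  qed

  interpret hnn_setting F A B \<phi> by unfold_locales (rule data)
  interpret E: group "hnn F A \<phi>" by (rule group_hnn)
  interpret P: group_presentation "{Hx1, Hx2, Hy}" G3_rels
    by unfold_locales (rule G3_rels_words)
  interpret G3: group G3 by (simp add: G3_def P.group_presentation)
  have g_closed: "G3_gen Hx1 \<in> carrier G3" "G3_gen Hx2 \<in> carrier G3" "G3_gen Hy \<in> carrier G3"
    by (simp_all add: G3_def G3_gen_def P.pres_gen_closed)
  have G3_generated: "generate G3 {G3_gen Hx1, G3_gen Hx2, G3_gen Hy} = carrier G3"
    using P.presentation_generated by (simp add: G3_def G3_gen_def)
  have "\<forall>(u, v) \<in> G3_rels. free_lift G3 G3_gen u = free_lift G3 G3_gen v"
    using P.presentation_relation by (auto simp: G3_def G3_gen_def[abs_def])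
  then have G3_relation:
    "inv\<^bsub>G3\<^esub> G3_gen Hy \<otimes>\<^bsub>G3\<^esub> G3_gen Hx1 \<otimes>\<^bsub>G3\<^esub> G3_gen Hy =
      inv\<^bsub>G3\<^esub> G3_gen Hx2 \<otimes>\<^bsub>G3\<^esub> inv\<^bsub>G3\<^esub> G3_gen Hx1 \<otimes>\<^bsub>G3\<^esub> inv\<^bsub>G3\<^esub> G3_gen Hx2 \<otimes>\<^bsub>G3\<^esub> inv\<^bsub>G3\<^esub> G3_gen Hx1 \<otimes>\<^bsub>G3\<^esub> G3_gen Hx2"
    "inv\<^bsub>G3\<^esub> G3_gen Hy \<otimes>\<^bsub>G3\<^esub> (G3_gen Hx1 [^]\<^bsub>G3\<^esub> (2 :: int) \<otimes>\<^bsub>G3\<^esub> G3_gen Hx2 \<otimes>\<^bsub>G3\<^esub> G3_gen Hx1 \<otimes>\<^bsub>G3\<^esub> G3_gen Hx2)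
      \<otimes>\<^bsub>G3\<^esub> G3_gen Hy = G3_gen Hx2"
    using G3.free_lift_G3_rels[of G3_gen] G3.rels_G3_iff[of "G3_gen Hx1" "G3_gen Hx2" "G3_gen Hy"] g_closed
    by simp_all

  define f where "f = free_lift G3 G3_gen"
  have f: "f \<in> hom F G3" "f x\<^sub>1 = G3_gen Hx1" "f x\<^sub>2 = G3_gen Hx2"
    using G3.free_lift_hom[of G3_gen "{Hx1, Hx2}"] g_closed
    by (simp_all add: f_def F x1 x2 G3.free_lift_gen)
  interpret f: group_hom F G3 f
    using f(1) by (simp add: group_hom_def group_hom_axioms_def F.is_group G3.is_group)
  have conj: "inv\<^bsub>G3\<^esub> G3_gen Hy \<otimes>\<^bsub>G3\<^esub> f c \<otimes>\<^bsub>G3\<^esub> G3_gen Hy = f (\<phi> c)" if "c \<in> A" for c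
  proof -
    \<comment> \<open>The HNN relations range over all of \<open>A\<close>. Both sides are
      homomorphisms in \<open>c\<close>, so the cases \<open>c = x_1\<close> and
      \<open>c = w\<close> suffice, and these are the two relations of \<open>G3\<close>.\<close>
    have "(\<lambda>c. inv\<^bsub>G3\<^esub> G3_gen Hy \<otimes>\<^bsub>G3\<^esub> f c \<otimes>\<^bsub>G3\<^esub> G3_gen Hy) c = (f \<circ> \<phi>) c"
    proof (rule hom_eq_on_generate[OF F.is_group G3.is_group])
      have "(\<lambda>c. inv\<^bsub>G3\<^esub> G3_gen Hy \<otimes>\<^bsub>G3\<^esub> f c \<otimes>\<^bsub>G3\<^esub> G3_gen Hy) \<in> hom F G3"
        by (rule homI) (use g_closed in \<open>simp_all add: G3.group_normal_form\<close>)
      then show "(\<lambda>c. inv\<^bsub>G3\<^esub> G3_gen Hy \<otimes>\<^bsub>G3\<^esub> f c \<otimes>\<^bsub>G3\<^esub> G3_gen Hy) \<in> hom (F\<lparr>carrier := generate F {w, x\<^sub>1}\<rparr>) G3"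
        by (rule hom_restrict_carrier) (use A_gen A_closed in auto)
      show "f \<circ> \<phi> \<in> hom (F\<lparr>carrier := generate F {w, x\<^sub>1}\<rparr>) G3"
        using Group.hom_compose[OF \<phi>_hom f(1)] by (simp add: A_gen)
      show "inv\<^bsub>G3\<^esub> G3_gen Hy \<otimes>\<^bsub>G3\<^esub> f c \<otimes>\<^bsub>G3\<^esub> G3_gen Hy = (f \<circ> \<phi>) c" if c: "c \<in> {w, x\<^sub>1}" for c
      proof (cases "c = x\<^sub>1")
        case True
        then show ?thesis
          using G3_relation(1) closed by (simp add: \<phi>x1 f(2,3))
      next
        case False
        then have "c = w" using c by simp
        moreover have "f w = G3_gen Hx1 [^]\<^bsub>G3\<^esub> (2 :: int) \<otimes>\<^bsub>G3\<^esub> G3_gen Hx2 \<otimes>\<^bsub>G3\<^esub> G3_gen Hx1 \<otimes>\<^bsub>G3\<^esub> G3_gen Hx2"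
          using closed by (simp add: w_def f(2,3) f.hom_int_pow)
        ultimately show ?thesis
          using G3_relation(2) by (simp add: \<phi>w f(3))
      qed
    qed (use that A_gen closed w in auto)
    then show ?thesis by simp
  qed
  obtain \<Phi> where \<Phi>: "\<Phi> \<in> hom (hnn F A \<phi>) G3" "\<Phi> (hnn_stable F A \<phi>) = G3_gen Hy"
      "\<And>c. c \<in> carrier F \<Longrightarrow> \<Phi> (hnn_in F A \<phi> c) = f c"
    using hnn_lift[OF G3.is_group f(1) g_closed(3) conj] by blast

  let ?E = "hnn F A \<phi>" and ?p = "hnn_in F A \<phi> x\<^sub>1" and ?q = "hnn_in F A \<phi> x\<^sub>2" and ?y = "hnn_stable F A \<phi>"
  have E_closed: "?p \<in> carrier ?E" "?q \<in> carrier ?E" "?y \<in> carrier ?E"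
    using closed by (auto intro: hnn_in_closed hnn_stable_closed)
  interpret in_hom: group_hom F ?E "hnn_in F A \<phi>"
    using hnn_in_hom by (simp add: group_hom_def group_hom_axioms_def F.is_group E.is_group)
  have "x\<^sub>1 \<in> A" "w \<in> A"
    using A_gen by (auto intro: generate.incl)
  then have "inv\<^bsub>?E\<^esub> ?y \<otimes>\<^bsub>?E\<^esub> ?p \<otimes>\<^bsub>?E\<^esub> ?y = hnn_in F A \<phi> (\<phi> x\<^sub>1)"
    "inv\<^bsub>?E\<^esub> ?y \<otimes>\<^bsub>?E\<^esub> hnn_in F A \<phi> w \<otimes>\<^bsub>?E\<^esub> ?y = ?q"
    using hnn_relation[of x\<^sub>1] hnn_relation[of w] by (simp_all add: \<phi>w)
  moreover have "hnn_in F A \<phi> (\<phi> x\<^sub>1) = inv\<^bsub>?E\<^esub> ?q \<otimes>\<^bsub>?E\<^esub> inv\<^bsub>?E\<^esub> ?p \<otimes>\<^bsub>?E\<^esub> inv\<^bsub>?E\<^esub> ?q \<otimes>\<^bsub>?E\<^esub> inv\<^bsub>?E\<^esub> ?p \<otimes>\<^bsub>?E\<^esub> ?q"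
    using closed by (simp add: \<phi>x1)
  moreover have "hnn_in F A \<phi> w = ?p [^]\<^bsub>?E\<^esub> (2 :: int) \<otimes>\<^bsub>?E\<^esub> ?q \<otimes>\<^bsub>?E\<^esub> ?p \<otimes>\<^bsub>?E\<^esub> ?q"
    using closed by (simp add: w_def in_hom.hom_int_pow)
  ultimately have E_relation: "\<forall>(u, v) \<in> rels_G3 ?E ?p ?q ?y. u = v"
    using E.rels_G3_iff[OF E_closed] by simp
  let ?g = "case_gen_xxy ?p ?q ?y"
  have g_rel: "\<forall>(u, v) \<in> G3_rels. free_lift ?E ?g u = free_lift ?E ?g v"
    using E.free_lift_G3_rels[of ?g] E_closed E_relation by simp
  obtain \<Theta> where "\<Theta> \<in> hom (presentation {Hx1, Hx2, Hy} G3_rels) ?E"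
      "\<And>s. s \<in> {Hx1, Hx2, Hy} \<Longrightarrow> \<Theta> (pres_gen {Hx1, Hx2, Hy} G3_rels s) = ?g s"
    by (rule P.presentation_lift[OF E.is_group, of ?g]) (use E_closed g_rel in auto)
  then have \<Theta>: "\<Theta> \<in> hom G3 ?E" "\<Theta> (G3_gen Hx1) = ?p" "\<Theta> (G3_gen Hx2) = ?q" "\<Theta> (G3_gen Hy) = ?y"
    by (simp_all add: G3_def G3_gen_def)
  \<comment> \<open>The HNN-extension has every element of \<open>F\<close> as a generator, so the
    composite must be known on all of \<open>F\<close>; it is determined by \<open>x_1\<close> and
    \<open>x_2\<close>.\<close>
  have \<Theta>f: "\<Theta> (f c) = hnn_in F A \<phi> c" if "c \<in> carrier F" for c
  proof -
    have "(\<Theta> \<circ> f) c = hnn_in F A \<phi> c"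
      by (rule hom_eq_on_carrier[OF F.is_group E.is_group _ F_gen Group.hom_compose[OF f(1) \<Theta>(1)] hnn_in_hom])
        (use closed that in \<open>auto simp: f(2,3) \<Theta>\<close>)
    then show ?thesis by simp
  qed
  have "group_isomorphisms ?E G3 \<Phi> \<Theta>"
  proof (rule group_isomorphismsI_generators[OF E.is_group G3.is_group _ hnn_generated _ G3_generated \<Phi>(1) \<Theta>(1)])
    show "insert ?y (hnn_in F A \<phi> ` carrier F) \<subseteq> carrier ?E"
      using E_closed(3) hnn_in_closed by blast
    show "\<Theta> (\<Phi> e) = e" if "e \<in> insert ?y (hnn_in F A \<phi> ` carrier F)" for e
      using that by (auto simp del: in_hom.hom_closed simp: \<Phi>(2,3) \<Theta>(4) \<Theta>f)
    show "\<Phi> (\<Theta> e) = e" if "e \<in> {G3_gen Hx1, G3_gen Hx2, G3_gen Hy}" for e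
      using that \<Phi>(2) \<Phi>(3)[OF closed(1)] \<Phi>(3)[OF closed(2)] \<Theta>(2-4) f(2,3) by auto
  qed (use g_closed in simp)
  then have "\<Phi> \<in> iso ?E G3"
    by (rule group_isomorphisms_imp_iso)
  then have "\<exists>\<Phi> \<in> iso ?E G3. \<Phi> ?p = G3_gen Hx1 \<and> \<Phi> ?q = G3_gen Hx2 \<and> \<Phi> ?y = G3_gen Hy"
    using \<Phi>(2) \<Phi>(3)[OF closed(1)] \<Phi>(3)[OF closed(2)] f(2,3) by (intro bexI[of _ \<Phi>]) simp_all
  moreover have F_F2: "F \<cong> F2"
    unfolding F by (rule free_group_pair_iso_F2) simp
  moreover have "F \<cong> F\<lparr>carrier := A\<rparr>" "F \<cong> F\<lparr>carrier := B\<rparr>"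
    using \<alpha>(1) \<beta>(1) unfolding is_iso_def by blast+
  then have "F\<lparr>carrier := A\<rparr> \<cong> F2" "F\<lparr>carrier := B\<rparr> \<cong> F2"
    using iso_trans[OF F.iso_sym F_F2] by blast+
  ultimately show ?thesis
    using data \<phi>x1 \<phi>w unfolding w_def by blast
qed


theorem theorem3p1:
  fixes r :: int
  assumes "r > 0"
  shows
   "(let G = G1 r; x = G1_gen r Gx; y = G1_gen r Gy;
         H = generate G (range (shift G x y));
         A = chain_factor (rels_A1 r); a = factor_gen (rels_A1 r);
         B = edge_in (rels_A1 r); C = edge_out (rels_A1 r)
     in internal_semidirect G H (generate G {y}) \<and> infinite_cyclic_on G y \<and>
        (\<exists>\<phi>. amalgam_data A B C \<phi> \<and>
             (\<forall>i. \<phi> i (a i i) = a (i + 1) i \<and> \<phi> i (a i (i + 1)) = a (i + 1) (i + 1)) \<and>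
             (\<exists>\<Phi> \<in> iso (amalgam A B \<phi>) (G\<lparr>carrier := H\<rparr>).
                \<forall>i. \<forall>j \<in> {i - 1, i, i + 1}. \<Phi> (amalgam_in A B \<phi> i (a i j)) = shift G x y j)) \<and>
        (\<forall>i. (A i)\<lparr>carrier := B i\<rparr> \<cong> F2 \<and> (A (i + 1))\<lparr>carrier := C i\<rparr> \<cong> F2) \<and>
        (\<forall>\<epsilon> \<in> {1, - 1}. r = \<epsilon> \<longrightarrow>
           (\<forall>i. let u = a i i;
                    v = a i (i - 1) [^]\<^bsub>A i\<^esub> \<epsilon> \<otimes>\<^bsub>A i\<^esub> a i (i + 1) [^]\<^bsub>A i\<^esub> \<epsilon>;
                    w = a i (i + 1);
                    P = (A i)\<lparr>carrier := generate (A i) {u}\<rparr> \<times>\<times> (A i)\<lparr>carrier := generate (A i) {v}\<rparr>;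
                    Q = (A i)\<lparr>carrier := generate (A i) {w}\<rparr>
                in infinite_cyclic_on (A i) u \<and> infinite_cyclic_on (A i) v \<and>
                   infinite_cyclic_on (A i) w \<and>
                   (\<exists>\<psi> \<in> iso (free_product P Q) (A i).
                      (\<forall>p \<in> carrier P. \<psi> (fp_in1 P Q p) = fst p \<otimes>\<^bsub>A i\<^esub> snd p) \<and>
                      (\<forall>q \<in> carrier Q. \<psi> (fp_in2 P Q q) = q)) \<and>
                   A i \<cong> free_product (integer_group \<times>\<times> integer_group) integer_group)))
    \<and>
    (let G = G2; x = G2_gen Gx; y = G2_gen Gy;
         H = generate G (range (shift G x y));
         A = chain_factor rels_A2; a = factor_gen rels_A2;
         B = edge_in rels_A2; C = edge_out rels_A2
     in internal_semidirect G H (generate G {y}) \<and> infinite_cyclic_on G y \<and>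
        (\<exists>\<phi>. amalgam_data A B C \<phi> \<and>
             (\<forall>i. \<phi> i (a i i) = a (i + 1) i \<and> \<phi> i (a i (i + 1)) = a (i + 1) (i + 1)) \<and>
             (\<exists>\<Phi> \<in> iso (amalgam A B \<phi>) (G\<lparr>carrier := H\<rparr>).
                \<forall>i. \<forall>j \<in> {i - 1, i, i + 1}. \<Phi> (amalgam_in A B \<phi> i (a i j)) = shift G x y j)) \<and>
        (\<forall>i. (A i)\<lparr>carrier := B i\<rparr> \<cong> F2 \<and> (A (i + 1))\<lparr>carrier := C i\<rparr> \<cong> F2))
    \<and>
    (let F = free_group {Hx1, Hx2}; x\<^sub>1 = free_gen Hx1; x\<^sub>2 = free_gen Hx2;
         A = generate F {x\<^sub>2 \<otimes>\<^bsub>F\<^esub> x\<^sub>1 \<otimes>\<^bsub>F\<^esub> x\<^sub>2, x\<^sub>1};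
         B = generate F {x\<^sub>1 \<otimes>\<^bsub>F\<^esub> x\<^sub>2 \<otimes>\<^bsub>F\<^esub> x\<^sub>1, x\<^sub>2}
     in F \<cong> F2 \<and> F\<lparr>carrier := A\<rparr> \<cong> F2 \<and> F\<lparr>carrier := B\<rparr> \<cong> F2 \<and>
        (\<exists>\<phi>. hnn_data F A B \<phi> \<and>
             \<phi> x\<^sub>1 = inv\<^bsub>F\<^esub> x\<^sub>2 \<otimes>\<^bsub>F\<^esub> inv\<^bsub>F\<^esub> x\<^sub>1 \<otimes>\<^bsub>F\<^esub> inv\<^bsub>F\<^esub> x\<^sub>2 \<otimes>\<^bsub>F\<^esub> inv\<^bsub>F\<^esub> x\<^sub>1 \<otimes>\<^bsub>F\<^esub> x\<^sub>2 \<and>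
             \<phi> (x\<^sub>1 [^]\<^bsub>F\<^esub> (2 :: int) \<otimes>\<^bsub>F\<^esub> x\<^sub>2 \<otimes>\<^bsub>F\<^esub> x\<^sub>1 \<otimes>\<^bsub>F\<^esub> x\<^sub>2) = x\<^sub>2 \<and>
             (\<exists>\<Phi> \<in> iso (hnn F A \<phi>) G3.
                \<Phi> (hnn_in F A \<phi> x\<^sub>1) = G3_gen Hx1 \<and> \<Phi> (hnn_in F A \<phi> x\<^sub>2) = G3_gen Hx2 \<and>
                \<Phi> (hnn_stable F A \<phi>) = G3_gen Hy)))"
proof -
  note G1 = G1_semidirect_amalgam[OF refl refl refl refl refl refl refl refl, of r]
  note G2 = G2_semidirect_amalgam[OF refl refl refl refl refl refl refl refl]
  note G3 = G3_hnn[OF refl refl refl refl refl]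
  show ?thesis
    unfolding Let_def
  proof (intro conjI[OF _ conjI[OF G2 G3]], goal_cases)
    case 1
    from G1 show ?case
    proof (elim conjE, intro conjI, goal_cases)
      case 5
      show ?case
      proof (intro ballI impI allI, goal_cases)
        case (1 \<epsilon> i)
        \<comment> \<open>Positivity of \<open>r\<close> excludes \<open>\<epsilon> = -1\<close>,
          which leaves the decomposition for exponent \<open>1\<close>.\<close>
        then have eqs: "\<epsilon> = 1" "r = 1" using assms by auto
        interpret chain: factor_chain "rels_A1 1" by (rule factor_chain_A1)
        interpret A: group "chain_factor (rels_A1 1) i" by (rule chain.group_factor)
        have v: "factor_gen (rels_A1 1) i (i - 1) [^]\<^bsub>chain_factor (rels_A1 1) i\<^esub> (1 :: int)
              \<otimes>\<^bsub>chain_factor (rels_A1 1) i\<^esub>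
              factor_gen (rels_A1 1) i (i + 1) [^]\<^bsub>chain_factor (rels_A1 1) i\<^esub> (1 :: int)
            = factor_gen (rels_A1 1) i (i - 1) \<otimes>\<^bsub>chain_factor (rels_A1 1) i\<^esub> factor_gen (rels_A1 1) i (i + 1)"
          using chain.factor_gen_closed[of _ i] by simp
        show ?case
          unfolding eqs by (rule A1_free_product[OF refl refl v refl refl refl])
      qed
    qed assumption+
  qed
qed

end
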